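(* Let $M=(M^2,\varphi)$ be a two-dimensional monochromatic (possibly Riemannian) Finsler manifold, $p\in M$, and let $f_i\colon M\to V_i$, $i=1,2$, be smooth isometric embeddings where $V_1$ and $V_2$ are $3$-dimensional Banach-Minkowski spaces. Then the second fundamental forms of $f_1$ and $f_2$ at $p$ are of the same type: either both are definite, or both are indefinite, or both are degenerate.
   Context: "Smooth" means $C^\infty$. A norm on a real vector space $V$ is a subadditive, positively homogeneous function $\Phi\colon V\to[0,\infty)$, positive on $V\setminus\{0\}$, not required to be symmetric. A Banach-Minkowski norm is a norm that is smooth on $V\setminus\{0\}$ and such that $\Phi^2$ is quadratically strictly convex (second differential positive definite at every $v\neq0$). A Banach-Minkowski space is a finite-dimensional vector space with a Banach-Minkowski norm. A Finsler manifold $(M,\varphi)$ is a smooth manifold with a continuous $\varphi\colon TM\to[0,\infty)$, smooth on $TM$ minus the zero section, whose restriction to each $T_xM$ is a Banach-Minkowski norm. It is Riemannian if each $\varphi|_{T_xM}$ is a Euclidean norm (comes from an inner product). It is monochromatic if all tangent spaces $(T_xM,\varphi|_{T_xM})$ are isometric to each other as normed vector spaces. A smooth embedding $f\colon M\to (V,\Phi)$ is isometric if $\Phi(d_xf(v))=\varphi(v)$ for all $x\in M$, $v\in T_xM$. The second fundamental form of a smooth immersion $f\colon M\to V$ at $p$ is the symmetric bilinear form on $T_pM$ with values in $V/\operatorname{Im}d_pf$ defined as the Hessian at $p$ of $\pi\circ f$, where $\pi\colon V\to V/\operatorname{Im}d_pf$ is the quotient map. Here the quotient is one-dimensional and the form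 is regarded as real-valued up to a nonzero constant factor. It is definite if it is positive definite or negative definite, indefinite if its quadratic form takes both positive and negative values, and degenerate if it has a nontrivial kernel (the zero form is degenerate). *)

theory Defs
  imports "HOL-Analysis.Analysis"
begin

section \<open>Smooth functions on open subsets of Euclidean spaces\<close>

text \<open>Only meaningful for open sets \<open>S\<close>.  Continuity of all iterated directional derivatives is
  the same as being \<open>C\<^sup>k\<close>, since the domain is finite-dimensional.\<close>

primrec Ck_on :: "nat \<Rightarrow> ('a::euclidean_space \<Rightarrow> 'b::real_normed_vector) \<Rightarrow> 'a set \<Rightarrow> bool" where
  "Ck_on 0 f S \<longleftrightarrow> continuous_on S f"
| "Ck_on (Suc n) f S \<longleftrightarrow>
     (\<forall>x\<in>S. f differentiable (at x)) \<and> (\<forall>v. Ck_on n (\<lambda>x. frechet_derivative f (at x) v) S)"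

definition smooth_on :: "('a::euclidean_space \<Rightarrow> 'b::real_normed_vector) \<Rightarrow> 'a set \<Rightarrow> bool" where
  "smooth_on f S \<longleftrightarrow> (\<forall>n. Ck_on n f S)"

definition second_differential ::
    "('a::euclidean_space \<Rightarrow> 'b::real_normed_vector) \<Rightarrow> 'a \<Rightarrow> 'a \<Rightarrow> 'a \<Rightarrow> 'b" where
  "second_differential f x v w =
     frechet_derivative (\<lambda>y. frechet_derivative f (at y) w) (at x) v"

section \<open>Banach-Minkowski norms\<close>

definition asym_norm :: "('v::real_vector \<Rightarrow> real) \<Rightarrow> bool" where
  "asym_norm \<Phi> \<longleftrightarrow>
     (\<forall>v. 0 \<le> \<Phi> v) \<and>
     (\<forall>v w. \<Phi> (v + w) \<le> \<Phi> v + \<Phi> w) \<and>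
     (\<forall>t v. 0 \<le> t \<longrightarrow> \<Phi> (t *\<^sub>R v) = t * \<Phi> v) \<and>
     (\<forall>v. v \<noteq> 0 \<longrightarrow> 0 < \<Phi> v)"

definition banach_minkowski_norm :: "('v::euclidean_space \<Rightarrow> real) \<Rightarrow> bool" where
  "banach_minkowski_norm \<Phi> \<longleftrightarrow>
     asym_norm \<Phi> \<and>
     smooth_on \<Phi> (- {0}) \<and>
     (\<forall>v w. v \<noteq> 0 \<longrightarrow> w \<noteq> 0 \<longrightarrow> 0 < second_differential (\<lambda>u. (\<Phi> u)\<^sup>2) v w w)"

section \<open>Smooth manifolds\<close>

text \<open>A chart is its domain together with its coordinate map, whose values outside the domain
  are irrelevant.  An atlas need not be maximal.\<close>

type_synonym ('m, 'e) chart = "'m set \<times> ('m \<Rightarrow> 'e)"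

abbreviation chart_inv :: "('m, 'e) chart \<Rightarrow> 'e \<Rightarrow> 'm" where
  "chart_inv k \<equiv> inv_into (fst k) (snd k)"

definition is_chart :: "('m::topological_space, 'e::euclidean_space) chart \<Rightarrow> bool" where
  "is_chart k \<longleftrightarrow>
     open (fst k) \<and> open (snd k ` fst k) \<and>
     homeomorphism (fst k) (snd k ` fst k) (snd k) (chart_inv k)"

definition smooth_manifold ::
    "'m::{t2_space, second_countable_topology} set \<Rightarrow> ('m, 'e::euclidean_space) chart set \<Rightarrow> bool"
  where
  "smooth_manifold M A \<longleftrightarrow>
     (\<forall>k\<in>A. is_chart k) \<and>
     (\<Union>k\<in>A. fst k) = M \<and>
     (\<forall>k\<in>A. \<forall>l\<in>A. smooth_on (snd l \<circ> chart_inv k) (snd k ` (fst k \<inter> fst l)))"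

section \<open>Tangent vectors\<close>

text \<open>A tangent vector at \<open>p\<close> is the family of its coordinate vectors in all charts of the atlas
  around \<open>p\<close>, related by the differentials of the transition maps; it is extended by \<open>0\<close> to the
  other charts.  The vector space operations are pointwise.\<close>

type_synonym ('m, 'e) tangent_vector = "('m, 'e) chart \<Rightarrow> 'e"

definition tangent_space ::
    "('m, 'e::euclidean_space) chart set \<Rightarrow> 'm \<Rightarrow> ('m, 'e) tangent_vector set" where
  "tangent_space A p = {\<xi>.
     (\<forall>k. k \<notin> A \<or> p \<notin> fst k \<longrightarrow> \<xi> k = 0) \<and>
     (\<forall>k\<in>A. \<forall>l\<in>A. p \<in> fst k \<longrightarrow> p \<in> fst l \<longrightarrow>
        \<xi> l = frechet_derivative (snd l \<circ> chart_inv k) (at (snd k p)) (\<xi> k))}"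

definition tangent_bundle ::
    "'m set \<Rightarrow> ('m, 'e::euclidean_space) chart set \<Rightarrow> ('m \<times> ('m, 'e) tangent_vector) set" where
  "tangent_bundle M A = Sigma M (tangent_space A)"

text \<open>For \<open>k \<in> A\<close> around \<open>p\<close>, this is the element of \<open>tangent_space A p\<close> whose coordinate vector
  in the chart \<open>k\<close> is \<open>v\<close>.\<close>

definition tangent_of_coords ::
    "('m, 'e::euclidean_space) chart set \<Rightarrow> 'm \<Rightarrow> ('m, 'e) chart \<Rightarrow> 'e \<Rightarrow> ('m, 'e) tangent_vector"
  where
  "tangent_of_coords A p k v = (\<lambda>l.
     if l \<in> A \<and> p \<in> fst l then frechet_derivative (snd l \<circ> chart_inv k) (at (snd k p)) v else 0)"

section \<open>Finsler manifolds\<close>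

text \<open>The smooth structure of the tangent bundle is given by the bundle charts induced by the
  charts of the base.  That the restriction to a tangent space is a Banach-Minkowski norm is
  expressed through the linear isomorphisms between that space and \<open>'e\<close> given by the charts.\<close>

definition finsler_metric ::
    "'m set \<Rightarrow> ('m, 'e::euclidean_space) chart set \<Rightarrow> ('m \<times> ('m, 'e) tangent_vector \<Rightarrow> real) \<Rightarrow> bool"
  where
  "finsler_metric M A \<phi> \<longleftrightarrow>
     (\<forall>z\<in>tangent_bundle M A. 0 \<le> \<phi> z) \<and>
     (\<forall>k\<in>A.
        let F = (\<lambda>(x, v). \<phi> (chart_inv k x, tangent_of_coords A (chart_inv k x) k v)) in
        continuous_on ((snd k ` fst k) \<times> UNIV) F \<and>
        smooth_on F ((snd k ` fst k) \<times> (- {0}))) \<and>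
     (\<forall>p\<in>M. \<forall>k\<in>A. p \<in> fst k \<longrightarrow>
        banach_minkowski_norm (\<lambda>v. \<phi> (p, tangent_of_coords A p k v)))"

definition finsler_manifold ::
    "'m::{t2_space, second_countable_topology} set \<Rightarrow> ('m, 'e::euclidean_space) chart set \<Rightarrow>
      ('m \<times> ('m, 'e) tangent_vector \<Rightarrow> real) \<Rightarrow> bool" where
  "finsler_manifold M A \<phi> \<longleftrightarrow> smooth_manifold M A \<and> finsler_metric M A \<phi>"

definition isometric_tangent_spaces ::
    "('m, 'e::euclidean_space) chart set \<Rightarrow> ('m \<times> ('m, 'e) tangent_vector \<Rightarrow> real) \<Rightarrow>
      'm \<Rightarrow> 'm \<Rightarrow> bool" where
  "isometric_tangent_spaces A \<phi> p q \<longleftrightarrow>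
     (\<exists>L. bij_betw L (tangent_space A p) (tangent_space A q) \<and>
        (\<forall>\<xi>\<in>tangent_space A p. \<forall>\<eta>\<in>tangent_space A p.
           L (\<lambda>k. \<xi> k + \<eta> k) = (\<lambda>k. L \<xi> k + L \<eta> k)) \<and>
        (\<forall>c. \<forall>\<xi>\<in>tangent_space A p. L (\<lambda>k. c *\<^sub>R \<xi> k) = (\<lambda>k. c *\<^sub>R L \<xi> k)) \<and>
        (\<forall>\<xi>\<in>tangent_space A p. \<phi> (q, L \<xi>) = \<phi> (p, \<xi>)))"

definition monochromatic ::
    "'m set \<Rightarrow> ('m, 'e::euclidean_space) chart set \<Rightarrow> ('m \<times> ('m, 'e) tangent_vector \<Rightarrow> real) \<Rightarrow> bool"
  where
  "monochromatic M A \<phi> \<longleftrightarrow> (\<forall>p\<in>M. \<forall>q\<in>M. isometric_tangent_spaces A \<phi> p q)"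

section \<open>Isometric embeddings\<close>

text \<open>An arbitrary chart around \<open>p\<close>; it is used below only for notions that do not depend on
  the chart.\<close>

definition chart_at :: "('m, 'e) chart set \<Rightarrow> 'm \<Rightarrow> ('m, 'e) chart" where
  "chart_at A p = (SOME k. k \<in> A \<and> p \<in> fst k)"

definition smooth_map ::
    "('m, 'e::euclidean_space) chart set \<Rightarrow> ('m \<Rightarrow> 'v::euclidean_space) \<Rightarrow> bool" where
  "smooth_map A f \<longleftrightarrow> (\<forall>k\<in>A. smooth_on (f \<circ> chart_inv k) (snd k ` fst k))"

definition differential ::
    "('m, 'e::euclidean_space) chart set \<Rightarrow> ('m \<Rightarrow> 'v::euclidean_space) \<Rightarrow> 'm \<Rightarrow>
      ('m, 'e) tangent_vector \<Rightarrow> 'v" where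
  "differential A f p \<xi> =
     (let k = chart_at A p in frechet_derivative (f \<circ> chart_inv k) (at (snd k p)) (\<xi> k))"

definition smooth_immersion ::
    "'m set \<Rightarrow> ('m, 'e::euclidean_space) chart set \<Rightarrow> ('m \<Rightarrow> 'v::euclidean_space) \<Rightarrow> bool" where
  "smooth_immersion M A f \<longleftrightarrow>
     smooth_map A f \<and> (\<forall>p\<in>M. inj_on (differential A f p) (tangent_space A p))"

definition smooth_embedding ::
    "'m::topological_space set \<Rightarrow> ('m, 'e::euclidean_space) chart set \<Rightarrow>
      ('m \<Rightarrow> 'v::euclidean_space) \<Rightarrow> bool" where
  "smooth_embedding M A f \<longleftrightarrow>
     smooth_immersion M A f \<and> homeomorphism M (f ` M) f (inv_into M f)"

definition isometric_embedding ::
    "'m::topological_space set \<Rightarrow> ('m, 'e::euclidean_space) chart set \<Rightarrow>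
      ('m \<times> ('m, 'e) tangent_vector \<Rightarrow> real) \<Rightarrow> ('v::euclidean_space \<Rightarrow> real) \<Rightarrow> ('m \<Rightarrow> 'v) \<Rightarrow> bool"
  where
  "isometric_embedding M A \<phi> \<Phi> f \<longleftrightarrow>
     smooth_embedding M A f \<and>
     (\<forall>x\<in>M. \<forall>\<xi>\<in>tangent_space A x. \<Phi> (differential A f x \<xi>) = \<phi> (x, \<xi>))"

section \<open>The second fundamental form\<close>

text \<open>A linear functional onto the reals with kernel \<open>S\<close> is the quotient map modulo \<open>S\<close> followed by
  an identification of the one-dimensional quotient with the reals.  Such a functional is unique
  up to a nonzero factor.\<close>

definition quotient_map_to_real :: "'v::euclidean_space set \<Rightarrow> ('v \<Rightarrow> real) \<Rightarrow> bool" where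
  "quotient_map_to_real S \<pi> \<longleftrightarrow> linear \<pi> \<and> surj \<pi> \<and> {v. \<pi> v = 0} = S"

text \<open>The Hessian of a real function at \<open>p\<close>; it does not depend on the chart if the differential
  of \<open>g\<close> at \<open>p\<close> vanishes, which is the only case in which it is used.\<close>

definition hessian ::
    "('m, 'e::euclidean_space) chart set \<Rightarrow> ('m \<Rightarrow> real) \<Rightarrow> 'm \<Rightarrow>
      ('m, 'e) tangent_vector \<Rightarrow> ('m, 'e) tangent_vector \<Rightarrow> real" where
  "hessian A g p \<xi> \<eta> =
     (let k = chart_at A p in second_differential (g \<circ> chart_inv k) (snd k p) (\<xi> k) (\<eta> k))"

definition second_fundamental_form_of ::
    "('m, 'e::euclidean_space) chart set \<Rightarrow> ('m \<Rightarrow> 'v::euclidean_space) \<Rightarrow> 'm \<Rightarrow>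
      (('m, 'e) tangent_vector \<Rightarrow> ('m, 'e) tangent_vector \<Rightarrow> real) \<Rightarrow> bool" where
  "second_fundamental_form_of A f p h \<longleftrightarrow>
     (\<exists>\<pi>. quotient_map_to_real (differential A f p ` tangent_space A p) \<pi> \<and>
          h = hessian A (\<pi> \<circ> f) p)"

text \<open>Types of a symmetric bilinear form \<open>h\<close> on a tangent space \<open>T\<close>, whose zero is \<open>\<lambda>_. 0\<close>.\<close>

definition definite_form ::
    "('m, 'e::euclidean_space) tangent_vector set \<Rightarrow>
      (('m, 'e) tangent_vector \<Rightarrow> ('m, 'e) tangent_vector \<Rightarrow> real) \<Rightarrow> bool" where
  "definite_form T h \<longleftrightarrow>
     (\<forall>\<xi>\<in>T. \<xi> \<noteq> (\<lambda>_. 0) \<longrightarrow> 0 < h \<xi> \<xi>) \<or> (\<forall>\<xi>\<in>T. \<xi> \<noteq> (\<lambda>_. 0) \<longrightarrow> h \<xi> \<xi> < 0)"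

definition indefinite_form ::
    "('m, 'e::euclidean_space) tangent_vector set \<Rightarrow>
      (('m, 'e) tangent_vector \<Rightarrow> ('m, 'e) tangent_vector \<Rightarrow> real) \<Rightarrow> bool" where
  "indefinite_form T h \<longleftrightarrow> (\<exists>\<xi>\<in>T. 0 < h \<xi> \<xi>) \<and> (\<exists>\<xi>\<in>T. h \<xi> \<xi> < 0)"

definition degenerate_form ::
    "('m, 'e::euclidean_space) tangent_vector set \<Rightarrow>
      (('m, 'e) tangent_vector \<Rightarrow> ('m, 'e) tangent_vector \<Rightarrow> real) \<Rightarrow> bool" where
  "degenerate_form T h \<longleftrightarrow> (\<exists>\<xi>\<in>T. \<xi> \<noteq> (\<lambda>_. 0) \<and> (\<forall>\<eta>\<in>T. h \<xi> \<eta> = 0))"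

end

theory Submission
  imports Defs
begin

text \<open>
  Let \<open>B = \<Phi>\<^sup>2\<close>, let \<open>F\<close> be an embedding read in a chart and put \<open>q x v = B (DF x v)\<close>, which depends on
  the intrinsic metric only.  Write \<open>h\<close> for the second fundamental form.

  If the tangent norms are not Euclidean, no nonzero linear or quadratic vector field annihilates
  \<open>q x\<close>.  Monochromaticity gives linear maps \<open>T u\<close> with \<open>\<partial>\<^sub>u q x v = Dq x v (T u v)\<close>.  Comparing this with
  \<open>\<partial>\<^sub>u q x v = DB (D\<^sup>2F u v)\<close> shows that, where \<open>h\<close> is nondegenerate, there is a transversal \<open>N\<close>
  that \<open>DB\<close> annihilates at every tangent vector, so that \<open>T\<close> is a symmetric connection with
  \<open>D\<^sup>2F = DF T + h N\<close>.  Differentiating once more, \<open>D\<^sup>2B N N * h u v * h w v = Dq x v (E w u v)\<close>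
  with a trilinear \<open>E\<close>, and the absence of quadratic fields forces \<open>E = 0\<close>, hence \<open>h = 0\<close>, a
  contradiction.  So \<open>h\<close> is degenerate for every embedding.

  If the tangent norms are Euclidean, a transversal \<open>N\<close> with the same property exists unless \<open>h\<close> and its
  derivative both vanish at the point, because \<open>h u v * DB n\<close> is quadratic in \<open>v\<close>.  The classical
  computation then yields a Gauss equation \<open>k * det h = K\<close> with \<open>k > 0\<close> and \<open>K\<close> determined by the
  metric, although \<open>\<Phi>\<close> need not be Euclidean away from the tangent plane.
\<close>

section \<open>Calculus\<close>

text \<open>The obstacle is regularity. Monochromaticity supplies a linear isometry between any two
  tangent spaces but says nothing about its dependence on the points, and the connection found where
  \<open>h\<close> is nondegenerate is likewise given point by point. Both are differentiated along
  sequences: rescaled differences subconverge by compactness, and the limit keeps a nonzero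
  component in the direction of motion because a non-Euclidean norm has no infinitesimal isometry. A
  Euclidean norm has rotations, so this argument breaks down for it; there the base derivatives are
  controlled directly, since a quadratic form is determined by three of its values.

  The equation \<open>E = 0\<close> arises in two stages. The factor \<open>h u v\<close> makes
  \<open>E w u v\<close> equal to \<open>h u v\<close> times a vector \<open>e w\<close>; symmetry
  in \<open>w\<close> and \<open>u\<close>, with \<open>h\<close> nondegenerate, then leaves
  \<open>e = 0\<close>.

  In dimension two the sign of the determinant decides the type of a form. Signs are all that can be
  compared, because \<open>k\<close> depends on the ambient norm.\<close>

lemma second_difference_bound:
  fixes f :: "'a::real_normed_vector \<Rightarrow> real"
  assumes S: "open S" "x0 \<in> S"
    and D: "\<forall>x\<in>S. (f has_derivative D x) (at x)"
    and Du: "((\<lambda>x. D x u) has_derivative Du) (at x0)"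
    and "0 < \<epsilon>"
  shows "eventually (\<lambda>t. \<bar>f (x0 + t *\<^sub>R u + t *\<^sub>R w) - f (x0 + t *\<^sub>R u) - f (x0 + t *\<^sub>R w) + f x0 - t\<^sup>2 * Du w\<bar>
            \<le> t\<^sup>2 * (\<epsilon> * (2 * norm u + norm w))) (at_right 0)"
proof -
  interpret Du: bounded_linear Du using Du by (rule has_derivative_bounded_linear)
  obtain r where r: "r > 0" "ball x0 r \<subseteq> S" using S by (auto simp: open_contains_ball)
  obtain d where d: "d > 0" "\<And>y. norm (y - x0) < d \<Longrightarrow> \<bar>D y u - D x0 u - Du (y - x0)\<bar> \<le> \<epsilon> * norm (y - x0)"
  proof -
    have "\<forall>e>0. \<exists>d>0. \<forall>y. norm (y - x0) < d \<longrightarrow> norm (D y u - D x0 u - Du (y - x0)) \<le> e * norm (y - x0)"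
      using Du unfolding has_derivative_at_alt by simp
    from this[rule_format, OF \<open>0 < \<epsilon>\<close>] obtain d
      where "d > 0" "\<forall>y. norm (y - x0) < d \<longrightarrow> norm (D y u - D x0 u - Du (y - x0)) \<le> \<epsilon> * norm (y - x0)"
      by (elim exE conjE)
    then show ?thesis using that[of d] by simp
  qed
  define m where "m = min r d / (norm u + norm w + 1)"
  have np: "norm u + norm w + 1 > 0" by (intro add_nonneg_pos add_nonneg_nonneg) auto
  have m: "m > 0" unfolding m_def using r d np by auto
  have main: "\<bar>f (x0 + t *\<^sub>R u + t *\<^sub>R w) - f (x0 + t *\<^sub>R u) - f (x0 + t *\<^sub>R w) + f x0 - t\<^sup>2 * Du w\<bar>
            \<le> t\<^sup>2 * (\<epsilon> * (2 * norm u + norm w))" if t: "0 < t" "t < m" for t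
  proof -
    have small: "norm (a *\<^sub>R u + b *\<^sub>R w) < min r d" if "0 \<le> a" "a \<le> t" "0 \<le> b" "b \<le> t" for a b
    proof -
      have "norm (a *\<^sub>R u + b *\<^sub>R w) \<le> a * norm u + b * norm w"
        using norm_triangle_ineq[of "a *\<^sub>R u" "b *\<^sub>R w"] that by simp
      also have "\<dots> \<le> t * norm u + t * norm w" using that by (intro add_mono mult_right_mono) auto
      also have "\<dots> < t * (norm u + norm w + 1)" using t by (simp add: algebra_simps)
      also have "\<dots> < m * (norm u + norm w + 1)" using t np by simp
      also have "\<dots> = min r d" unfolding m_def using np by (simp add: field_simps)
      finally show ?thesis .
    qed
    have inS: "x0 + a *\<^sub>R u + b *\<^sub>R w \<in> S" if "0 \<le> a" "a \<le> t" "0 \<le> b" "b \<le> t" for a b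
    proof -
      have "dist x0 (x0 + a *\<^sub>R u + b *\<^sub>R w) = norm (a *\<^sub>R u + b *\<^sub>R w)"
        by (subst dist_commute) (simp add: dist_norm add.assoc)
      then show ?thesis using small[OF that] r(2) by auto
    qed
    \<comment> \<open>The increment in \<open>w\<close> is frozen, so that the mean value theorem in
      the direction \<open>u\<close> leaves a difference of two values of \<open>D _ u\<close>. Both
      are compared with the derivative of \<open>D _ u\<close> at the single point
      \<open>x0\<close>.\<close>
    define \<psi> where "\<psi> s = f (x0 + s *\<^sub>R u + t *\<^sub>R w) - f (x0 + s *\<^sub>R u + 0 *\<^sub>R w)" for s
    have der: "(\<psi> has_real_derivative (D (x0 + s *\<^sub>R u + t *\<^sub>R w) u - D (x0 + s *\<^sub>R u + 0 *\<^sub>R w) u)) (at s)"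
      if "0 \<le> s" "s \<le> t" for s
    proof -
      have *: "((\<lambda>s. f (x0 + s *\<^sub>R u + b *\<^sub>R w)) has_real_derivative D (x0 + s *\<^sub>R u + b *\<^sub>R w) u) (at s)"
        if "0 \<le> b" "b \<le> t" for b
      proof -
        have D': "(f has_derivative D (x0 + s *\<^sub>R u + b *\<^sub>R w)) (at (x0 + s *\<^sub>R u + b *\<^sub>R w))"
          using D inS \<open>0 \<le> s\<close> \<open>s \<le> t\<close> that by simp
        interpret L: bounded_linear "D (x0 + s *\<^sub>R u + b *\<^sub>R w)" using D' by (rule has_derivative_bounded_linear)
        have "((\<lambda>s. f (x0 + s *\<^sub>R u + b *\<^sub>R w)) has_derivative (\<lambda>h. D (x0 + s *\<^sub>R u + b *\<^sub>R w) (h *\<^sub>R u))) (at s)"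
          by (rule has_derivative_compose[where g = f and f = "\<lambda>s. x0 + s *\<^sub>R u + b *\<^sub>R w", OF _ D']) (auto intro!: derivative_eq_intros)
        then show ?thesis by (simp add: has_field_derivative_def L.scaleR mult.commute[of _ "D _ u"])
      qed
      show ?thesis unfolding \<psi>_def using t by (intro DERIV_diff *) auto
    qed
    obtain \<xi> where \<xi>: "0 < \<xi>" "\<xi> < t" "\<psi> t - \<psi> 0 = (t - 0) * (D (x0 + \<xi> *\<^sub>R u + t *\<^sub>R w) u - D (x0 + \<xi> *\<^sub>R u + 0 *\<^sub>R w) u)"
      using MVT2[OF t(1) der] by blast
    let ?y = "\<xi> *\<^sub>R u + t *\<^sub>R w" and ?z = "\<xi> *\<^sub>R u"
    have y: "\<bar>D (x0 + ?y) u - D x0 u - Du ?y\<bar> \<le> \<epsilon> * norm ?y"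
      using d(2)[of "x0 + ?y"] small[of \<xi> t] \<xi> t by simp
    have z: "\<bar>D (x0 + ?z) u - D x0 u - Du ?z\<bar> \<le> \<epsilon> * norm ?z"
      using d(2)[of "x0 + ?z"] small[of \<xi> 0] \<xi> t by simp
    have E: "Du ?y - Du ?z = t * Du w" by (simp add: Du.add Du.scaleR)
    have ny: "norm ?y \<le> t * norm u + t * norm w"
      using norm_triangle_ineq[of "\<xi> *\<^sub>R u" "t *\<^sub>R w"] \<xi> t mult_right_mono[of \<xi> t "norm u"] by simp
    have nz: "norm ?z \<le> t * norm u" using \<xi> mult_right_mono[of \<xi> t "norm u"] by simp
    have "\<bar>D (x0 + ?y) u - D (x0 + ?z) u - t * Du w\<bar> \<le> \<epsilon> * norm ?y + \<epsilon> * norm ?z"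
      using y z E by linarith
    also have "\<dots> \<le> \<epsilon> * (t * norm u + t * norm w) + \<epsilon> * (t * norm u)"
      using ny nz \<open>0 < \<epsilon>\<close> by (intro add_mono mult_left_mono) auto
    finally have b: "\<bar>D (x0 + ?y) u - D (x0 + ?z) u - t * Du w\<bar> \<le> t * (\<epsilon> * (2 * norm u + norm w))"
      by (simp add: algebra_simps)
    have "f (x0 + t *\<^sub>R u + t *\<^sub>R w) - f (x0 + t *\<^sub>R u) - f (x0 + t *\<^sub>R w) + f x0 - t\<^sup>2 * Du w
       = t * (D (x0 + ?y) u - D (x0 + ?z) u - t * Du w)"
      using \<xi>(3) unfolding \<psi>_def by (simp add: algebra_simps power2_eq_square)
    then have "\<bar>f (x0 + t *\<^sub>R u + t *\<^sub>R w) - f (x0 + t *\<^sub>R u) - f (x0 + t *\<^sub>R w) + f x0 - t\<^sup>2 * Du w\<bar>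
       = t * \<bar>D (x0 + ?y) u - D (x0 + ?z) u - t * Du w\<bar>" using t by (simp add: abs_mult)
    also have "\<dots> \<le> t * (t * (\<epsilon> * (2 * norm u + norm w)))" using b t by (intro mult_left_mono) auto
    finally show ?thesis by (simp add: power2_eq_square algebra_simps)
  qed
  show ?thesis using m main by (auto simp: eventually_at_right_field)
qed

text \<open>The second difference of \<open>f\<close> does not depend on the order of
  \<open>u\<close> and \<open>w\<close>, and \<open>second_difference_bound\<close> gives both
  \<open>Du w\<close> and \<open>Dw u\<close> as its leading coefficient.\<close>

lemma symmetric_second_derivative_real:
  fixes f :: "'a::real_normed_vector \<Rightarrow> real"
  assumes S: "open S" "x0 \<in> S"
    and D: "\<forall>x\<in>S. (f has_derivative D x) (at x)"
    and Du: "((\<lambda>x. D x u) has_derivative Du) (at x0)"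
    and Dw: "((\<lambda>x. D x w) has_derivative Dw) (at x0)"
  shows "Du w = Dw u"
proof (rule ccontr)
  assume ne: "Du w \<noteq> Dw u"
  define K where "K = 3 * norm u + 3 * norm w + 1"
  have K: "K > 0" unfolding K_def by (intro add_nonneg_pos add_nonneg_nonneg) auto
  \<comment> \<open>\<open>K\<close> exceeds the sum of the two error factors, so this choice makes
    the gap smaller than half of itself.\<close>
  define \<epsilon> where "\<epsilon> = \<bar>Du w - Dw u\<bar> / (2 * K)"
  have \<epsilon>: "\<epsilon> > 0" unfolding \<epsilon>_def using ne K by simp
  have "eventually (\<lambda>t::real. False) (at_right 0)"
    using second_difference_bound[OF S D Du \<epsilon>, of w] second_difference_bound[OF S D Dw \<epsilon>, of u]
      eventually_at_right_less[of 0]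
  proof eventually_elim
    case (elim t)
    let ?d = "f (x0 + t *\<^sub>R u + t *\<^sub>R w) - f (x0 + t *\<^sub>R u) - f (x0 + t *\<^sub>R w) + f x0"
    have e: "f (x0 + t *\<^sub>R w + t *\<^sub>R u) - f (x0 + t *\<^sub>R w) - f (x0 + t *\<^sub>R u) + f x0 = ?d"
      by (simp add: algebra_simps)
    have "\<bar>t\<^sup>2 * Du w - t\<^sup>2 * Dw u\<bar> \<le> t\<^sup>2 * (\<epsilon> * (2 * norm u + norm w)) + t\<^sup>2 * (\<epsilon> * (2 * norm w + norm u))"
      using elim(1,2) unfolding e by linarith
    moreover have "\<bar>t\<^sup>2 * Du w - t\<^sup>2 * Dw u\<bar> = t\<^sup>2 * \<bar>Du w - Dw u\<bar>"
      unfolding right_diff_distrib[symmetric] abs_mult by simp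
    ultimately have "t\<^sup>2 * \<bar>Du w - Dw u\<bar> \<le> t\<^sup>2 * (\<epsilon> * (3 * norm u + 3 * norm w))"
      by (simp add: algebra_simps)
    then have "\<bar>Du w - Dw u\<bar> \<le> \<epsilon> * (3 * norm u + 3 * norm w)" using elim(3) by simp
    also have "\<dots> < \<epsilon> * K" unfolding K_def using \<epsilon> by simp
    also have "\<dots> = \<bar>Du w - Dw u\<bar> / 2" unfolding \<epsilon>_def using K by simp
    finally have "\<bar>Du w - Dw u\<bar> < \<bar>Du w - Dw u\<bar> / 2" .
    moreover have "0 < \<bar>Du w - Dw u\<bar>" using ne by simp
    ultimately show False by simp
  qed
  then show False by simp
qed

lemma symmetric_second_derivative:
  fixes f :: "'a::real_normed_vector \<Rightarrow> 'b::euclidean_space"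
  assumes S: "open S" "x0 \<in> S"
    and D: "\<forall>x\<in>S. (f has_derivative D x) (at x)"
    and Du: "((\<lambda>x. D x u) has_derivative Du) (at x0)"
    and Dw: "((\<lambda>x. D x w) has_derivative Dw) (at x0)"
  shows "Du w = Dw u"
proof (rule euclidean_eqI)
  fix b :: 'b assume "b \<in> Basis"
  show "Du w \<bullet> b = Dw u \<bullet> b"
    by (rule symmetric_second_derivative_real[OF S, of "\<lambda>x. f x \<bullet> b" "\<lambda>x v. D x v \<bullet> b"])
       (auto intro!: has_derivative_inner_left D[rule_format] Du Dw)
qed

text \<open>Expanding \<open>Y\<close> in the basis reduces the claim to the product rule. Only
  values on basis vectors are differentiated, which avoids derivatives in a space of
  operators.\<close>

lemma has_derivative_linear_family:
  fixes L :: "'a::real_normed_vector \<Rightarrow> 'b::euclidean_space \<Rightarrow> 'c::real_normed_vector"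
  assumes lin: "\<And>x. linear (L x)"
    and L: "\<And>b. b \<in> Basis \<Longrightarrow> ((\<lambda>x. L x b) has_derivative (\<lambda>h. L' h b)) (at z)"
    and lin': "\<And>h. linear (L' h)"
    and Y: "(Y has_derivative Y') (at z)"
  shows "((\<lambda>x. L x (Y x)) has_derivative (\<lambda>h. L' h (Y z) + L z (Y' h))) (at z)"
proof -
  have e: "M y = (\<Sum>b\<in>Basis. (y \<bullet> b) *\<^sub>R M b)" if "linear M" for M :: "'b \<Rightarrow> 'c" and y
  proof -
    have "M y = M (\<Sum>b\<in>Basis. (y \<bullet> b) *\<^sub>R b)" by (simp add: euclidean_representation)
    also have "\<dots> = (\<Sum>b\<in>Basis. (y \<bullet> b) *\<^sub>R M b)" using that by (simp add: linear_sum linear_scale)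
    finally show ?thesis .
  qed
  have "((\<lambda>x. \<Sum>b\<in>Basis. (Y x \<bullet> b) *\<^sub>R L x b) has_derivative
     (\<lambda>h. \<Sum>b\<in>Basis. (Y z \<bullet> b) *\<^sub>R L' h b + (Y' h \<bullet> b) *\<^sub>R L z b)) (at z)"
    by (intro has_derivative_sum has_derivative_scaleR has_derivative_inner_left Y L)
  moreover have "(\<lambda>x. L x (Y x)) = (\<lambda>x. \<Sum>b\<in>Basis. (Y x \<bullet> b) *\<^sub>R L x b)"
    using e[OF lin] by (intro ext)
  moreover have "(\<lambda>h. L' h (Y z) + L z (Y' h)) =
      (\<lambda>h. \<Sum>b\<in>Basis. (Y z \<bullet> b) *\<^sub>R L' h b + (Y' h \<bullet> b) *\<^sub>R L z b)"
    unfolding sum.distrib by (intro ext arg_cong2[where f = "(+)"] e lin lin')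
  ultimately show ?thesis by simp
qed

section \<open>Norms on the plane without infinitesimal isometries\<close>

abbreviation e1 :: "real^2" where "e1 \<equiv> axis 1 1"
abbreviation e2 :: "real^2" where "e2 \<equiv> axis 2 1"

lemma plane_basis:
  "e1 $ 1 = 1" "e1 $ 2 = 0" "e2 $ 1 = 0" "e2 $ 2 = 1"
  by (simp_all add: axis_def)

lemma plane_expand: "v = v $ 1 *\<^sub>R e1 + v $ 2 *\<^sub>R e2"
  by (simp add: vec_eq_iff forall_2 plane_basis)

lemma linear_plane:
  assumes "linear (f :: real^2 \<Rightarrow> 'b::real_vector)"
  shows "f v = v $ 1 *\<^sub>R f e1 + v $ 2 *\<^sub>R f e2"
proof -
  have "f v = f (v $ 1 *\<^sub>R e1 + v $ 2 *\<^sub>R e2)" using plane_expand[of v] by simp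
  then show ?thesis using assms by (simp add: linear_add linear_scale)
qed

lemma bilinear_plane:
  assumes "bilinear (b :: real^2 \<Rightarrow> real^2 \<Rightarrow> 'b::real_vector)"
  shows "b u v = (u $ 1 * v $ 1) *\<^sub>R b e1 e1 + (u $ 1 * v $ 2) *\<^sub>R b e1 e2
    + (u $ 2 * v $ 1) *\<^sub>R b e2 e1 + (u $ 2 * v $ 2) *\<^sub>R b e2 e2"
proof -
  have l: "linear (b w)" "linear (\<lambda>u. b u w)" for w using assms by (auto simp: bilinear_def)
  have "b u v = v $ 1 *\<^sub>R b u e1 + v $ 2 *\<^sub>R b u e2" by (rule linear_plane[OF l(1)])
  moreover have "b u w = u $ 1 *\<^sub>R b e1 w + u $ 2 *\<^sub>R b e2 w" for w by (rule linear_plane[OF l(2)])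
  ultimately show ?thesis by (simp add: scaleR_add_right mult.commute)
qed

text \<open>For the square of a norm this is the condition that the norm is Euclidean.\<close>

definition quadratic :: "(real^2 \<Rightarrow> real) \<Rightarrow> bool" where
  "quadratic q \<longleftrightarrow> (\<exists>a b c. \<forall>v. q v = a * (v $ 1)\<^sup>2 + b * (v $ 1 * v $ 2) + c * (v $ 2)\<^sup>2)"

lemma quadratic_compose_linear:
  assumes "quadratic q" "linear f"
  shows "quadratic (\<lambda>v. q (f v))"
proof -
  obtain a b c where q: "\<And>v. q v = a * (v $ 1)\<^sup>2 + b * (v $ 1 * v $ 2) + c * (v $ 2)\<^sup>2"
    using assms(1) by (auto simp: quadratic_def)
  have f: "f v $ i = v $ 1 * f e1 $ i + v $ 2 * f e2 $ i" for v i
    by (subst linear_plane[OF assms(2), of v]) simp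
  have "q (f v) = (a * (f e1 $ 1)\<^sup>2 + b * (f e1 $ 1 * f e1 $ 2) + c * (f e1 $ 2)\<^sup>2) * (v $ 1)\<^sup>2
      + (2 * a * (f e1 $ 1) * (f e2 $ 1) + b * (f e1 $ 1 * f e2 $ 2 + f e2 $ 1 * f e1 $ 2)
         + 2 * c * (f e1 $ 2 * f e2 $ 2)) * (v $ 1 * v $ 2)
      + (a * (f e2 $ 1)\<^sup>2 + b * (f e2 $ 1 * f e2 $ 2) + c * (f e2 $ 2)\<^sup>2) * (v $ 2)\<^sup>2" for v
    unfolding q f[of v] by (simp add: power2_eq_square algebra_simps)
  then show ?thesis unfolding quadratic_def by blast
qed

lemma singular_kernel:
  fixes S :: "real^2 \<Rightarrow> real^2"
  assumes "linear S" and det: "S e1 $ 1 * S e2 $ 2 = S e2 $ 1 * S e1 $ 2"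
  shows "\<exists>v. v \<noteq> 0 \<and> S v = 0"
proof -
  \<comment> \<open>A vector annihilated by the first nonzero row of the matrix of \<open>S\<close>,
    if there is one; the vanishing determinant makes the other row a multiple of it.\<close>
  define v :: "real^2" where "v = (if S e1 $ 1 = 0 \<and> S e2 $ 1 = 0
     then (if S e1 $ 2 = 0 \<and> S e2 $ 2 = 0 then e1 else S e2 $ 2 *\<^sub>R e1 - S e1 $ 2 *\<^sub>R e2)
     else S e2 $ 1 *\<^sub>R e1 - S e1 $ 1 *\<^sub>R e2)"
  have "v \<noteq> 0" unfolding v_def by (auto simp: vec_eq_iff forall_2 plane_basis)
  moreover have "S v = 0"
    using det unfolding v_def
    by (auto simp: vec_eq_iff forall_2 linear_diff[OF assms(1)] linear_scale[OF assms(1)] algebra_simps)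
  ultimately show ?thesis by blast
qed

text \<open>\<open>q\<close> models the square of a possibly asymmetric norm, hence homogeneity for
  nonnegative factors only. A field \<open>S\<close> with \<open>q' v (S v) = 0\<close> is an
  infinitesimal isometry: \<open>q\<close> is constant along its orbits.\<close>

locale minkowski_plane =
  fixes q :: "real^2 \<Rightarrow> real" and q' :: "real^2 \<Rightarrow> real^2 \<Rightarrow> real"
  assumes pos: "v \<noteq> 0 \<Longrightarrow> 0 < q v"
    and hom: "0 \<le> t \<Longrightarrow> q (t *\<^sub>R v) = t\<^sup>2 * q v"
    and der: "v \<noteq> 0 \<Longrightarrow> (q has_derivative q' v) (at v)"
    and cont: "continuous_on (- {0}) (\<lambda>v. q' v w)"
    and not_quadratic: "\<not> quadratic q"
begin

lemma lin: "v \<noteq> 0 \<Longrightarrow> linear (q' v)"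
  using der has_derivative_linear by blast

lemma constant_along_curve:
  assumes "\<And>t. (\<gamma> has_vector_derivative \<gamma>' t) (at t)" "\<And>t. \<gamma> t \<noteq> 0" "\<And>t. q' (\<gamma> t) (\<gamma>' t) = 0"
  shows "q (\<gamma> s) = q (\<gamma> t)"
proof (rule DERIV_isconst_all[of "\<lambda>t. q (\<gamma> t)"], rule allI)
  fix t
  have "((\<lambda>t. q (\<gamma> t)) has_derivative (\<lambda>h. q' (\<gamma> t) (h *\<^sub>R \<gamma>' t))) (at t)"
    by (rule has_derivative_compose[where g = q and f = \<gamma>, OF _ der])
       (use assms in \<open>auto simp: has_vector_derivative_def\<close>)
  then show "((\<lambda>t. q (\<gamma> t)) has_real_derivative 0) (at t)"
    using assms(3)[of t] linear_scale[OF lin[OF assms(2)]]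
    by (simp add: has_field_derivative_def lambda_zero)
qed

lemma euler:
  assumes "v \<noteq> 0" shows "q' v v = 2 * q v"
proof -
  have "((\<lambda>t. q (t *\<^sub>R v)) has_derivative (\<lambda>h. q' (1 *\<^sub>R v) (h *\<^sub>R v))) (at 1)"
    by (rule has_derivative_compose[where g = q and f = "\<lambda>t. t *\<^sub>R v", OF _ der])
       (use assms in \<open>auto intro!: derivative_eq_intros\<close>)
  moreover have "((\<lambda>t. q (t *\<^sub>R v)) has_derivative (\<lambda>h. 2 * h * q v)) (at 1)"
    by (rule has_derivative_transform_within_open[of "\<lambda>t. t\<^sup>2 * q v" _ _ _ "{0<..}"])
       (auto intro!: derivative_eq_intros simp: hom)
  ultimately have "(\<lambda>h. q' (1 *\<^sub>R v) (h *\<^sub>R v)) = (\<lambda>h. 2 * h * q v)" by (rule has_derivative_unique)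
  from fun_cong[OF this, of 1] show ?thesis by simp
qed

text \<open>A radial field changes \<open>q\<close> at the rate \<open>2 * \<mu> * q v\<close> by
  Euler's relation, and \<open>q v\<close> is positive.\<close>

lemma eigenvalue_zero:
  assumes "v \<noteq> 0" "w = \<mu> *\<^sub>R v" "q' v w = 0"
  shows "\<mu> = 0"
proof -
  have "\<mu> * q' v v = 0" using assms linear_scale[OF lin[OF assms(1)], of \<mu> v] by simp
  then show ?thesis using euler[OF assms(1)] pos[OF assms(1)] by auto
qed

lemma cayley_hamilton:
  fixes S :: "real^2 \<Rightarrow> real^2"
  assumes "linear S"
  shows "S (S v) = (S e1 $ 1 + S e2 $ 2) *\<^sub>R S v - (S e1 $ 1 * S e2 $ 2 - S e2 $ 1 * S e1 $ 2) *\<^sub>R v"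
proof -
  have "S v $ i = v $ 1 * S e1 $ i + v $ 2 * S e2 $ i" for i
    by (subst linear_plane[OF assms, of v]) simp
  moreover have "S (S v) $ i = S v $ 1 * S e1 $ i + S v $ 2 * S e2 $ i" for i
    by (subst linear_plane[OF assms, of "S v"]) simp
  ultimately show ?thesis by (simp add: vec_eq_iff forall_2 algebra_simps)
qed

text \<open>The orbits are the lines \<open>v + s *\<^sub>R S v\<close>, along which
  \<open>q\<close> is constant. Dividing by \<open>s\<close> and letting \<open>s\<close> grow,
  homogeneity gives \<open>q (S v) = 0\<close>.\<close>

lemma nilpotent_zero:
  assumes S: "linear S" and kill: "\<And>v. v \<noteq> 0 \<Longrightarrow> q' v (S v) = 0" and nil: "\<And>v. S (S v) = 0"
  shows "S v = 0"
proof (rule ccontr)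
  assume w: "S v \<noteq> 0"
  let ?\<gamma> = "\<lambda>s. v + s *\<^sub>R S v"
  have S\<gamma>: "S (?\<gamma> s) = S v" for s using S nil by (simp add: linear_add linear_scale)
  have ne: "?\<gamma> s \<noteq> 0" for s using S\<gamma>[of s] w S by (metis linear_0)
  have const: "q (?\<gamma> s) = q (?\<gamma> 0)" for s
    by (rule constant_along_curve[of ?\<gamma> "\<lambda>s. S v"])
       (use ne kill[OF ne] S\<gamma> in \<open>auto intro!: derivative_eq_intros simp: has_vector_derivative_def\<close>)
  have "isCont q (S v)" using der[OF w] by (rule has_derivative_continuous)
  moreover have lim: "(\<lambda>n. inverse (real (Suc n)) *\<^sub>R v + S v) \<longlonglongrightarrow> 0 *\<^sub>R v + S v"
    by (intro tendsto_intros LIMSEQ_inverse_real_of_nat)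
  ultimately have "(\<lambda>n. q (inverse (real (Suc n)) *\<^sub>R v + S v)) \<longlonglongrightarrow> q (S v)"
    by (intro isCont_tendsto_compose[of "S v" q]) simp_all
  moreover have "q (inverse (real (Suc n)) *\<^sub>R v + S v) = (inverse (real (Suc n)))\<^sup>2 * q v" for n
  proof -
    have "inverse (real (Suc n)) *\<^sub>R v + S v = inverse (real (Suc n)) *\<^sub>R ?\<gamma> (real (Suc n))"
      by (simp add: scaleR_add_right del: of_nat_Suc)
    then show ?thesis using const[of "real (Suc n)"] by (simp add: hom del: of_nat_Suc)
  qed
  moreover have "(\<lambda>n. (inverse (real (Suc n)))\<^sup>2 * q v) \<longlonglongrightarrow> 0\<^sup>2 * q v"
    by (intro tendsto_intros LIMSEQ_inverse_real_of_nat)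
  ultimately have "q (S v) = 0" using LIMSEQ_unique by fastforce
  then show False using pos[OF w] by simp
qed

text \<open>\<open>R\<close> is a complex structure, so \<open>e1\<close> and \<open>R e1\<close>
  form a basis in which every vector lies on a multiple of the given ellipse. Homogeneity then makes
  \<open>q\<close> the form \<open>(x\<^sup>2 + y\<^sup>2) * q e1\<close>.\<close>

lemma rotation_quadratic:
  assumes R: "linear R" "\<And>v. R (R v) = - v"
    and c: "\<And>\<theta>. q (cos \<theta> *\<^sub>R e1 + sin \<theta> *\<^sub>R R e1) = q e1"
  shows "quadratic q"
proof -
  let ?r = "R e1"
  \<comment> \<open>Otherwise \<open>R e1\<close> would be a real multiple of \<open>e1\<close>, and
    the square of the factor would be -1.\<close>
  have r2: "?r $ 2 \<noteq> 0"
  proof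
    assume "?r $ 2 = 0"
    then have "?r = ?r $ 1 *\<^sub>R e1" using plane_expand[of ?r] by simp
    then have "R ?r = ?r $ 1 *\<^sub>R ?r" using linear_scale[OF R(1)] by metis
    then have "- 1 = ?r $ 1 * ?r $ 1" using R(2)[of e1] by (simp add: vec_eq_iff forall_2 plane_basis)
    then show False by (metis not_square_less_zero neg_less_0_iff_less zero_less_one)
  qed
  have polar: "q (x *\<^sub>R e1 + y *\<^sub>R ?r) = (x\<^sup>2 + y\<^sup>2) * q e1" for x y
  proof (cases "x\<^sup>2 + y\<^sup>2 = 0")
    case True
    then show ?thesis using hom[of 0 0] by (simp add: sum_power2_eq_zero_iff)
  next
    case False
    define \<rho> where "\<rho> = sqrt (x\<^sup>2 + y\<^sup>2)"
    have \<rho>: "\<rho> > 0" "\<rho>\<^sup>2 = x\<^sup>2 + y\<^sup>2" unfolding \<rho>_def using False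
      by (auto simp: sum_power2_gt_zero_iff sum_power2_eq_zero_iff)
    have "(x / \<rho>)\<^sup>2 + (y / \<rho>)\<^sup>2 = 1" using False
      by (simp add: power_divide \<rho>(2) flip: add_divide_distrib)
    then obtain \<theta> where \<theta>: "x / \<rho> = cos \<theta>" "y / \<rho> = sin \<theta>" by (rule sincos_total_2pi)
    then have "x = \<rho> * cos \<theta>" "y = \<rho> * sin \<theta>" using \<rho>(1) by (auto simp: field_simps)
    then have "x *\<^sub>R e1 + y *\<^sub>R ?r = \<rho> *\<^sub>R (cos \<theta> *\<^sub>R e1 + sin \<theta> *\<^sub>R ?r)" by (simp add: scaleR_add_right)
    then show ?thesis using hom[of \<rho>] \<rho> c[of \<theta>] by simp
  qed
  have *: "q v = ((v $ 1 - v $ 2 * ?r $ 1 / ?r $ 2)\<^sup>2 + (v $ 2 / ?r $ 2)\<^sup>2) * q e1" for v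
  proof -
    have "v = (v $ 1 - v $ 2 * ?r $ 1 / ?r $ 2) *\<^sub>R e1 + (v $ 2 / ?r $ 2) *\<^sub>R ?r"
      using r2 by (simp add: vec_eq_iff forall_2 plane_basis)
    then show ?thesis using polar by metis
  qed
  show ?thesis unfolding quadratic_def
    by (rule exI[of _ "q e1"], rule exI[of _ "- 2 * (?r $ 1 / ?r $ 2) * q e1"],
        rule exI[of _ "((?r $ 1 / ?r $ 2)\<^sup>2 + (1 / ?r $ 2)\<^sup>2) * q e1"], subst *)
       (simp add: power2_eq_square field_simps r2)
qed

text \<open>A real eigenvalue of \<open>S\<close> must be 0, since the field is radial along an
  eigenvector; if the eigenvalues are real, \<open>S\<close> is therefore nilpotent. Otherwise the
  orbits are logarithmic spirals or ellipses: a spiral contradicts homogeneity, and an ellipse makes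
  \<open>q\<close> quadratic.\<close>

lemma linear_field_zero:
  assumes S: "linear S" and kill: "\<And>v. v \<noteq> 0 \<Longrightarrow> q' v (S v) = 0"
  shows "S v = 0"
proof -
  define \<tau> where "\<tau> = S e1 $ 1 + S e2 $ 2"
  define \<delta> where "\<delta> = S e1 $ 1 * S e2 $ 2 - S e2 $ 1 * S e1 $ 2"
  have CH: "S (S v) = \<tau> *\<^sub>R S v - \<delta> *\<^sub>R v" for v
    unfolding \<tau>_def \<delta>_def by (rule cayley_hamilton[OF S])
  have root: "\<mu> = 0" if "\<mu>\<^sup>2 - \<tau> * \<mu> + \<delta> = 0" for \<mu>
  proof -
    have "linear (\<lambda>v. S v - \<mu> *\<^sub>R v)"
      by (rule linearI) (simp_all add: linear_add[OF S] linear_scale[OF S] algebra_simps)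
    moreover have "(S e1 - \<mu> *\<^sub>R e1) $ 1 * (S e2 - \<mu> *\<^sub>R e2) $ 2 = (S e2 - \<mu> *\<^sub>R e2) $ 1 * (S e1 - \<mu> *\<^sub>R e1) $ 2"
      using that unfolding \<tau>_def \<delta>_def by (simp add: plane_basis power2_eq_square algebra_simps)
    ultimately obtain v where v: "v \<noteq> 0" "S v - \<mu> *\<^sub>R v = 0" using singular_kernel by blast
    then show ?thesis using eigenvalue_zero[OF v(1), of "S v" \<mu>] kill[OF v(1)] by simp
  qed
  show ?thesis
  proof (cases "\<tau>\<^sup>2 - 4 * \<delta> \<ge> 0")
    case True
    let ?d = "sqrt (\<tau>\<^sup>2 - 4 * \<delta>)"
    have d: "?d\<^sup>2 = \<tau>\<^sup>2 - 4 * \<delta>" using True by simp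
    have "((\<tau> + ?d) / 2)\<^sup>2 - \<tau> * ((\<tau> + ?d) / 2) + \<delta> = (?d\<^sup>2 - (\<tau>\<^sup>2 - 4 * \<delta>)) / 4"
      "((\<tau> - ?d) / 2)\<^sup>2 - \<tau> * ((\<tau> - ?d) / 2) + \<delta> = (?d\<^sup>2 - (\<tau>\<^sup>2 - 4 * \<delta>)) / 4"
      by (simp_all add: power2_eq_square field_simps del: real_sqrt_mult_self real_sqrt_mult_self)
    then have "(\<tau> + ?d) / 2 = 0" "(\<tau> - ?d) / 2 = 0"
      using root[of "(\<tau> + ?d) / 2"] root[of "(\<tau> - ?d) / 2"] unfolding d by auto
    moreover have "a = 0 \<and> b = 0" if "(a + b) / 2 = 0" "(a - b) / 2 = 0" for a b :: real
      using that by (simp add: field_simps)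
    ultimately have "\<tau> = 0" "?d = 0" by blast+
    then have "\<tau> = 0" "\<delta> = 0" using d by (simp_all only: power2_eq_square)
    then show ?thesis using nilpotent_zero[OF S kill] CH by simp
  next
    case False
    define \<alpha> where "\<alpha> = \<tau> / 2"
    define \<omega> where "\<omega> = sqrt (\<delta> - \<alpha>\<^sup>2)"
    have \<omega>2: "\<delta> - \<alpha>\<^sup>2 > 0" using False unfolding \<alpha>_def by (simp add: power2_eq_square)
    have \<omega>: "\<omega> > 0" "\<omega>\<^sup>2 = \<delta> - \<alpha>\<^sup>2" using \<omega>2 unfolding \<omega>_def by simp_all
    \<comment> \<open>The eigenvalues are \<open>\<alpha>\<close> plus or minus
      \<open>\<omega>\<close> times the imaginary unit, and \<open>R\<close> is the corresponding
      complex structure: \<open>S\<close> is \<open>\<alpha>\<close> times the identity plus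
      \<open>\<omega>\<close> times \<open>R\<close>.\<close>
    define R where "R v = (1 / \<omega>) *\<^sub>R (S v - \<alpha> *\<^sub>R v)" for v
    have linR: "linear R" unfolding R_def
      by (rule linearI) (simp_all add: linear_add[OF S] linear_scale[OF S] algebra_simps)
    have SR: "S v = \<alpha> *\<^sub>R v + \<omega> *\<^sub>R R v" for v unfolding R_def using \<omega> by simp
    have RR: "R (R v) = - v" for v
    proof -
      have "R (R v) = (1 / \<omega>\<^sup>2) *\<^sub>R (S (S v) - (\<alpha> *\<^sub>R S v + \<alpha> *\<^sub>R S v) + \<alpha>\<^sup>2 *\<^sub>R v)"
        unfolding R_def by (simp add: linear_diff[OF S] linear_scale[OF S] power2_eq_square algebra_simps)
      also have "\<dots> = (1 / \<omega>\<^sup>2) *\<^sub>R (- (\<omega>\<^sup>2 *\<^sub>R v))"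
        unfolding CH \<omega>(2) \<alpha>_def by (simp add: algebra_simps flip: scaleR_add_left)
      finally show ?thesis using \<omega>(1) by simp
    qed
    \<comment> \<open>The orbit of \<open>e1\<close> under the flow of \<open>S\<close>.\<close>
    define \<gamma> where "\<gamma> t = exp (\<alpha> * t) *\<^sub>R (cos (\<omega> * t) *\<^sub>R e1 + sin (\<omega> * t) *\<^sub>R R e1)" for t
    have indep: "c\<^sup>2 + s\<^sup>2 = 0" if z: "c *\<^sub>R e1 + s *\<^sub>R R e1 = 0" for c s
    proof -
      have "R (c *\<^sub>R e1 + s *\<^sub>R R e1) = c *\<^sub>R R e1 - s *\<^sub>R e1"
        by (simp add: linear_add[OF linR] linear_scale[OF linR] RR)
      then have z': "c *\<^sub>R R e1 - s *\<^sub>R e1 = 0" unfolding z linear_0[OF linR] by simp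
      have "c *\<^sub>R (c *\<^sub>R e1 + s *\<^sub>R R e1) - s *\<^sub>R (c *\<^sub>R R e1 - s *\<^sub>R e1) = (c\<^sup>2 + s\<^sup>2) *\<^sub>R e1"
        by (simp add: vec_eq_iff forall_2 power2_eq_square algebra_simps)
      then show ?thesis unfolding z z' by (simp add: axis_eq_0_iff)
    qed
    have ne: "\<gamma> t \<noteq> 0" for t
      using indep[of "cos (\<omega> * t)" "sin (\<omega> * t)"] unfolding \<gamma>_def by auto
    have S\<gamma>: "S (\<gamma> t) = \<alpha> *\<^sub>R \<gamma> t + (\<omega> * exp (\<alpha> * t)) *\<^sub>R (cos (\<omega> * t) *\<^sub>R R e1 - sin (\<omega> * t) *\<^sub>R e1)" for t
      unfolding SR \<gamma>_def by (simp add: linear_add[OF linR] linear_scale[OF linR] RR algebra_simps)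
    have der\<gamma>: "(\<gamma> has_vector_derivative S (\<gamma> t)) (at t)" for t
    proof -
      let ?E = "exp (\<alpha> * t)" and ?C = "cos (\<omega> * t)" and ?S = "sin (\<omega> * t)"
      have C: "((\<lambda>t. exp (\<alpha> * t) * cos (\<omega> * t)) has_real_derivative \<alpha> * ?E * ?C - \<omega> * ?E * ?S) (at t)"
        and S: "((\<lambda>t. exp (\<alpha> * t) * sin (\<omega> * t)) has_real_derivative \<alpha> * ?E * ?S + \<omega> * ?E * ?C) (at t)"
        by (auto intro!: derivative_eq_intros)
      have "\<gamma> = (\<lambda>t. (exp (\<alpha> * t) * cos (\<omega> * t)) *\<^sub>R e1 + (exp (\<alpha> * t) * sin (\<omega> * t)) *\<^sub>R R e1)"
        unfolding \<gamma>_def by (simp add: fun_eq_iff scaleR_add_right)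
      then have "(\<gamma> has_vector_derivative
          ((?E * ?C) *\<^sub>R 0 + (\<alpha> * ?E * ?C - \<omega> * ?E * ?S) *\<^sub>R e1) +
          ((?E * ?S) *\<^sub>R 0 + (\<alpha> * ?E * ?S + \<omega> * ?E * ?C) *\<^sub>R R e1)) (at t)"
        using has_vector_derivative_add[OF
            has_vector_derivative_scaleR[OF C has_vector_derivative_const[of e1]]
            has_vector_derivative_scaleR[OF S has_vector_derivative_const[of "R e1"]]] by simp
      also have "((?E * ?C) *\<^sub>R 0 + (\<alpha> * ?E * ?C - \<omega> * ?E * ?S) *\<^sub>R e1) +
          ((?E * ?S) *\<^sub>R 0 + (\<alpha> * ?E * ?S + \<omega> * ?E * ?C) *\<^sub>R R e1) = S (\<gamma> t)"
        unfolding S\<gamma> unfolding \<gamma>_def by (simp add: vec_eq_iff forall_2 algebra_simps)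
      finally show ?thesis .
    qed
    have const: "q (\<gamma> t) = q (\<gamma> 0)" for t
      by (rule constant_along_curve[OF der\<gamma> ne kill[OF ne]])
    have \<gamma>0: "\<gamma> 0 = e1" unfolding \<gamma>_def by simp
    have e1: "e1 \<noteq> 0" by (simp add: axis_eq_0_iff)
    \<comment> \<open>After a full turn the orbit is back on the ray of \<open>e1\<close>, where
      constancy of \<open>q\<close> admits no growth factor other than 1.\<close>
    have "\<gamma> (2 * pi / \<omega>) = exp (\<alpha> * (2 * pi / \<omega>)) *\<^sub>R e1" unfolding \<gamma>_def using \<omega>(1) by simp
    then have "(exp (\<alpha> * (2 * pi / \<omega>)))\<^sup>2 * q e1 = q e1"
      using const[of "2 * pi / \<omega>"] hom[of "exp (\<alpha> * (2 * pi / \<omega>))" e1] \<gamma>0 by simp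
    then have "(exp (\<alpha> * (2 * pi / \<omega>)))\<^sup>2 = 1\<^sup>2" using pos[OF e1] by simp
    then have "exp (\<alpha> * (2 * pi / \<omega>)) = 1" by (subst (asm) power2_eq_iff_nonneg) auto
    then have "\<alpha> = 0" using \<omega>(1) by simp
    have "q (cos \<theta> *\<^sub>R e1 + sin \<theta> *\<^sub>R R e1) = q e1" for \<theta>
      using const[of "\<theta> / \<omega>"] unfolding \<gamma>0 unfolding \<gamma>_def \<open>\<alpha> = 0\<close> using \<omega>(1) by simp
    then have "quadratic q" using rotation_quadratic[OF linR RR] by blast
    then show ?thesis using not_quadratic by simp
  qed
qed

end

section \<open>Quadratic vector fields that annihilate a norm\<close>

definition symform :: "real \<Rightarrow> real \<Rightarrow> real \<Rightarrow> real^2 \<Rightarrow> real^2 \<Rightarrow> real" where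
  "symform a b c u v = a * (u $ 1 * v $ 1) + b * (u $ 1 * v $ 2 + u $ 2 * v $ 1) + c * (u $ 2 * v $ 2)"

context minkowski_plane
begin

lemma expand: "v \<noteq> 0 \<Longrightarrow> q' v w = w $ 1 * q' v e1 + w $ 2 * q' v e2"
  using linear_plane[OF lin, of v w] by simp

text \<open>In some direction \<open>v0\<close> the field is radial and hence vanishes. It is then a
  linear form vanishing on the line of \<open>v0\<close>, times a linear field. The linear field
  annihilates \<open>q\<close> off that line, by continuity also on it, and so is zero.\<close>

lemma quadratic_field_zero:
  assumes kill: "\<And>v. v \<noteq> 0 \<Longrightarrow> q' v ((v $ 1)\<^sup>2 *\<^sub>R A + (v $ 1 * v $ 2) *\<^sub>R B + (v $ 2)\<^sup>2 *\<^sub>R C) = 0"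
  shows "A = 0" "B = 0" "C = 0"
proof -
  define Q where "Q v = (v $ 1)\<^sup>2 *\<^sub>R A + (v $ 1 * v $ 2) *\<^sub>R B + (v $ 2)\<^sup>2 *\<^sub>R C" for v :: "real^2"
  \<comment> \<open>The determinant of \<open>v\<close> and \<open>Q v\<close> on the unit circle.
    It is cubic in \<open>v\<close>, so its values at 0 and \<open>pi\<close> are opposite and it
    has a zero.\<close>
  define g where "g \<theta> = cos \<theta> * Q (cos \<theta> *\<^sub>R e1 + sin \<theta> *\<^sub>R e2) $ 2 - sin \<theta> * Q (cos \<theta> *\<^sub>R e1 + sin \<theta> *\<^sub>R e2) $ 1" for \<theta>
  have cont_g: "continuous_on X g" for X
    unfolding g_def Q_def by (simp add: plane_basis) (intro continuous_intros)
  have "\<exists>\<theta>. g \<theta> = 0"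
  proof (cases "g 0 \<le> 0")
    case True
    moreover have "g pi = - g 0" unfolding g_def Q_def by (simp add: plane_basis)
    ultimately show ?thesis using IVT'[of g 0 0 pi] cont_g by (metis neg_0_le_iff_le pi_ge_zero)
  next
    case False
    moreover have "g pi = - g 0" unfolding g_def Q_def by (simp add: plane_basis)
    ultimately show ?thesis using IVT2'[of g pi 0 0] cont_g by (metis linear neg_le_0_iff_le pi_ge_zero)
  qed
  then obtain \<theta> where \<theta>: "g \<theta> = 0" by blast
  define c where "c = cos \<theta>"
  define s where "s = sin \<theta>"
  have cs: "c\<^sup>2 + s\<^sup>2 = 1" unfolding c_def s_def by simp
  define v0 where "v0 = c *\<^sub>R e1 + s *\<^sub>R e2"
  define w where "w = (- s) *\<^sub>R e1 + c *\<^sub>R e2"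
  have v0i: "v0 $ 1 = c" "v0 $ 2 = s" and wi: "w $ 1 = - s" "w $ 2 = c"
    unfolding v0_def w_def by (simp_all add: plane_basis)
  have v0: "v0 \<noteq> 0" using cs v0i by auto
  have par: "c * Q v0 $ 2 = s * Q v0 $ 1"
    using \<theta> unfolding g_def v0_def c_def s_def by simp
  have "Q v0 = (c * Q v0 $ 1 + s * Q v0 $ 2) *\<^sub>R v0"
  proof -
    have "(c * Q v0 $ 1 + s * Q v0 $ 2) * c = (c\<^sup>2 + s\<^sup>2) * Q v0 $ 1"
      using par by (simp add: power2_eq_square algebra_simps)
    moreover have "(c * Q v0 $ 1 + s * Q v0 $ 2) * s = (c\<^sup>2 + s\<^sup>2) * Q v0 $ 2"
      using par by (simp add: power2_eq_square algebra_simps)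
    ultimately show ?thesis unfolding cs by (simp add: vec_eq_iff forall_2 v0i)
  qed
  then have Qv0: "Q v0 = 0" using eigenvalue_zero[OF v0] kill[OF v0] Q_def by (metis scaleR_zero_left)
  \<comment> \<open>The mixed coefficient of \<open>Q\<close> in the frame \<open>v0\<close>,
    \<open>w\<close>: the value at \<open>x v0 + l w\<close> is
    \<open>x^2 Q v0 + x l M + l^2 Q w\<close>.\<close>
  define M where "M = (- 2 * c * s) *\<^sub>R A + (c\<^sup>2 - s\<^sup>2) *\<^sub>R B + (2 * c * s) *\<^sub>R C"
  define S where "S v = (c * v $ 1 + s * v $ 2) *\<^sub>R M + (c * v $ 2 - s * v $ 1) *\<^sub>R Q w" for v :: "real^2"
  have S: "linear S" unfolding S_def by (rule linearI) (simp_all add: algebra_simps)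
  have frame: "v = (c * v $ 1 + s * v $ 2) *\<^sub>R v0 + (c * v $ 2 - s * v $ 1) *\<^sub>R w" for v
  proof -
    have "(c * v $ 1 + s * v $ 2) * c - (c * v $ 2 - s * v $ 1) * s = (c\<^sup>2 + s\<^sup>2) * v $ 1"
      "(c * v $ 1 + s * v $ 2) * s + (c * v $ 2 - s * v $ 1) * c = (c\<^sup>2 + s\<^sup>2) * v $ 2"
      by (simp_all add: power2_eq_square algebra_simps)
    then show ?thesis unfolding cs by (simp add: vec_eq_iff forall_2 v0i wi)
  qed
  have QS: "Q v = (c * v $ 2 - s * v $ 1) *\<^sub>R S v" for v
  proof -
    have "Q (x *\<^sub>R v0 + l *\<^sub>R w) = x\<^sup>2 *\<^sub>R Q v0 + l *\<^sub>R (x *\<^sub>R M + l *\<^sub>R Q w)" for x l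
      unfolding Q_def M_def by (simp add: v0i wi vec_eq_iff power2_eq_square field_simps)
    from this[of "c * v $ 1 + s * v $ 2" "c * v $ 2 - s * v $ 1"] show ?thesis
      unfolding frame[of v, symmetric] Qv0 S_def by simp
  qed
  have off: "q' v (S v) = 0" if "v \<noteq> 0" "c * v $ 2 - s * v $ 1 \<noteq> 0" for v
    using kill[OF that(1), folded Q_def] that(2) linear_scale[OF lin[OF that(1)], of _ "S v"]
    unfolding QS by simp
  have "q' v (S v) = 0" if "v \<noteq> 0" for v
  proof (cases "c * v $ 2 - s * v $ 1 = 0")
    case True
    \<comment> \<open>The exceptional line is approached from the transversal direction
      \<open>w\<close>.\<close>
    define vn where "vn n = v + inverse (real (Suc n)) *\<^sub>R w" for n
    have "c * w $ 2 - s * w $ 1 = 1" using cs by (simp add: wi power2_eq_square)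
    moreover have "c * vn n $ 2 - s * vn n $ 1 = c * v $ 2 - s * v $ 1 + inverse (real (Suc n)) * (c * w $ 2 - s * w $ 1)" for n
      unfolding vn_def by (simp add: algebra_simps del: of_nat_Suc)
    ultimately have l: "c * vn n $ 2 - s * vn n $ 1 \<noteq> 0" for n using True by (simp del: of_nat_Suc)
    then have ne: "vn n \<noteq> 0" for n by (metis diff_self mult_zero_right zero_index)
    have "vn \<longlonglongrightarrow> v + 0 *\<^sub>R w" unfolding vn_def
      by (intro tendsto_intros LIMSEQ_inverse_real_of_nat)
    then have vn: "vn \<longlonglongrightarrow> v" by simp
    have lim: "(\<lambda>n. q' (vn n) u) \<longlonglongrightarrow> q' v u" for u
      using continuous_on_tendsto_compose[OF cont vn] that ne by simp
    have Sn: "(\<lambda>n. S (vn n)) \<longlonglongrightarrow> S v"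
      by (rule isCont_tendsto_compose[OF _ vn]) (simp add: S linear_continuous_at linear_conv_bounded_linear[symmetric])
    have "(\<lambda>n. S (vn n) $ 1 * q' (vn n) e1 + S (vn n) $ 2 * q' (vn n) e2) \<longlonglongrightarrow> S v $ 1 * q' v e1 + S v $ 2 * q' v e2"
      by (intro tendsto_intros lim Sn)
    then have "(\<lambda>n. q' (vn n) (S (vn n))) \<longlonglongrightarrow> q' v (S v)"
      using expand[OF ne, of _ "S (vn _)"] expand[OF that, of "S v"] by (simp only:)
    then have "(\<lambda>n::nat. 0) \<longlonglongrightarrow> q' v (S v)" using off[OF ne l] by simp
    then show ?thesis by (simp add: LIMSEQ_const_iff)
  qed (use off that in auto)
  then have "S v = 0" for v by (rule linear_field_zero[OF S])
  then have Q0: "Q v = 0" for v unfolding QS by simp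
  show "A = 0" using Q0[of e1] unfolding Q_def by (simp add: plane_basis)
  moreover show "C = 0" using Q0[of e2] unfolding Q_def by (simp add: plane_basis)
  ultimately show "B = 0" using Q0[of "e1 + e2"] unfolding Q_def by (simp add: plane_basis)
qed

text \<open>With \<open>J\<close> chosen such that \<open>h (J v) v = 0\<close>, the field \<open>v \<mapsto> b (J v) v\<close> is quadratic and hence zero.\<close>

lemma bilinear_multiple_of_form:
  fixes h11 h12 h22 :: real
  defines "h \<equiv> symform h11 h12 h22"
  assumes b: "bilinear b" and det: "h11 * h22 - h12\<^sup>2 \<noteq> 0"
    and kill: "\<And>u v. v \<noteq> 0 \<Longrightarrow> h u v = 0 \<Longrightarrow> q' v (b u v) = 0"
  shows "\<exists>e. \<forall>u v. b u v = h u v *\<^sub>R e"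
proof -
  define b11 b12 b21 b22 where bs: "b11 = b e1 e1" "b12 = b e1 e2" "b21 = b e2 e1" "b22 = b e2 e2"
  have be: "b u v = (u $ 1 * v $ 1) *\<^sub>R b11 + (u $ 1 * v $ 2) *\<^sub>R b12
    + (u $ 2 * v $ 1) *\<^sub>R b21 + (u $ 2 * v $ 2) *\<^sub>R b22" for u v
    unfolding bs by (rule bilinear_plane[OF b])
  define A B C where ABC: "A = h11 *\<^sub>R b21 - h12 *\<^sub>R b11"
    "B = h11 *\<^sub>R b22 + h12 *\<^sub>R b21 - h12 *\<^sub>R b12 - h22 *\<^sub>R b11" "C = h12 *\<^sub>R b22 - h22 *\<^sub>R b12"
  have "q' v ((v $ 1)\<^sup>2 *\<^sub>R A + (v $ 1 * v $ 2) *\<^sub>R B + (v $ 2)\<^sup>2 *\<^sub>R C) = 0" if "v \<noteq> 0" for v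
  proof -
    \<comment> \<open>This is \<open>J v\<close>: the coefficients of \<open>h _ v\<close>, turned
      by a right angle.\<close>
    define u where "u = (- (h12 * v $ 1 + h22 * v $ 2)) *\<^sub>R e1 + (h11 * v $ 1 + h12 * v $ 2) *\<^sub>R e2"
    have u: "u $ 1 = - (h12 * v $ 1 + h22 * v $ 2)" "u $ 2 = h11 * v $ 1 + h12 * v $ 2"
      unfolding u_def by (simp_all add: plane_basis)
    have "h u v = 0" unfolding h_def symform_def u by (simp add: algebra_simps)
    moreover have "b u v = (v $ 1)\<^sup>2 *\<^sub>R A + (v $ 1 * v $ 2) *\<^sub>R B + (v $ 2)\<^sup>2 *\<^sub>R C"
      unfolding be u ABC by (simp add: vec_eq_iff power2_eq_square algebra_simps)
    ultimately show ?thesis using kill[OF that, of u] by simp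
  qed
  from quadratic_field_zero[OF this] have z: "A $ i = 0" "B $ i = 0" "C $ i = 0" for i by auto
  define d where "d = h11 * h22 - h12\<^sup>2"
  \<comment> \<open>The only candidate: \<open>b11 = h11 e\<close> and \<open>b21 = h12 e\<close>
    combine to \<open>h22 b11 - h12 b21 = d e\<close>.\<close>
  define e where "e = (1 / d) *\<^sub>R (h22 *\<^sub>R b11 - h12 *\<^sub>R b21)"
  have d: "d \<noteq> 0" using det d_def by simp
  have ei: "d * e $ i = h22 * b11 $ i - h12 * b21 $ i" for i unfolding e_def using d by simp
  have comp: "d * b11 $ i = h11 * (d * e $ i)" "d * b12 $ i = h12 * (d * e $ i)"
    "d * b21 $ i = h12 * (d * e $ i)" "d * b22 $ i = h22 * (d * e $ i)" for i
  proof -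
    have "h11 * b21 $ i - h12 * b11 $ i = 0" "h12 * b22 $ i - h22 * b12 $ i = 0"
      "h11 * b22 $ i + h12 * b21 $ i - h12 * b12 $ i - h22 * b11 $ i = 0"
      using z[of i] unfolding ABC by simp_all
    then show "d * b11 $ i = h11 * (d * e $ i)" "d * b12 $ i = h12 * (d * e $ i)"
      "d * b21 $ i = h12 * (d * e $ i)" "d * b22 $ i = h22 * (d * e $ i)"
      unfolding ei unfolding d_def by algebra+
  qed
  have "b11 = h11 *\<^sub>R e" "b12 = h12 *\<^sub>R e" "b21 = h12 *\<^sub>R e" "b22 = h22 *\<^sub>R e"
    using comp d by (auto simp: vec_eq_iff)
  then have "b u v = h u v *\<^sub>R e" for u v
    unfolding be h_def symform_def by (simp add: vec_eq_iff algebra_simps)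
  then show ?thesis by blast
qed

end

text \<open>The unit vectors from \<open>z0\<close> towards \<open>z n\<close> have a convergent
  subsequence, and difference quotients along it vanish. The subsequence is chosen from
  \<open>z\<close> alone, so its limit serves an arbitrary, possibly infinite, family
  \<open>g\<close> at once.\<close>

lemma common_limit_direction:
  fixes g :: "'i \<Rightarrow> 'z::euclidean_space \<Rightarrow> real" and z :: "nat \<Rightarrow> 'z"
  assumes lim: "z \<longlonglongrightarrow> z0" and ne: "\<And>n. z n \<noteq> z0"
    and der: "\<And>i. i \<in> I \<Longrightarrow> (g i has_derivative D i) (at z0)"
    and const: "\<And>i n. i \<in> I \<Longrightarrow> g i (z n) = g i z0"
  shows "\<exists>\<zeta>. norm \<zeta> = 1 \<and> (\<forall>i\<in>I. D i \<zeta> = 0)"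
proof -
  define w where "w n = (1 / norm (z n - z0)) *\<^sub>R (z n - z0)" for n
  have nw: "norm (w n) = 1" for n unfolding w_def using ne by simp
  then have "\<forall>n. w n \<in> sphere 0 1" by simp
  with compact_sphere[of 0 1] obtain \<zeta> r where r: "\<zeta> \<in> sphere 0 1" "strict_mono r" "(w \<circ> r) \<longlonglongrightarrow> \<zeta>"
    unfolding compact_def by metis
  have "D i \<zeta> = 0" if i: "i \<in> I" for i
  proof -
    interpret D: bounded_linear "D i" using der[OF i] by (rule has_derivative_bounded_linear)
    have zr: "(\<lambda>n. z (r n)) \<longlonglongrightarrow> z0" using LIMSEQ_subseq_LIMSEQ[OF lim r(2)] by (simp add: o_def)
    have "((\<lambda>y. (1 / norm (y - z0)) *\<^sub>R (g i y - (g i z0 + D i (y - z0)))) \<longlongrightarrow> 0) (at z0)"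
      using der[OF i] unfolding has_derivative_at_within divide_inverse_commute by (simp add: diff_diff_eq divide_inverse)
    moreover have "filterlim (\<lambda>n. z (r n)) (at z0) sequentially"
      using zr ne by (simp add: filterlim_at)
    ultimately have "(\<lambda>n. (1 / norm (z (r n) - z0)) *\<^sub>R (g i (z (r n)) - (g i z0 + D i (z (r n) - z0)))) \<longlonglongrightarrow> 0"
      by (rule filterlim_compose)
    moreover have "(1 / norm (z (r n) - z0)) *\<^sub>R (g i (z (r n)) - (g i z0 + D i (z (r n) - z0))) = - D i (w (r n))" for n
      using const[OF i] unfolding w_def by (simp add: D.scaleR)
    ultimately have "(\<lambda>n. - D i (w (r n))) \<longlonglongrightarrow> 0" by simp
    moreover have "(\<lambda>n. - D i (w (r n))) \<longlonglongrightarrow> - D i \<zeta>"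
      using r(3) by (intro tendsto_minus D.tendsto) (simp add: o_def)
    ultimately have "- D i \<zeta> = 0" by (rule LIMSEQ_unique[rotated])
    then show ?thesis by simp
  qed
  then show ?thesis using r(1) by auto
qed

text \<open>A substitute for implicit differentiation of an overdetermined linear system that
  depends on a parameter: \<open>w\<close> plays the role of the derivative of the unknown
  \<open>y\<close>. The sequence \<open>y\<close> may be unbounded, because each pair
  \<open>(t n, y n)\<close> is scaled to unit length before the limit is taken.\<close>

lemma implicit_direction:
  fixes a :: "'i \<Rightarrow> real \<Rightarrow> real" and l :: "'i \<Rightarrow> real \<Rightarrow> 'y::euclidean_space \<Rightarrow> real" and y :: "nat \<Rightarrow> 'y"
  assumes t: "t \<longlonglongrightarrow> 0" "\<And>n. 0 < t n"
    and a: "\<And>i. i \<in> I \<Longrightarrow> (a i has_real_derivative a' i) (at 0)" "\<And>i. i \<in> I \<Longrightarrow> a i 0 = 0"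
    and l: "\<And>i t. i \<in> I \<Longrightarrow> linear (l i t)"
      "\<And>i w. i \<in> I \<Longrightarrow> isCont (\<lambda>t. l i t w) 0"
    and eq: "\<And>i n. i \<in> I \<Longrightarrow> a i (t n) + l i (t n) (y n) = 0"
    and inj: "\<And>w. (\<And>i. i \<in> I \<Longrightarrow> l i 0 w = 0) \<Longrightarrow> w = 0"
  shows "\<exists>w. \<forall>i\<in>I. a' i + l i 0 w = 0"
proof -
  define \<rho> where "\<rho> n = norm (t n, y n)" for n
  have \<rho>: "\<rho> n > 0" for n unfolding \<rho>_def using t(2)[of n] by (simp add: prod_eq_iff zero_prod_def)
  define w where "w n = (1 / \<rho> n) *\<^sub>R (t n, y n)" for n
  have nw: "norm (w n) = 1" for n unfolding w_def norm_scaleR using \<rho>[of n] by (simp add: \<rho>_def del: scaleR_Pair)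
  then have "\<forall>n. w n \<in> sphere 0 1" by simp
  with compact_sphere[of 0 1] obtain \<zeta> r where r: "\<zeta> \<in> sphere 0 1" "strict_mono r" "(w \<circ> r) \<longlonglongrightarrow> \<zeta>"
    unfolding compact_def by metis
  have r1: "(\<lambda>n. t (r n) / \<rho> (r n)) \<longlonglongrightarrow> fst \<zeta>" and r2: "(\<lambda>n. (1 / \<rho> (r n)) *\<^sub>R y (r n)) \<longlonglongrightarrow> snd \<zeta>"
    using tendsto_fst[OF r(3)] tendsto_snd[OF r(3)] by (simp_all add: w_def o_def)
  have tr: "(\<lambda>n. t (r n)) \<longlonglongrightarrow> 0" using LIMSEQ_subseq_LIMSEQ[OF t(1) r(2)] by (simp add: o_def)
  then have tr': "filterlim (\<lambda>n. t (r n)) (at 0) sequentially"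
  proof -
    have "t (r n) \<noteq> 0" for n using t(2)[of "r n"] by simp
    then show ?thesis using tr by (simp add: filterlim_at)
  qed
  have main: "a' i * fst \<zeta> + l i 0 (snd \<zeta>) = 0" if i: "i \<in> I" for i
  proof -
    have "((\<lambda>s. a i s / s) \<longlongrightarrow> a' i) (at 0)"
      using a(1)[OF i] unfolding has_field_derivative_iff a(2)[OF i] by simp
    then have "(\<lambda>n. a i (t (r n)) / t (r n)) \<longlonglongrightarrow> a' i" using tr' by (rule filterlim_compose)
    then have 1: "(\<lambda>n. (a i (t (r n)) / t (r n)) * (t (r n) / \<rho> (r n))) \<longlonglongrightarrow> a' i * fst \<zeta>"
      by (intro tendsto_mult r1)
    have e: "l i s v = (\<Sum>b\<in>Basis. (v \<bullet> b) * l i s b)" for s v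
    proof -
      have "l i s v = l i s (\<Sum>b\<in>Basis. (v \<bullet> b) *\<^sub>R b)" by (simp add: euclidean_representation)
      also have "\<dots> = (\<Sum>b\<in>Basis. (v \<bullet> b) * l i s b)"
        using l(1)[OF i] by (simp add: linear_sum linear_scale)
      finally show ?thesis .
    qed
    have "(\<lambda>n. \<Sum>b\<in>Basis. ((1 / \<rho> (r n)) *\<^sub>R y (r n) \<bullet> b) * l i (t (r n)) b) \<longlonglongrightarrow> (\<Sum>b\<in>Basis. (snd \<zeta> \<bullet> b) * l i 0 b)"
      by (intro tendsto_intros r2 isCont_tendsto_compose[OF l(2)[OF i] tr])
    then have 2: "(\<lambda>n. l i (t (r n)) ((1 / \<rho> (r n)) *\<^sub>R y (r n))) \<longlonglongrightarrow> l i 0 (snd \<zeta>)"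
      unfolding e[symmetric] .
    have "(a i (t (r n)) / t (r n)) * (t (r n) / \<rho> (r n)) + l i (t (r n)) ((1 / \<rho> (r n)) *\<^sub>R y (r n)) = 0" for n
    proof -
      have "(a i (t (r n)) / t (r n)) * (t (r n) / \<rho> (r n)) + l i (t (r n)) ((1 / \<rho> (r n)) *\<^sub>R y (r n))
        = (1 / \<rho> (r n)) * (a i (t (r n)) + l i (t (r n)) (y (r n)))"
        using t(2)[of "r n"] by (simp add: linear_scale[OF l(1)[OF i]] add_divide_distrib)
      then show ?thesis using eq[OF i] by simp
    qed
    then have "(\<lambda>n::nat. 0) \<longlonglongrightarrow> a' i * fst \<zeta> + l i 0 (snd \<zeta>)" using tendsto_add[OF 1 2] by simp
    then show ?thesis by (simp add: LIMSEQ_const_iff)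
  qed
  \<comment> \<open>With a vanishing first component the limit would be a nonzero common zero of the
    maps \<open>l i 0\<close>, against \<open>inj\<close>.\<close>
  have "fst \<zeta> \<noteq> 0"
  proof
    assume 0: "fst \<zeta> = 0"
    have "snd \<zeta> = 0" by (rule inj) (use main 0 in auto)
    then show False using r(1) 0 by (simp add: norm_prod_def)
  qed
  then have "a' i + l i 0 ((1 / fst \<zeta>) *\<^sub>R snd \<zeta>) = 0" if "i \<in> I" for i
    using main[OF that] by (simp add: linear_scale[OF l(1)[OF that]] field_simps)
  then show ?thesis by blast
qed

section \<open>Surfaces in a Minkowski space\<close>

text \<open>The derivatives of \<open>B\<close> are extended by zero to the origin, and \<open>d1\<close> below is to be extended
  by zero off \<open>U\<close>, so that they are linear at every point.\<close>

locale minkowski_energy =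
  fixes B :: "'v::euclidean_space \<Rightarrow> real" and B1 :: "'v \<Rightarrow> 'v \<Rightarrow> real" and B2 :: "'v \<Rightarrow> 'v \<Rightarrow> 'v \<Rightarrow> real"
  assumes B_pos: "X \<noteq> 0 \<Longrightarrow> 0 < B X"
    and B_hom: "0 \<le> t \<Longrightarrow> B (t *\<^sub>R X) = t\<^sup>2 * B X"
    and B_der: "X \<noteq> 0 \<Longrightarrow> (B has_derivative B1 X) (at X)"
    and B1_der: "X \<noteq> 0 \<Longrightarrow> ((\<lambda>X. B1 X Y) has_derivative (\<lambda>Z. B2 X Z Y)) (at X)"
    and B1_0: "B1 0 Y = 0" and B2_0: "B2 0 Z Y = 0"
    and B2_pos: "X \<noteq> 0 \<Longrightarrow> Y \<noteq> 0 \<Longrightarrow> 0 < B2 X Y Y"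
begin

lemma B1_linear: "linear (B1 X)"
  by (cases "X = 0") (use B1_0 has_derivative_linear[OF B_der] in \<open>auto intro!: linearI\<close>)

lemmas B1_simps = linear_add[OF B1_linear] linear_diff[OF B1_linear] linear_scale[OF B1_linear]

lemma B2_sym: "B2 X Z Y = B2 X Y Z"
proof (cases "X = 0")
  case False
  then show ?thesis
    by (intro symmetric_second_derivative_real[of "- {0}" X B B1 Y "\<lambda>Z. B2 X Z Y" Z "\<lambda>Y. B2 X Y Z"])
       (auto intro!: B_der B1_der open_Compl)
qed (simp add: B2_0)

lemma B2_linear1: "linear (\<lambda>Z. B2 X Z Y)"
  by (cases "X = 0") (use B2_0 has_derivative_linear[OF B1_der] in \<open>auto intro!: linearI\<close>)

lemma B2_linear2: "linear (B2 X Z)"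
  using B2_linear1[of X Z] unfolding B2_sym[of X _ Z] by (simp add: eta_contract_eq)

lemmas B2_simps = linear_add[OF B2_linear1] linear_diff[OF B2_linear1] linear_scale[OF B2_linear1]
  linear_add[OF B2_linear2] linear_diff[OF B2_linear2] linear_scale[OF B2_linear2]

lemma B1_chain:
  assumes X: "(X has_derivative X') (at z)" and "X z \<noteq> 0" and Y: "(Y has_derivative Y') (at z)"
  shows "((\<lambda>z. B1 (X z) (Y z)) has_derivative (\<lambda>h. B2 (X z) (X' h) (Y z) + B1 (X z) (Y' h))) (at z)"
  by (rule has_derivative_linear_family)
     (auto intro!: B1_linear B2_linear2 Y has_derivative_compose[OF X B1_der] assms)

end

locale surface = minkowski_energy B B1 B2
  for B :: "'v::euclidean_space \<Rightarrow> real" and B1 B2 +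
  fixes U :: "(real^2) set" and F :: "real^2 \<Rightarrow> 'v" and d1 :: "real^2 \<Rightarrow> real^2 \<Rightarrow> 'v"
    and d2 :: "real^2 \<Rightarrow> real^2 \<Rightarrow> real^2 \<Rightarrow> 'v" and d3 :: "real^2 \<Rightarrow> real^2 \<Rightarrow> real^2 \<Rightarrow> real^2 \<Rightarrow> 'v"
  assumes open_U: "open U"
    and F_der: "x \<in> U \<Longrightarrow> (F has_derivative d1 x) (at x)"
    and d1_linear: "linear (d1 x)"
    and d1_der: "x \<in> U \<Longrightarrow> ((\<lambda>x. d1 x v) has_derivative (\<lambda>w. d2 x w v)) (at x)"
    and d2_der: "x \<in> U \<Longrightarrow> ((\<lambda>x. d2 x u v) has_derivative (\<lambda>w. d3 x w u v)) (at x)"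
    and d1_inj: "x \<in> U \<Longrightarrow> v \<noteq> 0 \<Longrightarrow> d1 x v \<noteq> 0"
    and dim3: "DIM('v) = 3"
begin

lemma d2_sym: "x \<in> U \<Longrightarrow> d2 x w u = d2 x u w"
  using symmetric_second_derivative[of U x F d1 u "\<lambda>h. d2 x h u" w "\<lambda>h. d2 x h w"]
  by (simp add: open_U F_der d1_der)

lemma d2_linear1: "x \<in> U \<Longrightarrow> linear (\<lambda>w. d2 x w v)"
  using d1_der has_derivative_linear by blast

lemma d2_linear2: "x \<in> U \<Longrightarrow> linear (d2 x w)"
  using d2_linear1[of x w] d2_sym[of x _ w] by simp

lemma d3_sym12: "x \<in> U \<Longrightarrow> d3 x w u v = d3 x u w v"
  using symmetric_second_derivative[of U x "\<lambda>x. d1 x v" "\<lambda>x h. d2 x h v" u "\<lambda>h. d3 x h u v"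
      w "\<lambda>h. d3 x h w v"]
  by (simp add: open_U d1_der d2_der)

lemma d3_sym23:
  assumes "x \<in> U" shows "d3 x w u v = d3 x w v u"
proof -
  have "((\<lambda>x. d2 x u v) has_derivative (\<lambda>w. d3 x w v u)) (at x)"
    by (rule has_derivative_transform_within_open[OF d2_der open_U]) (use assms d2_sym in auto)
  from fun_cong[OF has_derivative_unique[OF d2_der[OF assms] this]] show ?thesis .
qed

lemma d3_linear1: "x \<in> U \<Longrightarrow> linear (\<lambda>w. d3 x w u v)"
  using d2_der has_derivative_linear by blast

lemma d3_bilinear: 
  assumes "x \<in> U" shows "bilinear (d3 x w)"
proof -
  have "linear (\<lambda>u. d3 x w u v)" for v
    using d3_linear1[OF assms, of w v] unfolding d3_sym12[OF assms, of _ w] .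
  moreover from this have "linear (\<lambda>v. d3 x w u v)" for u
    unfolding d3_sym23[OF assms, of w u] by simp
  ultimately show ?thesis by (simp add: bilinear_def)
qed

lemma d2_bilinear: "x \<in> U \<Longrightarrow> bilinear (d2 x)"
  by (simp add: bilinear_def d2_linear1 d2_linear2)

lemma d1_0: "d1 x 0 = 0" using d1_linear by (rule linear_0)

text \<open>With \<open>v\<close> fixed, \<open>G\<close> and \<open>H\<close> are the first and
  second derivatives of \<open>q x v\<close> in \<open>x\<close>, while \<open>q'\<close> is the
  derivative in \<open>v\<close>. All of them are therefore determined by the metric in the chart,
  although they are written through the embedding.\<close>

definition q :: "real^2 \<Rightarrow> real^2 \<Rightarrow> real" where "q x v = B (d1 x v)"
definition q' :: "real^2 \<Rightarrow> real^2 \<Rightarrow> real^2 \<Rightarrow> real" where "q' x v w = B1 (d1 x v) (d1 x w)"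
definition G :: "real^2 \<Rightarrow> real^2 \<Rightarrow> real^2 \<Rightarrow> real" where "G x u v = B1 (d1 x v) (d2 x u v)"
definition H :: "real^2 \<Rightarrow> real^2 \<Rightarrow> real^2 \<Rightarrow> real^2 \<Rightarrow> real" where
  "H x w u v = B2 (d1 x v) (d2 x w v) (d2 x u v) + B1 (d1 x v) (d3 x w u v)"

lemma d1_joint_der:
  assumes "x \<in> U"
  shows "((\<lambda>z. d1 (fst z) (snd z)) has_derivative (\<lambda>h. d2 x (fst h) v + d1 x (snd h))) (at (x, v))"
proof -
  have "((\<lambda>z. d1 (fst z) b) has_derivative (\<lambda>h. d2 x (fst h) b)) (at (x, v))" for b
    by (rule has_derivative_compose[where g = "\<lambda>x. d1 x b" and f = fst])
       (use d1_der[OF assms] in \<open>auto intro: bounded_linear_imp_has_derivative bounded_linear_fst\<close>)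
  from has_derivative_linear_family[OF d1_linear this d2_linear2[OF assms]
      bounded_linear_imp_has_derivative[OF bounded_linear_snd]]
  show ?thesis by simp
qed

lemma q_joint_der:
  assumes "x \<in> U" "v \<noteq> 0"
  shows "((\<lambda>z. q (fst z) (snd z)) has_derivative (\<lambda>h. G x (fst h) v + q' x v (snd h))) (at (x, v))"
  using has_derivative_compose[OF d1_joint_der[OF assms(1), of v] B_der[of "d1 (fst (x,v)) (snd (x,v))"]] d1_inj[OF assms]
  by (simp add: q_def G_def q'_def B1_simps)

lemma q_der:
  assumes "x \<in> U" "v \<noteq> 0" shows "(q x has_derivative q' x v) (at v)"
  unfolding q_def q'_def
  by (rule has_derivative_compose[where g = B and f = "d1 x", OF _ B_der[OF d1_inj[OF assms]]])
     (simp add: d1_linear linear_imp_has_derivative)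

lemma q_base_der:
  assumes "x \<in> U" "v \<noteq> 0" shows "((\<lambda>x. q x v) has_derivative (\<lambda>w. G x w v)) (at x)"
  unfolding q_def G_def
  by (rule has_derivative_compose[where g = B and f = "\<lambda>x. d1 x v", OF d1_der[OF assms(1)] B_der[OF d1_inj[OF assms]]])

lemma G_base_der:
  assumes "x \<in> U" "v \<noteq> 0" shows "((\<lambda>x. G x u v) has_derivative (\<lambda>w. H x w u v)) (at x)"
  unfolding G_def H_def
  by (rule B1_chain[OF d1_der[OF assms(1)] d1_inj[OF assms] d2_der[OF assms(1)]])

lemma q_pos: "x \<in> U \<Longrightarrow> v \<noteq> 0 \<Longrightarrow> 0 < q x v"
  unfolding q_def by (intro B_pos d1_inj)

lemma q_hom: "0 \<le> t \<Longrightarrow> q x (t *\<^sub>R v) = t\<^sup>2 * q x v"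
  unfolding q_def by (simp add: linear_scale[OF d1_linear] B_hom)

lemma q'_linear: "linear (q' x v)"
  unfolding q'_def using linear_compose[OF d1_linear B1_linear] by (simp add: o_def)

lemma G_linear: "x \<in> U \<Longrightarrow> linear (\<lambda>u. G x u v)"
  unfolding G_def using linear_compose[OF d2_linear1 B1_linear] by (simp add: o_def)

lemma fibre_derivative:
  assumes "x \<in> U" "v \<noteq> 0"
  shows "((\<lambda>v. B1 (d1 x v) Y) has_derivative (\<lambda>a. B2 (d1 x v) (d1 x a) Y)) (at v)"
  by (rule has_derivative_compose[where g = "\<lambda>X. B1 X Y" and f = "d1 x", OF _ B1_der[OF d1_inj[OF assms]]])
     (simp add: d1_linear linear_imp_has_derivative)

lemma plane:
  assumes "x \<in> U" "\<not> quadratic (q x)"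
  shows "minkowski_plane (q x) (q' x)"
proof
  show "continuous_on (- {0}) (\<lambda>v. q' x v w)" for w
    unfolding q'_def
    by (intro continuous_at_imp_continuous_on ballI has_derivative_continuous[OF fibre_derivative])
       (use assms in auto)
qed (use assms in \<open>auto intro: q_pos q_hom q_der\<close>)

end

section \<open>Differentiating the isometries between tangent spaces\<close>

context surface
begin

text \<open>Compactness of the unit circles over a closed ball, extended by homogeneity. These
  bounds keep isometries between nearby fibres bounded and their limits injective.\<close>

lemma q_bounds_near:
  assumes "x \<in> U"
  shows "\<exists>r>0. \<exists>a>0. \<exists>b>0. cball x r \<subseteq> U \<and> (\<forall>y\<in>cball x r. \<forall>w. a * (norm w)\<^sup>2 \<le> q y w \<and> q y w \<le> b * (norm w)\<^sup>2)"
proof -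
  obtain r where r: "r > 0" "cball x r \<subseteq> U" using open_U assms open_contains_cball by metis
  let ?K = "cball x r \<times> sphere (0 :: real^2) 1"
  have K: "compact ?K" by (intro compact_Times compact_cball compact_sphere)
  have "(x, e1) \<in> ?K" using r(1) by simp
  then have ne: "?K \<noteq> {}" by blast
  have c: "continuous_on ?K (\<lambda>z. q (fst z) (snd z))"
  proof (intro continuous_at_imp_continuous_on ballI)
    fix z assume "z \<in> ?K"
    then have "fst z \<in> U" "snd z \<noteq> 0" using r(2) by auto
    from has_derivative_continuous[OF q_joint_der[OF this]] show "isCont (\<lambda>z. q (fst z) (snd z)) z" by simp
  qed
  obtain z where z: "z \<in> ?K" "\<And>y. y \<in> ?K \<Longrightarrow> q (fst z) (snd z) \<le> q (fst y) (snd y)"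
    using continuous_attains_inf[OF K ne c] by blast
  obtain z' where z': "z' \<in> ?K" "\<And>y. y \<in> ?K \<Longrightarrow> q (fst y) (snd y) \<le> q (fst z') (snd z')"
    using continuous_attains_sup[OF K ne c] by blast
  have pos: "0 < q (fst z) (snd z)" "0 < q (fst z') (snd z')"
    by (rule q_pos; use z(1) z'(1) r(2) in auto)+
  have "q (fst z) (snd z) * (norm w)\<^sup>2 \<le> q y w \<and> q y w \<le> q (fst z') (snd z') * (norm w)\<^sup>2"
    if y: "y \<in> cball x r" for y w
  proof (cases "w = 0")
    case True
    then show ?thesis using q_hom[of 0 y 0] by simp
  next
    case False
    then have "(y, (1 / norm w) *\<^sub>R w) \<in> ?K" using y by simp
    moreover have "q y w = (norm w)\<^sup>2 * q y ((1 / norm w) *\<^sub>R w)"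
      using q_hom[of "norm w" y "(1 / norm w) *\<^sub>R w"] False by simp
    ultimately show ?thesis using z(2)[of "(y, (1 / norm w) *\<^sub>R w)"] z'(2)[of "(y, (1 / norm w) *\<^sub>R w)"]
      by (simp add: mult.commute mult_left_mono)
  qed
  then show ?thesis using r pos by blast
qed

text \<open>Monochromaticity read in the chart. Such an \<open>L\<close> is automatically
  invertible, since \<open>q\<close> is positive off zero.\<close>

definition isometric_fibres :: bool where
  "isometric_fibres \<longleftrightarrow> (\<forall>x\<in>U. \<forall>y\<in>U. \<exists>L. linear L \<and> (\<forall>v. q y (L v) = q x v))"

text \<open>Isometries from the fibre at \<open>x\<close> to the fibres along a sequence in the
  direction \<open>u\<close> come without continuity. They are uniformly bounded, so a subsequence
  converges, and its limit is an isometry of the fibre at \<open>x\<close>. Composition with the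
  inverse of the limit moves the limit to the identity; \<open>m1\<close> and \<open>m2\<close> are
  the images of the basis vectors.\<close>

lemma isometries_near_identity:
  assumes mono: "isometric_fibres" and x: "x \<in> U"
  shows "\<exists>t m1 m2. t \<longlonglongrightarrow> 0 \<and> (\<forall>n. 0 < t n) \<and> m1 \<longlonglongrightarrow> e1 \<and> m2 \<longlonglongrightarrow> e2 \<and>
    (\<forall>n v. q (x + t n *\<^sub>R u) (v $ 1 *\<^sub>R m1 n + v $ 2 *\<^sub>R m2 n) = q x v)"
proof -
  obtain r a b where r: "r > 0" "cball x r \<subseteq> U" and ab: "a > 0" "b > 0"
    "\<And>y w. y \<in> cball x r \<Longrightarrow> a * (norm w)\<^sup>2 \<le> q y w" "\<And>y w. y \<in> cball x r \<Longrightarrow> q y w \<le> b * (norm w)\<^sup>2"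
    using q_bounds_near[OF x] by blast
  define s where "s n = (r / (norm u + 1)) * inverse (real (Suc n))" for n
  have nu: "norm u + 1 > 0" by (simp add: add_nonneg_pos)
  have s_pos: "0 < s n" for n unfolding s_def using r(1) nu by simp
  have "s \<longlonglongrightarrow> (r / (norm u + 1)) * 0" unfolding s_def
    by (intro tendsto_intros LIMSEQ_inverse_real_of_nat)
  then have s_lim: "s \<longlonglongrightarrow> 0" by simp
  define y where "y n = x + s n *\<^sub>R u" for n
  have y: "y n \<in> cball x r" for n
  proof -
    have "s n * norm u \<le> (r / (norm u + 1)) * 1 * norm u" unfolding s_def
      using r(1) nu by (intro mult_right_mono mult_left_mono) (simp_all add: inverse_eq_divide)
    also have "\<dots> \<le> r" using r(1) nu by (simp add: field_simps)
    finally show ?thesis unfolding y_def using s_pos[of n] by (simp add: dist_norm)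
  qed
  have "\<forall>n. \<exists>L. linear L \<and> (\<forall>v. q (y n) (L v) = q x v)"
    using mono x y r(2) unfolding isometric_fibres_def by blast
  then obtain L where L: "\<And>n. linear (L n)" "\<And>n v. q (y n) (L n v) = q x v" by metis
  have up: "(norm (L n v))\<^sup>2 \<le> q x v / a" and lo: "q x v / b \<le> (norm (L n v))\<^sup>2" for n v
    using ab(3)[OF y, of "L n v" n] ab(4)[OF y, of n "L n v"] L(2)[of n v] ab(1,2) by (simp_all add: field_simps)
  have bd: "bounded (range (\<lambda>n. L n v))" for v
  proof (rule boundedI)
    fix z assume "z \<in> range (\<lambda>n. L n v)"
    then show "norm z \<le> sqrt (q x v / a)" using up[of _ v] by (auto intro!: real_le_rsqrt)
  qed
  have "bounded (range (\<lambda>n. (L n e1, L n e2)))"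
    by (rule bounded_subset[OF bounded_Times[OF bd[of e1] bd[of e2]]]) auto
  then obtain l k where k: "strict_mono k" "((\<lambda>n. (L n e1, L n e2)) \<circ> k) \<longlonglongrightarrow> l"
    using bounded_imp_convergent_subsequence by blast
  have l1: "(\<lambda>n. L (k n) e1) \<longlonglongrightarrow> fst l" and l2: "(\<lambda>n. L (k n) e2) \<longlonglongrightarrow> snd l"
    using tendsto_fst[OF k(2)] tendsto_snd[OF k(2)] by (simp_all add: o_def)
  define L0 where "L0 v = v $ 1 *\<^sub>R fst l + v $ 2 *\<^sub>R snd l" for v :: "real^2"
  have linL0: "linear L0" unfolding L0_def by (rule linearI) (simp_all add: algebra_simps)
  have lim: "(\<lambda>n. L (k n) v) \<longlonglongrightarrow> L0 v" for v
    unfolding L0_def linear_plane[OF L(1), of _ v] by (intro tendsto_intros l1 l2)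
  have ne: "L0 v \<noteq> 0" if "v \<noteq> 0" for v
  proof
    assume "L0 v = 0"
    moreover have "q x v / b \<le> (norm (L0 v))\<^sup>2"
      by (rule tendsto_lowerbound[OF tendsto_power[OF tendsto_norm[OF lim[of v]]]])
         (use lo in auto)
    ultimately show False using q_pos[OF x that] ab(2) by (simp add: field_simps)
  qed
  have injL0: "inj L0" using ne linear_injective_0[OF linL0] by blast
  then obtain K where K: "linear K" "\<And>v. K (L0 v) = v" "\<And>v. L0 (K v) = v"
    using linear_injective_isomorphism[OF linL0] by blast
  have yk: "(\<lambda>n. y (k n)) \<longlonglongrightarrow> x + 0 *\<^sub>R u" unfolding y_def
    using LIMSEQ_subseq_LIMSEQ[OF s_lim k(1)] by (intro tendsto_intros) (simp add: o_def)
  have qL0: "q x (L0 v) = q x v" for v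
  proof (cases "v = 0")
    case False
    have "isCont (\<lambda>z. q (fst z) (snd z)) (x, L0 v)"
      by (rule has_derivative_continuous[OF q_joint_der[OF x ne[OF False]]])
    moreover have "(\<lambda>n. (y (k n), L (k n) v)) \<longlonglongrightarrow> (x, L0 v)"
      using tendsto_Pair[OF yk lim[of v]] by simp
    ultimately have "(\<lambda>n. q (y (k n)) (L (k n) v)) \<longlonglongrightarrow> q x (L0 v)"
      using isCont_tendsto_compose[of "(x, L0 v)" "\<lambda>z. q (fst z) (snd z)"] by fastforce
    then show ?thesis using L(2) by (simp add: LIMSEQ_const_iff)
  qed (simp add: linear_0[OF linL0])
  define m where "m i n = L (k n) (K i)" for i n
  have m: "m i \<longlonglongrightarrow> i" for i unfolding m_def using lim[of "K i"] K(3) by simp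
  have lin: "linear (\<lambda>v. L (k n) (K v))" for n
    using linear_compose[OF K(1) L(1)[of "k n"]] by (simp add: o_def)
  have "q (x + s (k n) *\<^sub>R u) (v $ 1 *\<^sub>R m e1 n + v $ 2 *\<^sub>R m e2 n) = q x v" for n v
  proof -
    have "v $ 1 *\<^sub>R m e1 n + v $ 2 *\<^sub>R m e2 n = L (k n) (K v)"
      unfolding m_def by (rule linear_plane[OF lin, symmetric])
    moreover have "q x (K v) = q x v" using qL0[of "K v"] K(3) by simp
    ultimately show ?thesis using L(2)[of "k n" "K v"] by (simp add: y_def)
  qed
  moreover have "(\<lambda>n. s (k n)) \<longlonglongrightarrow> 0" using LIMSEQ_subseq_LIMSEQ[OF s_lim k(1)] by (simp add: o_def)
  ultimately show ?thesis using s_pos m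
    by (intro exI[of _ "\<lambda>n. s (k n)"] exI[of _ "m e1"] exI[of _ "m e2"]) simp
qed

text \<open>The sequence of isometries is blown up at the identity, with the parameter
  \<open>t\<close> as an extra coordinate. All \<open>v\<close> give equations for one limit
  direction \<open>\<zeta>\<close>. If its \<open>t\<close> component were zero, the remaining
  linear field would annihilate \<open>q x\<close>, which a non-Euclidean norm does not
  allow.\<close>

lemma infinitesimal_isometry:
  assumes mono: "isometric_fibres" and x: "x \<in> U" and nq: "\<not> quadratic (q x)"
  shows "\<exists>T. linear T \<and> (\<forall>v. v \<noteq> 0 \<longrightarrow> G x u v = q' x v (T v))"
proof -
  interpret minkowski_plane "q x" "q' x" using plane x nq by blast
  obtain t m1 m2 where t: "t \<longlonglongrightarrow> 0" "\<And>n. 0 < t n" and m: "m1 \<longlonglongrightarrow> e1" "m2 \<longlonglongrightarrow> e2"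
    and eq: "\<And>n v. q (x + t n *\<^sub>R u) (v $ 1 *\<^sub>R m1 n + v $ 2 *\<^sub>R m2 n) = q x v"
    using isometries_near_identity[OF mono x, of u] by blast
  define W :: "(real^2) \<times> (real^2) \<Rightarrow> real^2 \<Rightarrow> real^2" where "W m v = v $ 1 *\<^sub>R fst m + v $ 2 *\<^sub>R snd m" for m v
  have W1: "W (e1, e2) v = v" for v unfolding W_def using plane_expand[of v] by simp
  have linW: "linear (W m)" for m unfolding W_def by (rule linearI) (simp_all add: algebra_simps)
  define \<Psi> where "\<Psi> v z = q (x + fst z *\<^sub>R u) (W (snd z) v)" for v and z :: "real \<times> (real^2) \<times> (real^2)"
  have der: "(\<Psi> v has_derivative (\<lambda>h. fst h * G x u v + q' x v (W (snd h) v))) (at (0, e1, e2))" if v: "v \<noteq> 0" for v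
  proof -
    have "((\<lambda>z. (x + fst z *\<^sub>R u, W (snd z) v)) has_derivative (\<lambda>h. (fst h *\<^sub>R u, W (snd h) v))) (at (0, e1, e2))"
      unfolding W_def by (auto intro!: derivative_eq_intros)
    from has_derivative_compose[where g = "\<lambda>z. q (fst z) (snd z)", OF this, of "\<lambda>h. G x (fst h) v + q' x v (snd h)"]
    show ?thesis unfolding \<Psi>_def using q_joint_der[OF x v] W1 by (simp add: linear_scale[OF G_linear[OF x]])
  qed
  have lim: "(\<lambda>n. (t n, m1 n, m2 n)) \<longlonglongrightarrow> (0, e1, e2)" by (intro tendsto_Pair t m)
  have "\<exists>\<zeta>. norm \<zeta> = 1 \<and> (\<forall>v\<in>- {0}. fst \<zeta> * G x u v + q' x v (W (snd \<zeta>) v) = 0)"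
  proof (rule common_limit_direction[OF lim])
    show "(t n, m1 n, m2 n) \<noteq> (0, e1, e2)" for n using t(2)[of n] by simp
    show "\<Psi> v (t n, m1 n, m2 n) = \<Psi> v (0, e1, e2)" for v n
      using eq[of n v] W1 by (simp add: \<Psi>_def W_def)
    show "(\<Psi> v has_derivative (\<lambda>h. fst h * G x u v + q' x v (W (snd h) v))) (at (0, e1, e2))" if "v \<in> - {0}" for v
      using der that by simp
  qed
  then obtain \<zeta> where \<zeta>: "norm \<zeta> = 1" "\<And>v. v \<noteq> 0 \<Longrightarrow> fst \<zeta> * G x u v + q' x v (W (snd \<zeta>) v) = 0" by auto
  have "fst \<zeta> \<noteq> 0"
  proof
    assume 0: "fst \<zeta> = 0"
    then have "W (snd \<zeta>) v = 0" for v using \<zeta>(2) by (intro linear_field_zero[OF linW]) auto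
    from this[of e1] this[of e2] have "snd \<zeta> = 0" unfolding W_def by (simp add: plane_basis prod_eq_iff)
    with 0 have "\<zeta> = 0" by (simp add: prod_eq_iff)
    then show False using \<zeta>(1) by simp
  qed
  define T where "T v = (- 1 / fst \<zeta>) *\<^sub>R W (snd \<zeta>) v" for v
  have "linear T" unfolding T_def by (rule linear_compose_scale_right[OF linW])
  moreover have "G x u v = q' x v (T v)" if "v \<noteq> 0" for v
    using \<zeta>(2)[OF that] \<open>fst \<zeta> \<noteq> 0\<close> unfolding T_def linear_scale[OF q'_linear] by (simp add: field_simps)
  ultimately show ?thesis by blast
qed

lemma infinitesimal_isometries:
  assumes mono: "isometric_fibres" and x: "x \<in> U" and nq: "\<not> quadratic (q x)"
  shows "\<exists>T. bilinear T \<and> (\<forall>u v. v \<noteq> 0 \<longrightarrow> G x u v = q' x v (T u v))"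
proof -
  obtain T1 T2 where T1: "linear T1" "\<And>v. v \<noteq> 0 \<Longrightarrow> G x e1 v = q' x v (T1 v)"
    and T2: "linear T2" "\<And>v. v \<noteq> 0 \<Longrightarrow> G x e2 v = q' x v (T2 v)"
    using infinitesimal_isometry[OF assms] by metis
  define T where "T u v = u $ 1 *\<^sub>R T1 v + u $ 2 *\<^sub>R T2 v" for u v :: "real^2"
  have "bilinear T" unfolding T_def bilinear_def
    by (auto intro!: linearI simp: linear_add[OF T1(1)] linear_add[OF T2(1)] linear_scale[OF T1(1)]
        linear_scale[OF T2(1)] algebra_simps)
  moreover have "G x u v = q' x v (T u v)" if "v \<noteq> 0" for u v
    using linear_plane[OF G_linear[OF x], of u v] T1(2)[OF that] T2(2)[OF that]
    unfolding T_def by (simp add: linear_add[OF q'_linear] linear_scale[OF q'_linear])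
  ultimately show ?thesis by blast
qed

end

section \<open>The non-Euclidean case\<close>

context surface
begin

text \<open>The inner product of \<open>'v\<close> is unrelated to the norm; \<open>n\<close> merely
  represents the quotient map modulo the tangent plane. Rescaling that functional multiplies
  \<open>shape_det\<close> by a positive square, so the sign of \<open>shape_det\<close> is
  meaningful.\<close>

definition normal :: "real^2 \<Rightarrow> 'v \<Rightarrow> bool" where
  "normal x n \<longleftrightarrow> norm n = 1 \<and> (\<forall>a. n \<bullet> d1 x a = 0)"

definition shape_det :: "real^2 \<Rightarrow> 'v \<Rightarrow> real" where
  "shape_det x n = (n \<bullet> d2 x e1 e1) * (n \<bullet> d2 x e2 e2) - (n \<bullet> d2 x e1 e2)\<^sup>2"

lemma d1_injective: "x \<in> U \<Longrightarrow> inj (d1 x)"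
  using linear_injective_0[OF d1_linear] d1_inj by blast

lemma dim_range_d1: "x \<in> U \<Longrightarrow> dim (range (d1 x)) = 2"
  using dim_image_eq[OF d1_linear, of x UNIV] d1_injective by (simp add: dim_UNIV)

lemma normal_exists:
  assumes "x \<in> U" obtains n where "normal x n"
proof -
  have "dim (range (d1 x)) < DIM('v)" using dim_range_d1[OF assms] dim3 by simp
  then obtain y where y: "y \<noteq> 0" "\<And>z. z \<in> span (range (d1 x)) \<Longrightarrow> orthogonal y z"
    using orthogonal_to_subspace_exists by blast
  have "normal x ((1 / norm y) *\<^sub>R y)"
    using y span_base[of _ "range (d1 x)"] by (auto simp: normal_def orthogonal_def)
  then show ?thesis using that by blast
qed

lemma normal_kernel:
  assumes x: "x \<in> U" and n: "normal x n" and y: "n \<bullet> y = 0"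
  shows "y \<in> range (d1 x)"
proof -
  have "n \<noteq> 0" using n by (auto simp: normal_def)
  then have "dim {y. n \<bullet> y = 0} = 2" using dim_hyperplane[of n] dim3 by simp
  moreover have "range (d1 x) \<subseteq> {y. n \<bullet> y = 0}" using n by (auto simp: normal_def)
  ultimately have "range (d1 x) = {y. n \<bullet> y = 0}"
    using dim_range_d1[OF x]
    by (intro subspace_dim_equal linear_subspace_image d1_linear subspace_UNIV subspace_hyperplane) auto
  then show ?thesis using y by blast
qed

lemma tangential_projection:
  assumes x: "x \<in> U" and n: "normal x n"
  obtains g where "linear g" "\<And>a. g (d1 x a) = a" "\<And>y. y = d1 x (g y) + (n \<bullet> y) *\<^sub>R n"
proof -
  obtain g where g: "linear g" "g \<circ> d1 x = id"
    using linear_injective_left_inverse[OF d1_linear d1_injective[OF x]] by blast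
  have nn: "n \<bullet> n = 1" using n by (simp add: normal_def dot_square_norm)
  \<comment> \<open>An arbitrary left inverse of \<open>d1 x\<close> need not kill \<open>n\<close>,
    so the normal component is removed before it is applied.\<close>
  let ?p = "\<lambda>y. y - (n \<bullet> y) *\<^sub>R n"
  have "linear ?p" by (rule linearI) (simp_all add: algebra_simps)
  then have "linear (\<lambda>y. g (?p y))" using linear_compose[OF _ g(1)] by (simp add: o_def)
  moreover have "g (?p (d1 x a)) = a" for a using n fun_cong[OF g(2), of a] by (simp add: normal_def)
  moreover have "y = d1 x (g (?p y)) + (n \<bullet> y) *\<^sub>R n" for y
  proof -
    have "n \<bullet> ?p y = 0" by (simp add: inner_diff_right nn)
    then obtain a where a: "?p y = d1 x a" using normal_kernel[OF x n] by blast
    then have "d1 x (g (?p y)) = ?p y" using fun_cong[OF g(2), of a] by simp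
    then show ?thesis by simp
  qed
  ultimately show ?thesis using that by blast
qed

lemma shape_form:
  assumes x: "x \<in> U"
  shows "n \<bullet> d2 x u v = symform (n \<bullet> d2 x e1 e1) (n \<bullet> d2 x e1 e2) (n \<bullet> d2 x e2 e2) u v"
  by (subst bilinear_plane[OF d2_bilinear[OF x], of u v])
     (simp add: symform_def inner_add_right d2_sym[OF x, of e2 e1] algebra_simps)

text \<open>A determinant vanishes exactly when there is a kernel vector. Its normalisation to unit
  length lets it survive a passage to the limit.\<close>

lemma shape_det_zero_iff:
  assumes x: "x \<in> U"
  shows "shape_det x n = 0 \<longleftrightarrow> (\<exists>u. norm u = 1 \<and> (\<forall>v. n \<bullet> d2 x u v = 0))"
proof
  assume 0: "shape_det x n = 0"
  define S :: "real^2 \<Rightarrow> real^2" where "S u = (n \<bullet> d2 x u e1) *\<^sub>R e1 + (n \<bullet> d2 x u e2) *\<^sub>R e2" for u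
  have "linear S" unfolding S_def
    by (rule linearI) (simp_all add: linear_add[OF d2_linear1[OF x]] linear_scale[OF d2_linear1[OF x]] algebra_simps)
  moreover have "S e1 $ 1 * S e2 $ 2 = S e2 $ 1 * S e1 $ 2"
    using 0 unfolding S_def shape_det_def by (simp add: plane_basis d2_sym[OF x, of e2 e1] power2_eq_square)
  ultimately obtain u where u: "u \<noteq> 0" "S u = 0" using singular_kernel by blast
  have "n \<bullet> d2 x u e1 = 0" "n \<bullet> d2 x u e2 = 0"
    using u(2) unfolding S_def by (simp_all add: vec_eq_iff forall_2 plane_basis)
  then have "n \<bullet> d2 x u v = 0" for v
    using linear_plane[OF d2_linear2[OF x], of u v] by (simp add: inner_add_right)
  then have "norm ((1 / norm u) *\<^sub>R u) = 1 \<and> (\<forall>v. n \<bullet> d2 x ((1 / norm u) *\<^sub>R u) v = 0)"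
    using u(1) by (simp add: linear_scale[OF d2_linear1[OF x]])
  then show "\<exists>u. norm u = 1 \<and> (\<forall>v. n \<bullet> d2 x u v = 0)" by blast
next
  assume "\<exists>u. norm u = 1 \<and> (\<forall>v. n \<bullet> d2 x u v = 0)"
  then obtain u where u: "u \<noteq> 0" "\<And>v. n \<bullet> d2 x u v = 0" by (metis norm_zero zero_neq_one)
  let ?a = "n \<bullet> d2 x e1 e1" and ?b = "n \<bullet> d2 x e1 e2" and ?c = "n \<bullet> d2 x e2 e2"
  have 1: "?a * u $ 1 + ?b * u $ 2 = 0" "?b * u $ 1 + ?c * u $ 2 = 0"
    using u(2)[of e1] u(2)[of e2] unfolding shape_form[OF x, of n u] symform_def by (simp_all add: plane_basis)
  have "(?a * ?c - ?b\<^sup>2) * u $ 1 = 0" "(?a * ?c - ?b\<^sup>2) * u $ 2 = 0" using 1 by algebra+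
  then show "shape_det x n = 0" using u(1) unfolding shape_det_def by (auto simp: vec_eq_iff forall_2)
qed

lemma d2_tendsto:
  assumes x: "x \<in> U" and y: "\<And>k. y k \<in> U" "y \<longlonglongrightarrow> x" and u: "u \<longlonglongrightarrow> (u0 :: real^2)"
  shows "(\<lambda>k. d2 (y k) (u k) v) \<longlonglongrightarrow> d2 x u0 v"
proof -
  have "(\<lambda>k. d2 (y k) w v) \<longlonglongrightarrow> d2 x w v" for w
    using isCont_tendsto_compose[OF has_derivative_continuous[OF d2_der[OF x]] y(2)] .
  then have "(\<lambda>k. u k $ 1 *\<^sub>R d2 (y k) e1 v + u k $ 2 *\<^sub>R d2 (y k) e2 v) \<longlonglongrightarrow> u0 $ 1 *\<^sub>R d2 x e1 v + u0 $ 2 *\<^sub>R d2 x e2 v"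
    by (intro tendsto_intros u)
  moreover have "u k $ 1 *\<^sub>R d2 (y k) e1 v + u k $ 2 *\<^sub>R d2 (y k) e2 v = d2 (y k) (u k) v" for k
    by (rule linear_plane[OF d2_linear1[OF y(1)], symmetric])
  moreover have "u0 $ 1 *\<^sub>R d2 x e1 v + u0 $ 2 *\<^sub>R d2 x e2 v = d2 x u0 v"
    by (rule linear_plane[OF d2_linear1[OF x], symmetric])
  ultimately show ?thesis by simp
qed

text \<open>No continuous field of normals is chosen. Were the claim false, unit normals and unit
  kernel vectors at points tending to \<open>x\<close> would subconverge to a normal and a kernel
  vector at \<open>x\<close>.\<close>

lemma shape_det_nonzero_near:
  assumes x: "x \<in> U" and nd: "\<And>n. normal x n \<Longrightarrow> shape_det x n \<noteq> 0"
  shows "\<exists>r>0. ball x r \<subseteq> U \<and> (\<forall>y\<in>ball x r. \<forall>n. normal y n \<longrightarrow> shape_det y n \<noteq> 0)"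
proof (rule ccontr)
  assume contra: "\<not> ?thesis"
  obtain R where R: "R > 0" "ball x R \<subseteq> U" using open_U x open_contains_ball by metis
  define r where "r k = R * inverse (real (Suc k))" for k
  have r: "0 < r k" "r k \<le> R" for k unfolding r_def using R(1) by (simp_all add: inverse_eq_divide field_simps)
  have rl: "r \<longlonglongrightarrow> 0" unfolding r_def
    using tendsto_mult_left[OF LIMSEQ_inverse_real_of_nat, of R] by simp
  have "\<exists>y n. y \<in> ball x (r k) \<and> normal y n \<and> shape_det y n = 0" for k
  proof -
    have "ball x (r k) \<subseteq> U" using R(2) r(2)[of k] subset_ball by blast
    then show ?thesis using contra r(1)[of k] by blast
  qed
  then obtain y n where y: "\<And>k. y k \<in> ball x (r k)" and n: "\<And>k. normal (y k) (n k)" "\<And>k. shape_det (y k) (n k) = 0" by metis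
  have yU: "y k \<in> U" for k using y[of k] R(2) r(2)[of k] by auto
  have yl: "y \<longlonglongrightarrow> x"
  proof (rule metric_LIMSEQ_I)
    fix e :: real assume "e > 0"
    with rl obtain K where "\<And>k. k \<ge> K \<Longrightarrow> norm (r k - 0) < e" using LIMSEQ_D by metis
    then have "dist (y k) x < e" if "k \<ge> K" for k
      using y[of k] that r(1)[of k] by (fastforce simp: dist_commute)
    then show "\<exists>K. \<forall>k\<ge>K. dist (y k) x < e" by blast
  qed
  have "\<forall>k. \<exists>u. norm u = 1 \<and> (\<forall>v. n k \<bullet> d2 (y k) u v = 0)"
    using n(2) shape_det_zero_iff[OF yU] by simp
  then obtain u where u: "\<And>k. norm (u k) = 1" "\<And>k v. n k \<bullet> d2 (y k) (u k) v = 0" by metis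
  have "\<forall>k. (n k, u k) \<in> sphere 0 1 \<times> sphere 0 1" using n(1) u(1) by (simp add: normal_def)
  moreover have "compact (sphere (0::'v) 1 \<times> sphere (0::real^2) 1)" by (intro compact_Times compact_sphere)
  ultimately have "\<exists>l\<in>sphere (0::'v) 1 \<times> sphere (0::real^2) 1. \<exists>s. strict_mono s \<and> ((\<lambda>k. (n k, u k)) \<circ> s) \<longlonglongrightarrow> l"
    unfolding compact_def by simp
  then obtain l s where l: "l \<in> sphere (0::'v) 1 \<times> sphere (0::real^2) 1" "strict_mono s"
    "((\<lambda>k. (n k, u k)) \<circ> s) \<longlonglongrightarrow> l" by blast
  have nl: "(\<lambda>k. n (s k)) \<longlonglongrightarrow> fst l" and ul: "(\<lambda>k. u (s k)) \<longlonglongrightarrow> snd l"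
    using tendsto_fst[OF l(3)] tendsto_snd[OF l(3)] by (simp_all add: o_def)
  have ys: "(\<lambda>k. y (s k)) \<longlonglongrightarrow> x" using LIMSEQ_subseq_LIMSEQ[OF yl l(2)] by (simp add: o_def)
  have "fst l \<bullet> d1 x a = 0" for a
  proof -
    have "(\<lambda>k. n (s k) \<bullet> d1 (y (s k)) a) \<longlonglongrightarrow> fst l \<bullet> d1 x a"
      by (intro tendsto_inner nl isCont_tendsto_compose[OF has_derivative_continuous[OF d1_der[OF x]] ys])
    moreover have "n (s k) \<bullet> d1 (y (s k)) a = 0" for k using n(1) by (simp add: normal_def)
    ultimately show ?thesis by (simp add: LIMSEQ_const_iff)
  qed
  then have "normal x (fst l)" using l(1) by (auto simp: normal_def)
  moreover have "fst l \<bullet> d2 x (snd l) v = 0" for v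
  proof -
    have "(\<lambda>k. n (s k) \<bullet> d2 (y (s k)) (u (s k)) v) \<longlonglongrightarrow> fst l \<bullet> d2 x (snd l) v"
      by (intro tendsto_inner nl d2_tendsto x yU ys ul)
    then show ?thesis using u(2) by (simp add: LIMSEQ_const_iff)
  qed
  then have "shape_det x (fst l) = 0" using l(1) shape_det_zero_iff[OF x] by (metis SigmaE mem_sphere_0 snd_conv)
  ultimately show False using nd by blast
qed

text \<open>The difference of the infinitesimal isometries and the tangential part of \<open>d2\<close> annihilates \<open>q\<close>
  wherever the form \<open>h\<close> vanishes, so it is \<open>h\<close> times a vector \<open>e\<close>, and \<open>N = n - d1 x e\<close>.\<close>

lemma conjugate_direction:
  assumes x: "x \<in> U" and nq: "\<not> quadratic (q x)" and mono: isometric_fibres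
    and n: "normal x n" and det: "shape_det x n \<noteq> 0"
  shows "\<exists>N \<Gamma>. n \<bullet> N = 1 \<and> (\<forall>v. B1 (d1 x v) N = 0) \<and> bilinear \<Gamma> \<and> (\<forall>u v. \<Gamma> u v = \<Gamma> v u) \<and>
    (\<forall>u v. d2 x u v = d1 x (\<Gamma> u v) + (n \<bullet> d2 x u v) *\<^sub>R N)"
proof -
  interpret minkowski_plane "q x" "q' x" using plane x nq by blast
  obtain T where T: "bilinear T" "\<And>u v. v \<noteq> 0 \<Longrightarrow> G x u v = q' x v (T u v)"
    using infinitesimal_isometries[OF mono x nq] by blast
  obtain g where g: "linear g" "\<And>a. g (d1 x a) = a" "\<And>y. y = d1 x (g y) + (n \<bullet> y) *\<^sub>R n"
    using tangential_projection[OF x n] by metis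
  let ?h = "\<lambda>u v. n \<bullet> d2 x u v"
  define b where "b u v = T u v - g (d2 x u v)" for u v
  have bil: "bilinear b"
    using T(1) d2_bilinear[OF x] unfolding bilinear_def b_def
    by (auto intro!: linear_compose_sub linear_compose[OF _ g(1), unfolded o_def])
  have Gb: "q' x v (b u v) = ?h u v * B1 (d1 x v) n" if v: "v \<noteq> 0" for u v
  proof -
    have "G x u v = B1 (d1 x v) (d1 x (g (d2 x u v)) + ?h u v *\<^sub>R n)"
      unfolding G_def using g(3)[of "d2 x u v"] by simp
    then show ?thesis using T(2)[OF v] unfolding b_def by (simp add: q'_def B1_simps linear_diff[OF d1_linear])
  qed
  have "\<exists>e. \<forall>u v. b u v = symform (?h e1 e1) (?h e1 e2) (?h e2 e2) u v *\<^sub>R e"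
  proof (rule bilinear_multiple_of_form[OF bil])
    show "?h e1 e1 * ?h e2 e2 - (?h e1 e2)\<^sup>2 \<noteq> 0" using det by (simp add: shape_det_def)
    show "q' x v (b u v) = 0" if "v \<noteq> 0" "symform (?h e1 e1) (?h e1 e2) (?h e2 e2) u v = 0" for u v
      using Gb[OF that(1), of u] that(2) shape_form[OF x, of n u v] by simp
  qed
  then obtain e where "\<And>u v. b u v = symform (?h e1 e1) (?h e1 e2) (?h e2 e2) u v *\<^sub>R e" by blast
  then have e: "b u v = ?h u v *\<^sub>R e" for u v using shape_form[OF x, of n u v] by simp
  define N where "N = n - d1 x e"
  have nN: "n \<bullet> N = 1" using n unfolding N_def by (simp add: normal_def inner_diff_right dot_square_norm)
  have "B1 (d1 x v) N = 0" for v
  proof (cases "v = 0")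
    case False
    \<comment> \<open>Nondegeneracy supplies a \<open>u\<close> for which the factor
      \<open>?h u v\<close> can be cancelled.\<close>
    obtain u where u: "?h u v \<noteq> 0"
    proof (rule ccontr)
      assume "\<not> thesis"
      then have "\<forall>u. ?h v u = 0" using that d2_sym[OF x] by metis
      then have "\<forall>u. ?h ((1 / norm v) *\<^sub>R v) u = 0" by (simp add: linear_scale[OF d2_linear1[OF x]])
      moreover have "norm ((1 / norm v) *\<^sub>R v) = 1" using False by simp
      ultimately show False using det shape_det_zero_iff[OF x] by blast
    qed
    have "?h u v * B1 (d1 x v) n = ?h u v * B1 (d1 x v) (d1 x e)"
      using Gb[OF False, of u] unfolding e linear_scale[OF q'_linear] by (auto simp: q'_def)
    then show ?thesis using u unfolding N_def by (simp add: B1_simps)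
  qed (simp add: d1_0 B1_0)
  moreover have "d2 x u v = d1 x (T u v) + ?h u v *\<^sub>R N" for u v
  proof -
    have "T u v = g (d2 x u v) + ?h u v *\<^sub>R e" using e[of u v] unfolding b_def by (simp add: algebra_simps)
    then show ?thesis using g(3)[of "d2 x u v"] unfolding N_def
      by (simp add: linear_add[OF d1_linear] linear_scale[OF d1_linear] algebra_simps)
  qed
  moreover have "T u v = T v u" for u v
    using e[of u v] e[of v u] d2_sym[OF x, of u v] unfolding b_def by (simp add: algebra_simps)
  ultimately show ?thesis using T(1) nN by blast
qed

end

section \<open>The connection near a nondegenerate point and its derivative\<close>

context surface
begin

lemma quadratic_transport:
  assumes "isometric_fibres" "x \<in> U" "y \<in> U" "quadratic (q y)"
  shows "quadratic (q x)"
proof -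
  obtain L where L: "linear L" "\<And>v. q y (L v) = q x v" using assms(1-3) unfolding isometric_fibres_def by metis
  then have "q x = (\<lambda>v. q y (L v))" by auto
  then show ?thesis using quadratic_compose_linear[OF assms(4) L(1)] by simp
qed

lemma shape_det_nonzero_indep:
  assumes x: "x \<in> U" and n: "normal x n" "shape_det x n \<noteq> 0" and n': "normal x n'"
  shows "shape_det x n' \<noteq> 0"
proof
  assume "shape_det x n' = 0"
  then obtain u where u: "norm u = 1" "\<And>v. n' \<bullet> d2 x u v = 0" using shape_det_zero_iff[OF x] by blast
  have "n \<bullet> d2 x u v = 0" for v
    using normal_kernel[OF x n' u(2)[of v]] n(1) by (auto simp: normal_def)
  then show False using n(2) u(1) shape_det_zero_iff[OF x] by blast
qed

text \<open>Symmetric bilinear maps are encoded by their three values on basis vectors, so that a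
  connection at a point is an element of a Euclidean space, where compactness applies.\<close>

definition sym_bil :: "(real^2) \<times> (real^2) \<times> (real^2) \<Rightarrow> real^2 \<Rightarrow> real^2 \<Rightarrow> real^2" where
  "sym_bil y u v = (u $ 1 * v $ 1) *\<^sub>R fst y + (u $ 1 * v $ 2 + u $ 2 * v $ 1) *\<^sub>R fst (snd y)
    + (u $ 2 * v $ 2) *\<^sub>R snd (snd y)"

lemma sym_bil_linear: "linear (\<lambda>y. sym_bil y u v)"
  unfolding sym_bil_def by (rule linearI) (simp_all add: algebra_simps)

lemma sym_bil_bilinear: "bilinear (sym_bil y)"
  unfolding sym_bil_def bilinear_def by (auto intro!: linearI simp: algebra_simps)

lemma sym_bil_surj:
  assumes "bilinear b" "\<And>u v. b u v = b v u"
  shows "b = sym_bil (b e1 e1, b e1 e2, b e2 e2)"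
  by (intro ext, subst bilinear_plane[OF assms(1)])
     (simp add: sym_bil_def assms(2)[of e2 e1] algebra_simps)

text \<open>Nondegeneracy is an open condition, and all fibres are isometric to the one at
  \<open>x0\<close>, so \<open>conjugate_direction\<close> applies at every nearby point. The
  dependence of \<open>y\<close> on \<open>x\<close> is left open.\<close>

lemma nonquadratic_connection_near:
  assumes mono: isometric_fibres and x0: "x0 \<in> U" and nq: "\<not> quadratic (q x0)"
    and n: "normal x0 n" and det: "shape_det x0 n \<noteq> 0"
  shows "\<exists>r>0. ball x0 r \<subseteq> U \<and> (\<forall>x\<in>ball x0 r. \<exists>y. \<forall>u v. G x u v = q' x v (sym_bil y u v))"
proof -
  obtain r where r: "r > 0" "ball x0 r \<subseteq> U"
    "\<And>x n. x \<in> ball x0 r \<Longrightarrow> normal x n \<Longrightarrow> shape_det x n \<noteq> 0"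
    using shape_det_nonzero_near[OF x0 shape_det_nonzero_indep[OF x0 n det]] by blast
  have "\<exists>y. \<forall>u v. G x u v = q' x v (sym_bil y u v)" if x: "x \<in> ball x0 r" for x
  proof -
    have xU: "x \<in> U" using x r(2) by blast
    obtain m where m: "normal x m" using normal_exists[OF xU] .
    have "\<not> quadratic (q x)" using quadratic_transport[OF mono x0 xU] nq by blast
    from conjugate_direction[OF xU this mono m r(3)[OF x m]]
    obtain N \<Gamma> where N: "\<And>v. B1 (d1 x v) N = 0" and \<Gamma>: "bilinear \<Gamma>" "\<And>u v. \<Gamma> u v = \<Gamma> v u"
      "\<And>u v. d2 x u v = d1 x (\<Gamma> u v) + (m \<bullet> d2 x u v) *\<^sub>R N" by blast
    have "G x u v = q' x v (\<Gamma> u v)" for u v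
      unfolding G_def q'_def by (subst \<Gamma>(3)) (simp add: B1_simps N)
    then show ?thesis using sym_bil_surj[OF \<Gamma>(1,2)] by metis
  qed
  then show ?thesis using r(1,2) by blast
qed

text \<open>Differentiating \<open>G x u v = q' x v (\<Gamma> u v)\<close> along \<open>w\<close>; the derivative of the connection
  exists by compactness because a nonquadratic norm has no infinitesimal isometries.\<close>

lemma connection_derivative:
  assumes x0: "x0 \<in> U" and nq: "\<not> quadratic (q x0)"
    and r: "r > 0" "ball x0 r \<subseteq> U"
    and conn: "\<And>x. x \<in> ball x0 r \<Longrightarrow> \<exists>y. \<forall>u v. G x u v = q' x v (sym_bil y u v)"
    and \<Gamma>: "bilinear \<Gamma>" "\<And>u v. \<Gamma> u v = \<Gamma> v u" "\<And>u v. v \<noteq> 0 \<Longrightarrow> G x0 u v = q' x0 v (\<Gamma> u v)"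
  shows "\<exists>y. \<forall>u v. v \<noteq> 0 \<longrightarrow>
    B2 (d1 x0 v) (d2 x0 w v) (d1 x0 (\<Gamma> u v) - d2 x0 u v) + B1 (d1 x0 v) (d2 x0 w (\<Gamma> u v) - d3 x0 w u v)
      + q' x0 v (sym_bil y u v) = 0"
proof -
  interpret minkowski_plane "q x0" "q' x0" using plane x0 nq by blast
  define t where "t n = (r / (norm w + 1)) * inverse (real (Suc n))" for n
  have nw: "norm w + 1 > 0" by (simp add: add_nonneg_pos)
  have t_pos: "0 < t n" for n unfolding t_def using r(1) nw by simp
  have "t \<longlonglongrightarrow> (r / (norm w + 1)) * 0" unfolding t_def
    by (intro tendsto_intros LIMSEQ_inverse_real_of_nat)
  then have t_lim: "t \<longlonglongrightarrow> 0" by simp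
  have near: "x0 + t n *\<^sub>R w \<in> ball x0 r" for n
  proof -
    have "t n * norm w \<le> (r / (norm w + 1)) * 1 * norm w" unfolding t_def
      using r(1) nw by (intro mult_right_mono mult_left_mono) (simp_all add: inverse_eq_divide)
    also have "\<dots> < r" using r(1) nw by (simp add: field_simps)
    finally show ?thesis using t_pos[of n] by (simp add: dist_norm)
  qed
  obtain Y where Y: "\<And>n u v. G (x0 + t n *\<^sub>R w) u v = q' (x0 + t n *\<^sub>R w) v (sym_bil (Y n) u v)"
    using conn[OF near] by metis
  define \<gamma> where "\<gamma> = (\<Gamma> e1 e1, \<Gamma> e1 e2, \<Gamma> e2 e2)"
  have \<gamma>: "\<Gamma> = sym_bil \<gamma>" unfolding \<gamma>_def by (rule sym_bil_surj[OF \<Gamma>(1,2)])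
  define X where "X s = x0 + s *\<^sub>R w" for s :: real
  have X0: "X 0 = x0" unfolding X_def by simp
  have XU: "(X has_derivative (\<lambda>s. s *\<^sub>R w)) (at 0)" unfolding X_def by (auto intro!: derivative_eq_intros)
  \<comment> \<open>The index is a pair \<open>(u, v)\<close>. \<open>a\<close> is the defect of the
    fixed \<open>\<Gamma>\<close> as a connection at \<open>X s\<close>, and \<open>l\<close> is the
    effect of correcting it by \<open>y\<close>.\<close>
  define a where "a i s = B1 (d1 (X s) (snd i)) (d1 (X s) (\<Gamma> (fst i) (snd i)) - d2 (X s) (fst i) (snd i))" for i s
  define l where "l i s y = q' (X s) (snd i) (sym_bil y (fst i) (snd i))" for i s y
  have d1X: "((\<lambda>s. d1 (X s) v) has_derivative (\<lambda>s. s *\<^sub>R d2 x0 w v)) (at 0)" for v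
    using has_derivative_compose[OF XU, of "\<lambda>x. d1 x v" "\<lambda>w. d2 x0 w v"] d1_der[OF x0] X0
    by (simp add: linear_scale[OF d2_linear1[OF x0]])
  have d2X: "((\<lambda>s. d2 (X s) u v) has_derivative (\<lambda>s. s *\<^sub>R d3 x0 w u v)) (at 0)" for u v
    using has_derivative_compose[OF XU, of "\<lambda>x. d2 x u v" "\<lambda>w. d3 x0 w u v"] d2_der[OF x0] X0
    by (simp add: linear_scale[OF d3_linear1[OF x0]])
  let ?a' = "\<lambda>i. B2 (d1 x0 (snd i)) (d2 x0 w (snd i)) (d1 x0 (\<Gamma> (fst i) (snd i)) - d2 x0 (fst i) (snd i))
    + B1 (d1 x0 (snd i)) (d2 x0 w (\<Gamma> (fst i) (snd i)) - d3 x0 w (fst i) (snd i))"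
  have "\<exists>y. \<forall>i\<in>UNIV \<times> (- {0}). ?a' i + l i 0 y = 0"
  proof (rule implicit_direction[OF t_lim t_pos, where a = a and l = l and y = "\<lambda>n. Y n - \<gamma>"])
    fix i :: "(real^2) \<times> (real^2)" assume i: "i \<in> UNIV \<times> (- {0})"
    then have v: "snd i \<noteq> 0" by auto
    have "(a i has_derivative (\<lambda>s. B2 (d1 (X 0) (snd i)) (s *\<^sub>R d2 x0 w (snd i)) (d1 (X 0) (\<Gamma> (fst i) (snd i)) - d2 (X 0) (fst i) (snd i))
        + B1 (d1 (X 0) (snd i)) (s *\<^sub>R d2 x0 w (\<Gamma> (fst i) (snd i)) - s *\<^sub>R d3 x0 w (fst i) (snd i)))) (at 0)"
      unfolding a_def
      by (rule B1_chain[OF d1X _ has_derivative_diff[OF d1X d2X]]) (use d1_inj[OF x0 v] X0 in simp)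
    then show "(a i has_real_derivative ?a' i) (at 0)"
      by (rule has_derivative_imp_has_field_derivative)
         (simp add: X0 B1_simps B2_simps algebra_simps)
    show "a i 0 = 0" using \<Gamma>(3)[OF v, of "fst i"] unfolding a_def X0 G_def q'_def by (simp add: B1_simps)
    show "linear (l i s)" for s
      unfolding l_def using linear_compose[OF sym_bil_linear q'_linear] by (simp add: o_def)
    show "isCont (\<lambda>s. l i s y) 0" for y
      unfolding l_def q'_def
      by (rule has_derivative_continuous[OF B1_chain[OF d1X _ d1X]]) (use d1_inj[OF x0 v] X0 in simp)
    show "a i (t n) + l i (t n) (Y n - \<gamma>) = 0" for n
      using Y[of n "fst i" "snd i"] unfolding a_def l_def X_def[symmetric]
      by (simp add: linear_diff[OF sym_bil_linear] linear_diff[OF q'_linear] \<gamma>[symmetric] B1_simps)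
         (simp add: G_def q'_def)
  next
    \<comment> \<open>A common zero would give, for every \<open>u\<close>, a linear field
      annihilating \<open>q x0\<close>.\<close>
    fix y assume 0: "\<And>i. i \<in> UNIV \<times> (- {0}) \<Longrightarrow> l i 0 y = 0"
    have "sym_bil y u v = 0" for u v
    proof (rule linear_field_zero[of "sym_bil y u"])
      show "linear (sym_bil y u)" using sym_bil_bilinear by (simp add: bilinear_def)
      show "q' x0 v (sym_bil y u v) = 0" if "v \<noteq> 0" for v using 0[of "(u, v)"] that by (simp add: l_def X0)
    qed
    from this[of e1 e1] this[of e1 e2] this[of e2 e2] show "y = 0"
      by (simp add: sym_bil_def plane_basis prod_eq_iff)
  qed
  then obtain y where y: "\<And>i. i \<in> UNIV \<times> (- {0}) \<Longrightarrow> ?a' i + l i 0 y = 0" by blast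
  show ?thesis
    by (rule exI[of _ y]) (use y[of "(_, _)"] in \<open>auto simp: l_def X0\<close>)
qed

theorem nonquadratic_degenerate:
  assumes mono: isometric_fibres and x0: "x0 \<in> U" and nq: "\<not> quadratic (q x0)" and n: "normal x0 n"
  shows "shape_det x0 n = 0"
proof (rule ccontr)
  assume det: "shape_det x0 n \<noteq> 0"
  interpret minkowski_plane "q x0" "q' x0" using plane x0 nq by blast
  obtain N \<Gamma> where nN: "n \<bullet> N = 1" and N: "\<And>v. B1 (d1 x0 v) N = 0" and \<Gamma>: "bilinear \<Gamma>" "\<And>u v. \<Gamma> u v = \<Gamma> v u"
      "\<And>u v. d2 x0 u v = d1 x0 (\<Gamma> u v) + (n \<bullet> d2 x0 u v) *\<^sub>R N"
    using conjugate_direction[OF x0 nq mono n det] by blast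
  define h where "h u v = n \<bullet> d2 x0 u v" for u v
  have h_form: "h = symform (h e1 e1) (h e1 e2) (h e2 e2)"
    unfolding h_def by (intro ext) (rule shape_form[OF x0])
  have h_det: "h e1 e1 * h e2 e2 - (h e1 e2)\<^sup>2 \<noteq> 0" using det unfolding shape_det_def h_def .
  have h_sym: "h u v = h v u" for u v unfolding h_def d2_sym[OF x0, of u v] by simp
  have G\<Gamma>: "G x0 u v = q' x0 v (\<Gamma> u v)" for u v
    unfolding G_def q'_def by (subst \<Gamma>(3)) (simp add: B1_simps N)
  define c where "c v = B2 (d1 x0 v) N N" for v
  have "N \<noteq> 0" using nN by auto
  then have c_pos: "c v > 0" if "v \<noteq> 0" for v unfolding c_def by (intro B2_pos d1_inj x0 that)
  \<comment> \<open>The differential of the energy annihilates \<open>N\<close> at all tangent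
    vectors, so this can be differentiated along the fibre.\<close>
  have B2N: "B2 (d1 x0 v) (d1 x0 a) N = 0" if "v \<noteq> 0" for v a
  proof -
    have "((\<lambda>v. B1 (d1 x0 v) N) has_derivative (\<lambda>_. 0)) (at v)" unfolding N by simp
    from fun_cong[OF has_derivative_unique[OF fibre_derivative[OF x0 that] this], of a] show ?thesis .
  qed
  obtain g where g: "linear g" "\<And>a. g (d1 x0 a) = a" "\<And>y. y = d1 x0 (g y) + (n \<bullet> y) *\<^sub>R n"
    using tangential_projection[OF x0 n] by metis
  \<comment> \<open>The projection to the tangent plane is taken along \<open>N\<close> rather than
    along \<open>n\<close>, so that \<open>B1\<close> at tangent vectors sees only the projected
    part.\<close>
  define p where "p y = g (y - (n \<bullet> y) *\<^sub>R N)" for y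
  have "linear (\<lambda>y. y - (n \<bullet> y) *\<^sub>R N)" by (rule linearI) (simp_all add: algebra_simps)
  then have linp: "linear p" unfolding p_def using linear_compose[OF _ g(1)] by (simp add: o_def)
  have p: "y = d1 x0 (p y) + (n \<bullet> y) *\<^sub>R N" for y
    using g(3)[of "y - (n \<bullet> y) *\<^sub>R N"] unfolding p_def by (simp add: inner_diff_right nN)
  define D where "D w u v = p (d3 x0 w u v)" for w u v
  obtain r where r: "r > 0" "ball x0 r \<subseteq> U"
    "\<And>x. x \<in> ball x0 r \<Longrightarrow> \<exists>y. \<forall>u v. G x u v = q' x v (sym_bil y u v)"
    using nonquadratic_connection_near[OF mono x0 nq n det] by blast
  have "\<forall>w. \<exists>y. \<forall>u v. v \<noteq> 0 \<longrightarrow>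
    B2 (d1 x0 v) (d2 x0 w v) (d1 x0 (\<Gamma> u v) - d2 x0 u v) + B1 (d1 x0 v) (d2 x0 w (\<Gamma> u v) - d3 x0 w u v)
      + q' x0 v (sym_bil y u v) = 0"
    using connection_derivative[OF x0 nq r \<Gamma>(1,2)] G\<Gamma> by blast
  then obtain Y where Y: "\<And>w u v. v \<noteq> 0 \<Longrightarrow>
    B2 (d1 x0 v) (d2 x0 w v) (d1 x0 (\<Gamma> u v) - d2 x0 u v) + B1 (d1 x0 v) (d2 x0 w (\<Gamma> u v) - d3 x0 w u v)
      + q' x0 v (sym_bil (Y w) u v) = 0" by metis
  \<comment> \<open>\<open>Y w\<close> acts as the derivative of the connection in the direction
    \<open>w\<close>. \<open>E\<close> collects those terms of the differentiated identity that pass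
    through \<open>q'\<close>.\<close>
  define E where "E w u v = \<Gamma> w (\<Gamma> u v) + sym_bil (Y w) u v - D w u v" for w u v
  have hE: "q' x0 v (E w u v) = c v * h u v * h w v" if v: "v \<noteq> 0" for w u v
  proof -
    have 1: "d1 x0 (\<Gamma> u v) - d2 x0 u v = - h u v *\<^sub>R N" 
      unfolding h_def by (subst \<Gamma>(3)) simp
    have "B2 (d1 x0 v) (d2 x0 w v) N = h w v * c v"
      by (subst \<Gamma>(3)) (simp add: B2_simps B2N[OF v] c_def h_def)
    then have "B2 (d1 x0 v) (d2 x0 w v) (d1 x0 (\<Gamma> u v) - d2 x0 u v) = - (c v * h u v * h w v)"
      unfolding 1 linear_scale[OF B2_linear2] by simp
    moreover have "B1 (d1 x0 v) (d2 x0 w (\<Gamma> u v)) = q' x0 v (\<Gamma> w (\<Gamma> u v))"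
      by (subst \<Gamma>(3)) (simp add: B1_simps N q'_def)
    moreover have "B1 (d1 x0 v) (d3 x0 w u v) = q' x0 v (D w u v)"
      unfolding D_def by (subst p) (simp add: B1_simps N q'_def)
    ultimately show ?thesis using Y[OF v, of w u] unfolding E_def
      by (simp add: B1_simps linear_add[OF q'_linear] linear_diff[OF q'_linear])
  qed
  have bilE: "bilinear (E w)" for w
    unfolding bilinear_def E_def D_def
    by (intro allI conjI linearI)
       (simp_all add: bilinear_ladd[OF \<Gamma>(1)] bilinear_radd[OF \<Gamma>(1)] bilinear_lmul[OF \<Gamma>(1)]
         bilinear_rmul[OF \<Gamma>(1)] bilinear_ladd[OF sym_bil_bilinear] bilinear_radd[OF sym_bil_bilinear]
         bilinear_lmul[OF sym_bil_bilinear] bilinear_rmul[OF sym_bil_bilinear]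
         bilinear_ladd[OF d3_bilinear[OF x0]] bilinear_radd[OF d3_bilinear[OF x0]]
         bilinear_lmul[OF d3_bilinear[OF x0]] bilinear_rmul[OF d3_bilinear[OF x0]]
         linear_add[OF linp] linear_scale[OF linp] scaleR_add_right scaleR_diff_right)
  \<comment> \<open>The identity \<open>hE\<close> is symmetric in \<open>w\<close> and
    \<open>u\<close> on its right, so the difference is a linear field in \<open>v\<close> that
    annihilates \<open>q x0\<close>.\<close>
  have swap: "E w u v = E u w v" for w u v
  proof -
    have "linear (\<lambda>v. E w u v - E u w v)" using bilE unfolding bilinear_def by (intro linear_compose_sub) auto
    moreover have "q' x0 v (E w u v - E u w v) = 0" if "v \<noteq> 0" for v
      using hE[OF that, of w u] hE[OF that, of u w] by (simp add: linear_diff[OF q'_linear])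
    ultimately have "E w u v - E u w v = 0" by (rule linear_field_zero[of "\<lambda>v. E w u v - E u w v"])
    then show ?thesis by simp
  qed
  have "\<exists>e. \<forall>u v. E w u v = h u v *\<^sub>R e" for w
  proof -
    have "q' x0 v (E w u v) = 0" if "v \<noteq> 0" "symform (h e1 e1) (h e1 e2) (h e2 e2) u v = 0" for u v
      using hE[OF that(1), of w u] that(2) fun_cong[OF fun_cong[OF h_form], of u v] by simp
    then have "\<exists>e. \<forall>u v. E w u v = symform (h e1 e1) (h e1 e2) (h e2 e2) u v *\<^sub>R e"
      by (rule bilinear_multiple_of_form[OF bilE h_det])
    then show ?thesis unfolding h_form[symmetric] .
  qed
  then obtain e where e: "\<And>w u v. E w u v = h u v *\<^sub>R e w" by metis
  \<comment> \<open>Symmetry in the first two slots is a linear system for \<open>e e1\<close> and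
    \<open>e e2\<close> whose determinant is that of \<open>h\<close>.\<close>
  have "h e2 v *\<^sub>R e e1 = h e1 v *\<^sub>R e e2" for v using swap[of e1 e2 v] unfolding e .
  from this[of e1] this[of e2]
  have 1: "h e1 e2 *\<^sub>R e e1 = h e1 e1 *\<^sub>R e e2" and 2: "h e2 e2 *\<^sub>R e e1 = h e1 e2 *\<^sub>R e e2"
    using h_sym[of e2 e1] by simp_all
  have "(h e1 e1 * h e2 e2 - (h e1 e2)\<^sup>2) *\<^sub>R e e1 = h e1 e1 *\<^sub>R (h e2 e2 *\<^sub>R e e1) - h e1 e2 *\<^sub>R (h e1 e2 *\<^sub>R e e1)"
    by (simp add: algebra_simps power2_eq_square)
  also have "\<dots> = 0" unfolding 1 2 by simp
  finally have z1: "e e1 = 0" using h_det by simp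
  have "(h e1 e1 * h e2 e2 - (h e1 e2)\<^sup>2) *\<^sub>R e e2 = h e2 e2 *\<^sub>R (h e1 e1 *\<^sub>R e e2) - h e1 e2 *\<^sub>R (h e1 e2 *\<^sub>R e e2)"
    by (simp add: algebra_simps power2_eq_square)
  also have "\<dots> = 0" unfolding 1[symmetric] 2[symmetric] by simp
  finally have z2: "e e2 = 0" using h_det by simp
  have ne: "e1 \<noteq> (0 :: real^2)" by (simp add: axis_eq_0_iff)
  \<comment> \<open>With \<open>E = 0\<close> and \<open>c\<close> positive, \<open>h\<close>
    vanishes on \<open>e1\<close> paired with either basis vector, so it would be
    degenerate.\<close>
  have "c e1 * h e1 e1 * h e1 e1 = 0" "c e1 * h e2 e1 * h e2 e1 = 0"
    using hE[OF ne, of e1 e1] hE[OF ne, of e2 e2] unfolding e z1 z2 by (simp_all add: linear_0[OF q'_linear])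
  then have "h e1 e1 = 0" "h e1 e2 = 0" using c_pos[OF ne] h_sym[of e2 e1] by simp_all
  then show False using h_det by simp
qed

end

section \<open>The Euclidean case: the Gauss equation\<close>

lemma quadratic_diff:
  assumes "quadratic f" "quadratic g" shows "quadratic (\<lambda>v. f v - g v)"
proof -
  obtain a b c a' b' c' where "\<And>v. f v = a * (v $ 1)\<^sup>2 + b * (v $ 1 * v $ 2) + c * (v $ 2)\<^sup>2"
    "\<And>v. g v = a' * (v $ 1)\<^sup>2 + b' * (v $ 1 * v $ 2) + c' * (v $ 2)\<^sup>2"
    using assms unfolding quadratic_def by metis
  then have "f v - g v = (a - a') * (v $ 1)\<^sup>2 + (b - b') * (v $ 1 * v $ 2) + (c - c') * (v $ 2)\<^sup>2" for v
    by (simp add: algebra_simps)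
  then show ?thesis unfolding quadratic_def by blast
qed

lemma quadratic_diagonal:
  assumes "bilinear b" shows "quadratic (\<lambda>v. b v v)"
proof -
  have "b v v = b e1 e1 * (v $ 1)\<^sup>2 + (b e1 e2 + b e2 e1) * (v $ 1 * v $ 2) + b e2 e2 * (v $ 2)\<^sup>2" for v
    by (subst bilinear_plane[OF assms]) (simp add: power2_eq_square algebra_simps)
  then show ?thesis unfolding quadratic_def by blast
qed

text \<open>Three values determine a quadratic form. The formula is linear in these values, so it
  can be differentiated with respect to a parameter.\<close>

lemma quadratic_eval:
  assumes "quadratic f"
  shows "f v = v $ 1 * (v $ 1 - v $ 2) * f e1 + v $ 2 * (v $ 2 - v $ 1) * f e2 + v $ 1 * v $ 2 * f (e1 + e2)"
proof -
  obtain a b c where f: "\<And>v. f v = a * (v $ 1)\<^sup>2 + b * (v $ 1 * v $ 2) + c * (v $ 2)\<^sup>2"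
    using assms unfolding quadratic_def by metis
  show ?thesis unfolding f[of v] f[of e1] f[of e2] f[of "e1 + e2"]
    by (simp add: plane_basis power2_eq_square algebra_simps)
qed

lemma quadraticI:
  assumes "\<And>v. f v = v $ 1 * (v $ 1 - v $ 2) * a + v $ 2 * (v $ 2 - v $ 1) * c + v $ 1 * v $ 2 * b"
  shows "quadratic f"
proof -
  have "f v = a * (v $ 1)\<^sup>2 + (b - a - c) * (v $ 1 * v $ 2) + c * (v $ 2)\<^sup>2" for v
    unfolding assms by (simp add: power2_eq_square algebra_simps)
  then show ?thesis unfolding quadratic_def by blast
qed

text \<open>The quadratic form vanishes on the kernel of \<open>l\<close>, so \<open>l\<close>
  divides it. This determines \<open>\<beta>\<close> off that line, and continuity does the rest. In
  the application \<open>\<beta>\<close> is the differential of the energy in a normal direction,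
  which is a priori only positively homogeneous.\<close>

lemma linear_factor:
  fixes \<beta> :: "real^2 \<Rightarrow> real"
  assumes l: "l \<noteq> 0" and quad: "quadratic (\<lambda>v. (l \<bullet> v) * \<beta> v)"
    and cont: "continuous_on (- {0}) \<beta>" and 0: "\<beta> 0 = 0"
  shows "\<exists>m. \<forall>v. \<beta> v = m \<bullet> v"
proof -
  obtain a b c where q: "\<And>v. (l \<bullet> v) * \<beta> v = a * (v $ 1)\<^sup>2 + b * (v $ 1 * v $ 2) + c * (v $ 2)\<^sup>2"
    using quad unfolding quadratic_def by metis
  have inner: "x \<bullet> y = x $ 1 * y $ 1 + x $ 2 * y $ 2" for x y :: "real^2" by (simp add: inner_vec_def sum_2)
  define k where "k = l $ 2 *\<^sub>R e1 - l $ 1 *\<^sub>R e2"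
  have k: "k $ 1 = l $ 2" "k $ 2 = - l $ 1" unfolding k_def by (simp_all add: plane_basis)
  have "l \<bullet> k = 0" unfolding inner k by simp
  then have root: "a * (l $ 2)\<^sup>2 - b * (l $ 1 * l $ 2) + c * (l $ 1)\<^sup>2 = 0" using q[of k] unfolding k by (simp add: mult.commute)
  \<comment> \<open>Division of the quadratic form by \<open>l\<close>, with coefficients read off
    from a nonzero coordinate of \<open>l\<close>.\<close>
  define m where "m = (if l $ 1 \<noteq> 0 then (a / l $ 1) *\<^sub>R e1 + ((b - l $ 2 * (a / l $ 1)) / l $ 1) *\<^sub>R e2
     else (b / l $ 2) *\<^sub>R e1 + (c / l $ 2) *\<^sub>R e2)"
  have coeffs: "l $ 1 * m $ 1 = a" "l $ 1 * m $ 2 + l $ 2 * m $ 1 = b" "l $ 2 * m $ 2 = c"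
  proof -
    have "l $ 1 * m $ 1 = a \<and> l $ 1 * m $ 2 + l $ 2 * m $ 1 = b \<and> l $ 2 * m $ 2 = c"
    proof (cases "l $ 1 = 0")
      case True
      then have "l $ 2 \<noteq> 0" using l by (simp add: vec_eq_iff forall_2)
      then show ?thesis using True root unfolding m_def by (simp add: plane_basis)
    next
      case False
      then have "l $ 2 * ((b - l $ 2 * (a / l $ 1)) / l $ 1) = c"
        using root by (simp add: field_simps power2_eq_square)
      then show ?thesis using False unfolding m_def by (simp add: plane_basis)
    qed
    then show "l $ 1 * m $ 1 = a" "l $ 1 * m $ 2 + l $ 2 * m $ 1 = b" "l $ 2 * m $ 2 = c" by auto
  qed
  have prod: "(l \<bullet> v) * \<beta> v = (l \<bullet> v) * (m \<bullet> v)" for v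
  proof -
    have "(l \<bullet> v) * (m \<bullet> v) = a * (v $ 1)\<^sup>2 + b * (v $ 1 * v $ 2) + c * (v $ 2)\<^sup>2"
      unfolding inner coeffs[symmetric] by (simp add: power2_eq_square algebra_simps)
    then show ?thesis using q[of v] by simp
  qed
  have "\<beta> v = m \<bullet> v" for v
  proof (cases "l \<bullet> v = 0 \<and> v \<noteq> 0")
    case False
    then show ?thesis using prod[of v] 0 by (cases "v = 0") auto
  next
    case True
    define vn where "vn n = v + inverse (real (Suc n)) *\<^sub>R l" for n
    have "l \<bullet> vn n = inverse (real (Suc n)) * (l \<bullet> l)" for n
      unfolding vn_def using True by (simp add: inner_add_right del: of_nat_Suc)
    then have off: "l \<bullet> vn n \<noteq> 0" for n using l by simp
    then have ne: "vn n \<noteq> 0" for n by (metis inner_zero_right)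
    have "vn \<longlonglongrightarrow> v + 0 *\<^sub>R l" unfolding vn_def
      by (intro tendsto_intros LIMSEQ_inverse_real_of_nat)
    then have vn: "vn \<longlonglongrightarrow> v" by simp
    have "(\<lambda>n. \<beta> (vn n)) \<longlonglongrightarrow> \<beta> v"
      using continuous_on_tendsto_compose[OF cont vn] True ne by simp
    moreover have "\<beta> (vn n) = m \<bullet> vn n" for n using prod[of "vn n"] off[of n] by simp
    moreover have "(\<lambda>n. m \<bullet> vn n) \<longlonglongrightarrow> m \<bullet> v" by (intro tendsto_intros vn)
    ultimately show ?thesis using LIMSEQ_unique by simp
  qed
  then show ?thesis by blast
qed

text \<open>In the linear coordinates \<open>l1\<close>, \<open>l2\<close> the form
  \<open>c * l1 * l2\<close> vanishes on both axes, so it is a multiple of the product of the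
  coordinates. Testing at \<open>e1 + e2\<close> and \<open>e1 - e2\<close> forces the same multiple
  on the other two forms.\<close>

lemma conformal_factor_constant:
  assumes c: "\<And>v. v \<noteq> 0 \<Longrightarrow> 0 < c v"
    and l1: "\<And>v. l1 v = a * v $ 1 + b * v $ 2" and l2: "\<And>v. l2 v = b * v $ 1 + d * v $ 2"
    and K11: "quadratic (\<lambda>v. c v * l1 v * l1 v)" and K12: "quadratic (\<lambda>v. c v * l1 v * l2 v)"
    and K22: "quadratic (\<lambda>v. c v * l2 v * l2 v)"
    and det: "a * d - b\<^sup>2 \<noteq> 0"
  shows "\<exists>k>0. \<forall>v. c v * l1 v * l1 v = k * (l1 v)\<^sup>2 \<and> c v * l1 v * l2 v = k * (l1 v * l2 v) \<and> c v * l2 v * l2 v = k * (l2 v)\<^sup>2"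
proof -
  define \<Delta> where "\<Delta> = a * d - b\<^sup>2"
  \<comment> \<open>The inverse of the coordinate change given by \<open>l1\<close> and
    \<open>l2\<close>.\<close>
  define f :: "real^2 \<Rightarrow> real^2" where "f z = ((d * z $ 1 - b * z $ 2) / \<Delta>) *\<^sub>R e1 + ((a * z $ 2 - b * z $ 1) / \<Delta>) *\<^sub>R e2" for z
  have \<Delta>: "\<Delta> \<noteq> 0" using det \<Delta>_def by simp
  have f: "linear f" unfolding f_def
    by (rule linearI) (simp_all add: vec_eq_iff forall_2 plane_basis add_divide_distrib diff_divide_distrib algebra_simps)
  have fi: "f z $ 1 = (d * z $ 1 - b * z $ 2) / \<Delta>" "f z $ 2 = (a * z $ 2 - b * z $ 1) / \<Delta>" for z
    unfolding f_def by (simp_all add: plane_basis)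
  have l1f: "l1 (f z) = z $ 1" and l2f: "l2 (f z) = z $ 2" for z
  proof -
    have "a * (d * z $ 1 - b * z $ 2) + b * (a * z $ 2 - b * z $ 1) = \<Delta> * z $ 1"
      "b * (d * z $ 1 - b * z $ 2) + d * (a * z $ 2 - b * z $ 1) = \<Delta> * z $ 2"
      unfolding \<Delta>_def by (simp_all add: power2_eq_square algebra_simps)
    moreover have "l1 (f z) = (a * (d * z $ 1 - b * z $ 2) + b * (a * z $ 2 - b * z $ 1)) / \<Delta>"
      "l2 (f z) = (b * (d * z $ 1 - b * z $ 2) + d * (a * z $ 2 - b * z $ 1)) / \<Delta>"
      unfolding l1 l2 fi add_divide_distrib by simp_all
    ultimately show "l1 (f z) = z $ 1" "l2 (f z) = z $ 2" using \<Delta> by simp_all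
  qed
  have f_inv: "f (l1 v *\<^sub>R e1 + l2 v *\<^sub>R e2) = v" for v
  proof -
    have "d * (a * v $ 1 + b * v $ 2) - b * (b * v $ 1 + d * v $ 2) = \<Delta> * v $ 1"
      "a * (b * v $ 1 + d * v $ 2) - b * (a * v $ 1 + b * v $ 2) = \<Delta> * v $ 2"
      unfolding \<Delta>_def by (simp_all add: power2_eq_square algebra_simps)
    then show ?thesis using \<Delta> by (simp add: vec_eq_iff forall_2 fi plane_basis l1 l2)
  qed
  obtain p1 p2 p3 where p: "\<And>z. c (f z) * z $ 1 * z $ 1 = p1 * (z $ 1)\<^sup>2 + p2 * (z $ 1 * z $ 2) + p3 * (z $ 2)\<^sup>2"
    using quadratic_compose_linear[OF K11 f] unfolding quadratic_def l1f by blast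
  obtain r1 r2 r3 where r: "\<And>z. c (f z) * z $ 1 * z $ 2 = r1 * (z $ 1)\<^sup>2 + r2 * (z $ 1 * z $ 2) + r3 * (z $ 2)\<^sup>2"
    using quadratic_compose_linear[OF K12 f] unfolding quadratic_def l1f l2f by blast
  obtain s1 s2 s3 where s: "\<And>z. c (f z) * z $ 2 * z $ 2 = s1 * (z $ 1)\<^sup>2 + s2 * (z $ 1 * z $ 2) + s3 * (z $ 2)\<^sup>2"
    using quadratic_compose_linear[OF K22 f] unfolding quadratic_def l2f by blast
  have z: "p3 = 0" "r1 = 0" "r3 = 0" "s1 = 0"
    using p[of e2] r[of e1] r[of e2] s[of e1] by (simp_all add: plane_basis)
  have cr: "c (f (e1 + e2)) = r2" "c (f (e1 - e2)) = r2"
    using r[of "e1 + e2"] r[of "e1 - e2"] z by (simp_all add: plane_basis)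
  have "p1 + p2 = r2" "p1 - p2 = r2" "s2 + s3 = r2" "s3 - s2 = r2"
    using p[of "e1 + e2"] p[of "e1 - e2"] s[of "e1 + e2"] s[of "e1 - e2"] z cr by (simp_all add: plane_basis)
  then have ps: "p1 = r2" "p2 = 0" "s3 = r2" "s2 = 0" by linarith+
  have "f (e1 + e2) \<noteq> 0"
  proof
    assume "f (e1 + e2) = 0"
    then have "l1 (f (e1 + e2)) = 0" unfolding l1 by simp
    then show False unfolding l1f by (simp add: plane_basis)
  qed
  then have "r2 > 0" using c cr by metis
  moreover have "c v * l1 v * l1 v = r2 * (l1 v)\<^sup>2 \<and> c v * l1 v * l2 v = r2 * (l1 v * l2 v) \<and> c v * l2 v * l2 v = r2 * (l2 v)\<^sup>2" for v
    using p[of "l1 v *\<^sub>R e1 + l2 v *\<^sub>R e2"] r[of "l1 v *\<^sub>R e1 + l2 v *\<^sub>R e2"] s[of "l1 v *\<^sub>R e1 + l2 v *\<^sub>R e2"]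
    unfolding f_inv z ps by (simp add: plane_basis)
  ultimately show ?thesis by blast
qed

text \<open>If \<open>H w u v\<close> is half the second derivative of a metric \<open>g v v\<close> along \<open>w\<close> and \<open>u\<close>, this is
  \<open>g\<^sub>1\<^sub>2\<^sub>,\<^sub>1\<^sub>2 - (g\<^sub>1\<^sub>1\<^sub>,\<^sub>2\<^sub>2 + g\<^sub>2\<^sub>2\<^sub>,\<^sub>1\<^sub>1) / 2\<close>, the second order part of the Riemann tensor.\<close>

definition curvature_part :: "(real^2 \<Rightarrow> real^2 \<Rightarrow> real^2 \<Rightarrow> real) \<Rightarrow> real" where
  "curvature_part H = H e1 e2 (e1 + e2) - H e1 e2 e1 - H e1 e2 e2 - H e2 e2 e1 - H e1 e1 e2"

text \<open>For nondegenerate \<open>h\<close> the factor \<open>c\<close> acts as a constant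
  \<open>k\<close>, and the curvature part of \<open>h w v * h u v\<close> is the determinant of
  \<open>h\<close>. If the determinant vanishes and \<open>a\<close> is nonzero, the curvature part
  is minus the value of the quadratic form \<open>c v * h e1 v * h e1 v\<close> at a kernel vector
  of \<open>h\<close>, hence 0; for \<open>a = 0\<close> all its terms vanish.\<close>

lemma curvature_part_form:
  assumes c: "\<And>v. v \<noteq> 0 \<Longrightarrow> 0 < c v" and h: "h = symform a b d"
    and K: "\<And>w u. quadratic (\<lambda>v. c v * h w v * h u v)"
  shows "\<exists>k>0. k * (a * d - b\<^sup>2) = curvature_part (\<lambda>w u v. c v * h w v * h u v)"
proof (cases "a * d - b\<^sup>2 = 0")
  case False
  have l: "h e1 v = a * v $ 1 + b * v $ 2" "h e2 v = b * v $ 1 + d * v $ 2" for v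
    unfolding h symform_def by (simp_all add: plane_basis)
  obtain k where k: "k > 0" "\<And>v. c v * h e1 v * h e1 v = k * (h e1 v)\<^sup>2" "\<And>v. c v * h e1 v * h e2 v = k * (h e1 v * h e2 v)"
     "\<And>v. c v * h e2 v * h e2 v = k * (h e2 v)\<^sup>2"
    using conformal_factor_constant[OF c l K K K False] by blast
  have "k * (a * d - b\<^sup>2) = curvature_part (\<lambda>w u v. c v * h w v * h u v)"
    unfolding curvature_part_def k(2-4) unfolding l by (simp add: plane_basis power2_eq_square algebra_simps)
  then show ?thesis using k(1) by blast
next
  case True
  have l: "h e1 v = a * v $ 1 + b * v $ 2" "h e2 v = b * v $ 1 + d * v $ 2" for v
    unfolding h symform_def by (simp_all add: plane_basis)
  have "curvature_part (\<lambda>w u v. c v * h w v * h u v) = 0"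
  proof (cases "a = 0")
    case a: True
    then have "b = 0" using True by simp
    then show ?thesis using a unfolding curvature_part_def l by (simp add: plane_basis)
  next
    case a: False
    define s where "s = b / a"
    have b: "b = s * a" unfolding s_def using a by simp
    have "d * a = s\<^sup>2 * a * a" using True unfolding b by (simp add: power2_eq_square algebra_simps)
    then have d: "d = s\<^sup>2 * a" using a by simp
    have l2: "h e2 v = s * h e1 v" for v unfolding l b d by (simp add: power2_eq_square algebra_simps)
    define k where "k v = c v * h e1 v * h e1 v" for v
    have quad: "quadratic k" unfolding k_def by (rule K)
    \<comment> \<open>This vector spans the kernel of \<open>h\<close>, because
      \<open>b = s * a\<close>.\<close>
    have "k (s *\<^sub>R e1 - e2) = 0" unfolding k_def l b by (simp add: plane_basis)
    then have "s * (s + 1) * k e1 + (1 + s) * k e2 - s * k (e1 + e2) = 0"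
      using quadratic_eval[OF quad, of "s *\<^sub>R e1 - e2"] by (simp add: plane_basis algebra_simps)
    then have "s * k (e1 + e2) - s * k e1 - s * k e2 - s\<^sup>2 * k e1 - k e2 = 0"
      by (simp add: algebra_simps power2_eq_square)
    moreover have "curvature_part (\<lambda>w u v. c v * h w v * h u v) = s * k (e1 + e2) - s * k e1 - s * k e2 - s\<^sup>2 * k e1 - k e2"
      unfolding curvature_part_def l2 k_def by (simp add: power2_eq_square algebra_simps)
    ultimately show ?thesis by simp
  qed
  then show ?thesis using True by (intro exI[of _ 1]) simp
qed

section \<open>The Gauss equation at a point\<close>

context surface
begin

lemma fibre_differential_quadratic:
  assumes x: "x \<in> U" and quad: "quadratic (q x)"
  shows "\<exists>a b c. q' x = symform a b c \<and> (\<forall>v. q' x v v = 2 * q x v)"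
proof -
  obtain a b c where q: "\<And>v. q x v = a * (v $ 1)\<^sup>2 + b * (v $ 1 * v $ 2) + c * (v $ 2)\<^sup>2"
    using quad unfolding quadratic_def by metis
  have comp: "((\<lambda>v. v $ i) has_derivative (\<lambda>w. w $ i)) (at v)" for i and v :: "real^2"
    by (rule bounded_linear_imp_has_derivative[OF bounded_linear_vec_nth])
  have "q' x v w = symform (2 * a) b (2 * c) v w" for v w
  proof (cases "v = 0")
    case True
    then show ?thesis by (simp add: q'_def d1_0 B1_0 symform_def)
  next
    case False
    have "(q x has_derivative (\<lambda>w. symform (2 * a) b (2 * c) v w)) (at v)"
      unfolding q symform_def power2_eq_square by (auto intro!: derivative_eq_intros comp simp: algebra_simps)
    from fun_cong[OF has_derivative_unique[OF q_der[OF x False] this]] show ?thesis .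
  qed
  then have "q' x = symform (2 * a) b (2 * c)" by blast
  moreover from this have "q' x v v = 2 * q x v" for v
    unfolding q by (simp add: symform_def power2_eq_square algebra_simps)
  ultimately show ?thesis by blast
qed

text \<open>A quadratic energy has a constant Hessian on the tangent plane. This controls
  \<open>B2\<close> for tangent arguments only; transversal values may still vary with
  \<open>v\<close>.\<close>

lemma fibre_hessian_quadratic:
  assumes x: "x \<in> U" and quad: "quadratic (q x)" and v: "v \<noteq> 0"
  shows "B2 (d1 x v) (d1 x a) (d1 x b) = q' x a b"
proof -
  obtain p r s where q': "q' x = symform p r s" using fibre_differential_quadratic[OF x quad] by blast
  have "linear (\<lambda>v. q' x v b)" unfolding q' symform_def by (rule linearI) (simp_all add: algebra_simps)
  then have "((\<lambda>v. q' x v b) has_derivative (\<lambda>a. q' x a b)) (at v)" by (rule linear_imp_has_derivative)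
  from fun_cong[OF has_derivative_unique[OF fibre_derivative[OF x v] this[unfolded q'_def[of x]]], of a]
  show ?thesis unfolding q'_def by simp
qed


lemma fibre_functional_representation:
  assumes x: "x \<in> U" and quad: "quadratic (q x)"
  shows "\<exists>e. \<forall>v. m \<bullet> v = q' x v e"
proof -
  obtain a b c where q': "q' x = symform a b c" and euler: "\<And>v. q' x v v = 2 * q x v"
    using fibre_differential_quadratic[OF x quad] by blast
  have "a > 0" using q_pos[OF x, of e1] euler[of e1] unfolding q' symform_def
    by (simp add: plane_basis axis_eq_0_iff)
  define d where "d = a * c - b\<^sup>2"
  \<comment> \<open>On this vector the form takes the value \<open>a * d\<close>, so positivity
    excludes \<open>d = 0\<close>.\<close>
  let ?w = "b *\<^sub>R e1 - a *\<^sub>R e2"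
  have "?w \<noteq> 0" using \<open>a > 0\<close> by (simp add: vec_eq_iff forall_2 plane_basis)
  moreover have "q' x ?w ?w = a * d" unfolding q' symform_def d_def by (simp add: plane_basis power2_eq_square algebra_simps)
  ultimately have "d \<noteq> 0" using q_pos[OF x, of ?w] euler[of ?w] by auto
  define e where "e = ((c * m $ 1 - b * m $ 2) / d) *\<^sub>R e1 + ((a * m $ 2 - b * m $ 1) / d) *\<^sub>R e2"
  have "a * e $ 1 + b * e $ 2 = (a * (c * m $ 1 - b * m $ 2) + b * (a * m $ 2 - b * m $ 1)) / d"
    "b * e $ 1 + c * e $ 2 = (b * (c * m $ 1 - b * m $ 2) + c * (a * m $ 2 - b * m $ 1)) / d"
    unfolding e_def by (simp_all add: plane_basis add_divide_distrib)
  moreover have "a * (c * m $ 1 - b * m $ 2) + b * (a * m $ 2 - b * m $ 1) = d * m $ 1"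
    "b * (c * m $ 1 - b * m $ 2) + c * (a * m $ 2 - b * m $ 1) = d * m $ 2"
    unfolding d_def by (simp_all add: power2_eq_square algebra_simps)
  ultimately have "a * e $ 1 + b * e $ 2 = (d * m $ 1) / d" "b * e $ 1 + c * e $ 2 = (d * m $ 2) / d"
    by simp_all
  then have e: "a * e $ 1 + b * e $ 2 = m $ 1" "b * e $ 1 + c * e $ 2 = m $ 2" using \<open>d \<noteq> 0\<close> by simp_all
  have "m \<bullet> v = q' x v e" for v
    unfolding q' symform_def inner_vec_def sum_2 e[symmetric] by (simp add: algebra_simps)
  then show ?thesis by blast
qed

text \<open>The conditions \<open>kill\<close> carry the normal parts of \<open>d2\<close> and
  \<open>d3\<close> as factors, so that they cover two situations: an \<open>N\<close> annihilated
  by the differential of the energy, and an arbitrary \<open>N\<close> where \<open>d2\<close> and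
  \<open>d3\<close> are tangential. Splitting along \<open>N\<close> turns \<open>H\<close> into a
  product of connection terms, a term \<open>c v * h w v * h u v\<close> and a term in
  \<open>D\<close> that drops out of the curvature part.\<close>

lemma gauss_equation_transversal:
  assumes x: "x \<in> U" and n: "normal x n" and quad: "quadratic (q x)"
    and H: "\<And>w u. quadratic (\<lambda>v. H x w u v)"
    and N: "n \<bullet> N = 1"
    and kill: "\<And>u v. (n \<bullet> d2 x u v) * B1 (d1 x v) N = 0" "\<And>w u v. (n \<bullet> d3 x w u v) * B1 (d1 x v) N = 0"
      "\<And>u v a. v \<noteq> 0 \<Longrightarrow> (n \<bullet> d2 x u v) * B2 (d1 x v) (d1 x a) N = 0"
  shows "\<exists>\<Gamma> k. k > 0 \<and> bilinear \<Gamma> \<and> (\<forall>u v. \<Gamma> u v = \<Gamma> v u) \<and> (\<forall>u v. G x u v = q' x v (\<Gamma> u v)) \<and>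
    k * shape_det x n = curvature_part (H x) - q' x (\<Gamma> e1 e1) (\<Gamma> e2 e2) + q' x (\<Gamma> e1 e2) (\<Gamma> e1 e2)"
proof -
  obtain g where g: "linear g" "\<And>a. g (d1 x a) = a" "\<And>y. y = d1 x (g y) + (n \<bullet> y) *\<^sub>R n"
    using tangential_projection[OF x n] by metis
  define p where "p y = g (y - (n \<bullet> y) *\<^sub>R N)" for y
  have "linear (\<lambda>y. y - (n \<bullet> y) *\<^sub>R N)" by (rule linearI) (simp_all add: algebra_simps)
  then have linp: "linear p" unfolding p_def using linear_compose[OF _ g(1)] by (simp add: o_def)
  have p: "y = d1 x (p y) + (n \<bullet> y) *\<^sub>R N" for y
    using g(3)[of "y - (n \<bullet> y) *\<^sub>R N"] unfolding p_def by (simp add: inner_diff_right N)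
  define \<Gamma> where "\<Gamma> u v = p (d2 x u v)" for u v
  define D where "D w u v = p (d3 x w u v)" for w u v
  define h where "h u v = n \<bullet> d2 x u v" for u v
  define c where "c v = B2 (d1 x v) N N" for v
  have bil\<Gamma>: "bilinear \<Gamma>" unfolding bilinear_def \<Gamma>_def
    by (intro allI conjI linearI) (simp_all add: linear_add[OF linp] linear_scale[OF linp]
      bilinear_ladd[OF d2_bilinear[OF x]] bilinear_radd[OF d2_bilinear[OF x]] bilinear_lmul[OF d2_bilinear[OF x]] bilinear_rmul[OF d2_bilinear[OF x]])
  have sym\<Gamma>: "\<Gamma> u v = \<Gamma> v u" for u v unfolding \<Gamma>_def d2_sym[OF x, of u v] ..
  have d2: "d2 x u v = d1 x (\<Gamma> u v) + h u v *\<^sub>R N" for u v unfolding \<Gamma>_def h_def by (rule p)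
  have G\<Gamma>: "G x u v = q' x v (\<Gamma> u v)" for u v
    unfolding G_def q'_def using kill(1)[of u v] by (subst d2) (simp add: B1_simps h_def)
  obtain p' r' s' where q': "q' x = symform p' r' s'" using fibre_differential_quadratic[OF x quad] by blast
  have bilq': "bilinear (q' x)" unfolding q' bilinear_def symform_def
    by (auto intro!: linearI simp: algebra_simps)
  have symq': "q' x a b = q' x b a" for a b unfolding q' symform_def by (simp add: algebra_simps)
  have H_eq: "H x w u v = q' x (\<Gamma> w v) (\<Gamma> u v) + c v * h w v * h u v + q' x v (D w u v)" for w u v
  proof (cases "v = 0")
    case True
    have "q' x a 0 = 0" "q' x 0 a = 0" "h a 0 = 0" for a using bilq' linear_0[OF d2_linear2[OF x]]
      by (auto simp: bilinear_rzero bilinear_lzero h_def)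
    moreover have "\<Gamma> a 0 = 0" for a using bil\<Gamma> by (rule bilinear_rzero)
    ultimately show ?thesis using True by (simp add: H_def d1_0 B1_0 B2_0)
  next
    case False
    have "B1 (d1 x v) (d3 x w u v) = q' x v (D w u v)"
      using kill(2)[of w u v] by (subst p) (simp add: B1_simps D_def q'_def)
    moreover have "B2 (d1 x v) (d2 x w v) (d2 x u v) = B2 (d1 x v) (d1 x (\<Gamma> w v)) (d1 x (\<Gamma> u v))
        + h u v * B2 (d1 x v) (d1 x (\<Gamma> w v)) N + h w v * B2 (d1 x v) (d1 x (\<Gamma> u v)) N + h w v * h u v * B2 (d1 x v) N N"
      unfolding d2 by (simp add: B2_simps B2_sym[of _ N "d1 x _"] algebra_simps)
    ultimately show ?thesis
      using kill(3)[OF False, folded h_def] fibre_hessian_quadratic[OF x quad False]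
      unfolding H_def c_def by simp
  qed
  have "N \<noteq> 0" using N by auto
  then have c_pos: "0 < c v" if "v \<noteq> 0" for v unfolding c_def by (intro B2_pos d1_inj x that)
  have h_form: "h = symform (h e1 e1) (h e1 e2) (h e2 e2)"
    unfolding h_def by (intro ext) (rule shape_form[OF x])
  \<comment> \<open>All other terms of \<open>H_eq\<close> are quadratic in \<open>v\<close>,
    although the energy behind \<open>c\<close> need not be quadratic off the tangent plane.\<close>
  have "quadratic (\<lambda>v. c v * h w v * h u v)" for w u
  proof -
    have "bilinear (\<lambda>a b. q' x (\<Gamma> w a) (\<Gamma> u b))" "bilinear (\<lambda>a b. q' x a (D w u b))"
      unfolding bilinear_def D_def
      by (intro allI conjI linearI; simp add: bilinear_ladd[OF bilq'] bilinear_radd[OF bilq'] bilinear_lmul[OF bilq']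
          bilinear_rmul[OF bilq'] bilinear_radd[OF bil\<Gamma>] bilinear_rmul[OF bil\<Gamma>]
          linear_add[OF linp] linear_scale[OF linp] bilinear_radd[OF d3_bilinear[OF x]] bilinear_rmul[OF d3_bilinear[OF x]])+
    from quadratic_diff[OF quadratic_diff[OF H[of w u] quadratic_diagonal[OF this(1)]] quadratic_diagonal[OF this(2)]]
    show ?thesis unfolding H_eq by simp
  qed
  from curvature_part_form[OF c_pos h_form this]
  obtain k where k: "k > 0" "k * shape_det x n = curvature_part (\<lambda>w u v. c v * h w v * h u v)"
    unfolding shape_det_def h_def by blast
  have swap: "D w u v = D u w v" for w u v unfolding D_def d3_sym12[OF x, of w u v] ..
  have swap': "D w u v = D w v u" for w u v unfolding D_def d3_sym23[OF x, of w u v] ..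
  have symD: "D e1 e2 e1 = D e1 e1 e2" "D e2 e1 e1 = D e1 e1 e2" "D e2 e2 e1 = D e1 e2 e2" "D e2 e1 e2 = D e1 e2 e2"
    using swap'[of e1 e2 e1] swap[of e2 e1 e1] swap'[of e2 e2 e1] swap[of e2 e1 e2] by simp_all
  have add: "\<Gamma> a (b + b') = \<Gamma> a b + \<Gamma> a b'" "D w u (b + b') = D w u b + D w u b'" for a b b' w u
    unfolding D_def by (simp_all add: bilinear_radd[OF bil\<Gamma>] bilinear_radd[OF d3_bilinear[OF x]] linear_add[OF linp])
  \<comment> \<open>The terms in \<open>D\<close> cancel by its total symmetry. What remains of the
    connection are the two products of Christoffel symbols in the Riemann tensor.\<close>
  have "curvature_part (H x) = curvature_part (\<lambda>w u v. c v * h w v * h u v)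
      + (q' x (\<Gamma> e1 e1) (\<Gamma> e2 e2) - q' x (\<Gamma> e1 e2) (\<Gamma> e1 e2))"
    unfolding curvature_part_def H_eq add
    by (simp add: bilinear_ladd[OF bilq'] bilinear_radd[OF bilq'] symD sym\<Gamma>[of e2 e1] symq'[of "\<Gamma> e2 e2" "\<Gamma> e1 e1"])
  then have "k * shape_det x n = curvature_part (H x) - q' x (\<Gamma> e1 e1) (\<Gamma> e2 e2) + q' x (\<Gamma> e1 e2) (\<Gamma> e1 e2)"
    unfolding k(2) by simp
  then show ?thesis using k(1) bil\<Gamma> sym\<Gamma> G\<Gamma> by blast
qed

text \<open>The transversal is \<open>n\<close>, corrected by the tangent vector that represents
  \<open>\<beta>\<close> through \<open>q' x\<close>. Where \<open>h\<close> vanishes at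
  \<open>x\<close>, the identity for \<open>G\<close> says nothing about \<open>\<beta>\<close>; the
  linear factor is then the normal part of \<open>d3\<close>, found in \<open>H\<close>.\<close>

lemma gauss_equation:
  assumes x: "x \<in> U" and n: "normal x n" and quad: "quadratic (q x)"
    and G: "\<And>u. quadratic (\<lambda>v. G x u v)" and H: "\<And>w u. quadratic (\<lambda>v. H x w u v)"
  shows "\<exists>\<Gamma> k. k > 0 \<and> bilinear \<Gamma> \<and> (\<forall>u v. \<Gamma> u v = \<Gamma> v u) \<and> (\<forall>u v. G x u v = q' x v (\<Gamma> u v)) \<and>
    k * shape_det x n = curvature_part (H x) - q' x (\<Gamma> e1 e1) (\<Gamma> e2 e2) + q' x (\<Gamma> e1 e2) (\<Gamma> e1 e2)"
proof (cases "(\<forall>u v. n \<bullet> d2 x u v = 0) \<and> (\<forall>w u v. n \<bullet> d3 x w u v = 0)")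
  \<comment> \<open>Every transversal satisfies the vanishing conditions here, so \<open>n\<close>
    itself serves as \<open>N\<close>.\<close>
  case True
  moreover have "n \<bullet> n = 1" using n by (simp add: normal_def dot_square_norm)
  ultimately show ?thesis by (intro gauss_equation_transversal[OF x n quad H]) simp_all
next
  case False
  define \<beta> where "\<beta> v = B1 (d1 x v) n" for v
  have nn: "n \<bullet> n = 1" using n by (simp add: normal_def dot_square_norm)
  obtain g where g: "linear g" "\<And>a. g (d1 x a) = a" "\<And>y. y = d1 x (g y) + (n \<bullet> y) *\<^sub>R n"
    using tangential_projection[OF x n] by metis
  obtain p' r' s' where q': "q' x = symform p' r' s'" using fibre_differential_quadratic[OF x quad] by blast
  have bilq': "bilinear (q' x)" unfolding q' bilinear_def symform_def
    by (auto intro!: linearI simp: algebra_simps)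
  have quad2: "quadratic (\<lambda>v. q' x v (g (d2 x u v)))" "quadratic (\<lambda>v. q' x (g (d2 x w v)) (g (d2 x u v)))"
    "quadratic (\<lambda>v. q' x v (g (d3 x w u v)))" for w u
    by (rule quadratic_diagonal[where b = "\<lambda>a b. q' x a (g (d2 x u b))"]
        quadratic_diagonal[where b = "\<lambda>a b. q' x (g (d2 x w a)) (g (d2 x u b))"]
        quadratic_diagonal[where b = "\<lambda>a b. q' x a (g (d3 x w u b))"],
       unfold bilinear_def, intro allI conjI linearI;
       simp add: bilinear_ladd[OF bilq'] bilinear_radd[OF bilq'] bilinear_lmul[OF bilq']
          bilinear_rmul[OF bilq'] bilinear_radd[OF d2_bilinear[OF x]] bilinear_rmul[OF d2_bilinear[OF x]]
          linear_add[OF g(1)] linear_scale[OF g(1)] bilinear_radd[OF d3_bilinear[OF x]] bilinear_rmul[OF d3_bilinear[OF x]])+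
  have B1_split: "B1 (d1 x v) y = q' x v (g y) + (n \<bullet> y) * \<beta> v" for v y
    by (subst g(3)) (simp add: B1_simps q'_def \<beta>_def)
  have "\<exists>l. l \<noteq> 0 \<and> quadratic (\<lambda>v. (l \<bullet> v) * \<beta> v)"
  proof -
    have rep: "\<exists>l. l \<noteq> 0 \<and> (\<forall>v. l \<bullet> v = f v)" if f: "linear f" "f v0 \<noteq> 0" for f :: "real^2 \<Rightarrow> real" and v0
    proof -
      have "(f e1 *\<^sub>R e1 + f e2 *\<^sub>R e2) \<bullet> v = f v" for v
        by (subst linear_plane[OF f(1), of v]) (simp add: inner_vec_def sum_2 plane_basis)
      moreover from this[of v0] f(2) have "f e1 *\<^sub>R e1 + f e2 *\<^sub>R e2 \<noteq> 0" by auto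
      ultimately show ?thesis by blast
    qed
    show ?thesis
    proof (cases "\<forall>u v. n \<bullet> d2 x u v = 0")
      case h: False
      then obtain u v0 where uv: "n \<bullet> d2 x u v0 \<noteq> 0" by blast
      have "linear (\<lambda>v. n \<bullet> d2 x u v)"
        by (rule linearI) (simp_all add: bilinear_radd[OF d2_bilinear[OF x]] bilinear_rmul[OF d2_bilinear[OF x]] inner_add_right)
      from rep[OF this uv] obtain l where l: "l \<noteq> 0" "\<And>v. l \<bullet> v = n \<bullet> d2 x u v" by blast
      have "(l \<bullet> v) * \<beta> v = G x u v - q' x v (g (d2 x u v))" for v unfolding G_def B1_split l(2) by simp
      then show ?thesis using l(1) quadratic_diff[OF G quad2(1)] by auto
    next
      case h: True
      with False obtain w u v0 where wuv: "n \<bullet> d3 x w u v0 \<noteq> 0" by blast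
      have "linear (\<lambda>v. n \<bullet> d3 x w u v)"
        by (rule linearI) (simp_all add: bilinear_radd[OF d3_bilinear[OF x]] bilinear_rmul[OF d3_bilinear[OF x]] inner_add_right)
      from rep[OF this wuv] obtain l where l: "l \<noteq> 0" "\<And>v. l \<bullet> v = n \<bullet> d3 x w u v" by blast
      have "(l \<bullet> v) * \<beta> v = H x w u v - q' x (g (d2 x w v)) (g (d2 x u v)) - q' x v (g (d3 x w u v))" for v
      proof (cases "v = 0")
        case True
        then show ?thesis using bilinear_lzero[OF bilq'] linear_0[OF d2_linear2[OF x]] linear_0[OF g(1)]
          by (simp add: H_def d1_0 B1_0 B2_0)
      next
        case False
        \<comment> \<open>Second derivatives are tangential in this case, so the \<open>B2\<close>
          term of \<open>H\<close> is governed by the quadratic fibre alone.\<close>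
        have "d2 x a v = d1 x (g (d2 x a v))" for a using g(3)[of "d2 x a v"] h by simp
        then have "B2 (d1 x v) (d2 x w v) (d2 x u v) = q' x (g (d2 x w v)) (g (d2 x u v))"
          using fibre_hessian_quadratic[OF x quad False] by metis
        then show ?thesis unfolding H_def B1_split l(2) by simp
      qed
      then show ?thesis using l(1) quadratic_diff[OF quadratic_diff[OF H quad2(2)] quad2(3)] by auto
    qed
  qed
  then obtain l where l: "l \<noteq> 0" "quadratic (\<lambda>v. (l \<bullet> v) * \<beta> v)" by blast
  have "continuous_on (- {0}) \<beta>" unfolding \<beta>_def
    by (intro continuous_at_imp_continuous_on ballI has_derivative_continuous[OF fibre_derivative]) (use x in auto)
  then obtain m where m: "\<And>v. \<beta> v = m \<bullet> v"
    using linear_factor[OF l] by (auto simp: \<beta>_def d1_0 B1_0)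
  obtain e where e: "\<And>v. m \<bullet> v = q' x v e" using fibre_functional_representation[OF x quad] by blast
  define N where "N = n - d1 x e"
  have N0: "B1 (d1 x v) N = 0" for v
    using m[of v] e[of v] unfolding N_def \<beta>_def q'_def by (simp add: B1_simps)
  have B2N: "B2 (d1 x v) (d1 x a) N = 0" if "v \<noteq> 0" for v a
  proof -
    have "((\<lambda>v. B1 (d1 x v) N) has_derivative (\<lambda>_. 0)) (at v)" unfolding N0 by simp
    from fun_cong[OF has_derivative_unique[OF fibre_derivative[OF x that] this], of a] show ?thesis .
  qed
  have "n \<bullet> N = 1" unfolding N_def using n nn by (simp add: inner_diff_right normal_def)
  then show ?thesis
    by (rule gauss_equation_transversal[OF x n quad H]) (simp_all add: N0 B2N)
qed

text \<open>The formula of \<open>quadratic_eval\<close> holds over all of \<open>U\<close> with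
  coefficients independent of the base point, so it passes to derivatives in the base.\<close>

lemma base_derivatives_quadratic:
  assumes quad: "\<And>x. x \<in> U \<Longrightarrow> quadratic (q x)" and x: "x \<in> U"
  shows "quadratic (\<lambda>v. G x u v)" "quadratic (\<lambda>v. H x w u v)"
proof -
  have ne: "e1 \<noteq> (0 :: real^2)" "e2 \<noteq> (0 :: real^2)" "e1 + e2 \<noteq> (0 :: real^2)"
    by (simp_all add: vec_eq_iff forall_2 plane_basis)
  have Geval: "G y u v = v $ 1 * (v $ 1 - v $ 2) * G y u e1 + v $ 2 * (v $ 2 - v $ 1) * G y u e2 + v $ 1 * v $ 2 * G y u (e1 + e2)"
    if y: "y \<in> U" for y u v
  proof (cases "v = 0")
    case False
    have "((\<lambda>y. q y v) has_derivative (\<lambda>u. v $ 1 * (v $ 1 - v $ 2) * G y u e1 + v $ 2 * (v $ 2 - v $ 1) * G y u e2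
        + v $ 1 * v $ 2 * G y u (e1 + e2))) (at y)"
      by (rule has_derivative_transform_within_open[of "\<lambda>y. v $ 1 * (v $ 1 - v $ 2) * q y e1
            + v $ 2 * (v $ 2 - v $ 1) * q y e2 + v $ 1 * v $ 2 * q y (e1 + e2)" _ _ _ U])
         (use quadratic_eval[OF quad, of _ v] y open_U in
           \<open>auto intro!: has_derivative_add has_derivative_mult_right q_base_der ne\<close>)
    from fun_cong[OF has_derivative_unique[OF q_base_der[OF y False] this], of u] show ?thesis .
  qed (simp add: G_def d1_0 B1_0)
  then show "quadratic (\<lambda>v. G x u v)" using quadraticI x by blast
  have "H x w u v = v $ 1 * (v $ 1 - v $ 2) * H x w u e1 + v $ 2 * (v $ 2 - v $ 1) * H x w u e2 + v $ 1 * v $ 2 * H x w u (e1 + e2)"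
    for v
  proof (cases "v = 0")
    case False
    have "((\<lambda>y. G y u v) has_derivative (\<lambda>w. v $ 1 * (v $ 1 - v $ 2) * H x w u e1 + v $ 2 * (v $ 2 - v $ 1) * H x w u e2
        + v $ 1 * v $ 2 * H x w u (e1 + e2))) (at x)"
      by (rule has_derivative_transform_within_open[of "\<lambda>y. v $ 1 * (v $ 1 - v $ 2) * G y u e1
            + v $ 2 * (v $ 2 - v $ 1) * G y u e2 + v $ 1 * v $ 2 * G y u (e1 + e2)" _ _ _ U])
         (use Geval[of _ u v] x open_U in
           \<open>auto intro!: has_derivative_add has_derivative_mult_right G_base_der ne\<close>)
    from fun_cong[OF has_derivative_unique[OF G_base_der[OF x False] this], of w] show ?thesis .
  qed (simp add: H_def d1_0 B1_0 B2_0)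
  then show "quadratic (\<lambda>v. H x w u v)" by (rule quadraticI)
qed

end

section \<open>Comparison of two surfaces with the same metric\<close>

context surface
begin

text \<open>The uniqueness argument for the Levi-Civita connection: paired with \<open>q' x\<close>,
  the difference is symmetric in one pair of slots and antisymmetric in another, hence zero.\<close>

lemma connection_unique:
  assumes x: "x \<in> U" and quad: "quadratic (q x)"
    and \<Gamma>: "bilinear \<Gamma>" "\<And>u v. \<Gamma> u v = \<Gamma> v u" and \<Gamma>': "bilinear \<Gamma>'" "\<And>u v. \<Gamma>' u v = \<Gamma>' v u"
    and eq: "\<And>u v. q' x v (\<Gamma> u v) = q' x v (\<Gamma>' u v)"
  shows "\<Gamma> u w = \<Gamma>' u w"
proof -
  obtain a b c where q': "q' x = symform a b c" and euler: "\<And>v. q' x v v = 2 * q x v"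
    using fibre_differential_quadratic[OF x quad] by blast
  have bilq': "bilinear (q' x)" unfolding q' bilinear_def symform_def
    by (auto intro!: linearI simp: algebra_simps)
  define \<Delta> where "\<Delta> u v = \<Gamma> u v - \<Gamma>' u v" for u v
  have sym: "\<Delta> u v = \<Delta> v u" for u v unfolding \<Delta>_def using \<Gamma>(2)[of u v] \<Gamma>'(2)[of u v] by simp
  have add: "\<Delta> u (v + w) = \<Delta> u v + \<Delta> u w" for u v w
    unfolding \<Delta>_def by (simp add: bilinear_radd[OF \<Gamma>(1)] bilinear_radd[OF \<Gamma>'(1)])
  have zero: "q' x v (\<Delta> u v) = 0" for u v
    unfolding \<Delta>_def using eq[of v u] by (simp add: bilinear_rsub[OF bilq'])
  have anti: "q' x v (\<Delta> u w) = - q' x w (\<Delta> u v)" for u v w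
    using zero[of "v + w" u] zero[of v u] zero[of w u]
    by (simp add: add bilinear_ladd[OF bilq'] bilinear_radd[OF bilq'])
  have "q' x v (\<Delta> u w) = 0" for v
    using anti[of v u w] anti[of w v u] anti[of u w v] sym[of u v] sym[of v w] sym[of u w] by simp
  from this[of "\<Delta> u w"] have "\<not> \<Delta> u w \<noteq> 0" using q_pos[OF x, of "\<Delta> u w"] euler[of "\<Delta> u w"] by auto
  then show ?thesis unfolding \<Delta>_def by simp
qed

end

text \<open>In the non-Euclidean case both determinants vanish. In the Euclidean case the surfaces
  share \<open>q'\<close>, \<open>G\<close>, \<open>H\<close> and the connection, so their Gauss
  equations have equal right-hand sides. The factors \<open>k\<close> and \<open>k'\<close> come
  from the two ambient norms, which is why only signs are compared.\<close>

theorem shape_det_sign_intrinsic: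
  assumes S1: "surface B B1 B2 U F d1 d2 d3" and S2: "surface C C1 C2 U F' d1' d2' d3'"
    and eq: "\<And>x v. x \<in> U \<Longrightarrow> B (d1 x v) = C (d1' x v)"
    and mono: "surface.isometric_fibres B U d1"
    and x: "x \<in> U" and n: "surface.normal d1 x n" and n': "surface.normal d1' x n'"
  shows "sgn (surface.shape_det d2 x n) = sgn (surface.shape_det d2' x n')"
proof -
  interpret S1: surface B B1 B2 U F d1 d2 d3 by (rule S1)
  interpret S2: surface C C1 C2 U F' d1' d2' d3' by (rule S2)
  have q: "S1.q y = S2.q y" if "y \<in> U" for y
    using eq[OF that] by (simp add: fun_eq_iff S1.q_def S2.q_def)
  have q': "S1.q' x = S2.q' x"
  proof (intro ext)
    fix v w show "S1.q' x v w = S2.q' x v w"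
    proof (cases "v = 0")
      case False
      from fun_cong[OF has_derivative_unique[OF S1.q_der[OF x False] S2.q_der[OF x False, folded q[OF x]]]]
      show ?thesis .
    qed (simp add: S1.q'_def S2.q'_def S1.d1_0 S2.d1_0 S1.B1_0 S2.B1_0)
  qed
  have G: "S1.G y u v = S2.G y u v" if y: "y \<in> U" for y u v
  proof (cases "v = 0")
    case False
    have "((\<lambda>y. S1.q y v) has_derivative (\<lambda>u. S2.G y u v)) (at y)"
      by (rule has_derivative_transform_within_open[OF S2.q_base_der[OF y False] S1.open_U y]) (simp add: q)
    from fun_cong[OF has_derivative_unique[OF S1.q_base_der[OF y False] this]] show ?thesis .
  qed (simp add: S1.G_def S2.G_def S1.d1_0 S2.d1_0 S1.B1_0 S2.B1_0)
  have H: "S1.H x w u v = S2.H x w u v" for w u v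
  proof (cases "v = 0")
    case False
    have "((\<lambda>y. S1.G y u v) has_derivative (\<lambda>w. S2.H x w u v)) (at x)"
      by (rule has_derivative_transform_within_open[OF S2.G_base_der[OF x False] S1.open_U x]) (simp add: G)
    from fun_cong[OF has_derivative_unique[OF S1.G_base_der[OF x False] this]] show ?thesis .
  qed (simp add: S1.H_def S2.H_def S1.d1_0 S2.d1_0 S1.B1_0 S2.B1_0 S1.B2_0 S2.B2_0)
  have mono2: S2.isometric_fibres
    using mono q unfolding S1.isometric_fibres_def S2.isometric_fibres_def by simp
  show ?thesis
  proof (cases "quadratic (S1.q x)")
    case False
    then have "S1.shape_det x n = 0" "S2.shape_det x n' = 0"
      using S1.nonquadratic_degenerate[OF mono x _ n] S2.nonquadratic_degenerate[OF mono2 x _ n'] q[OF x] by auto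
    then show ?thesis by simp
  next
    case True
    \<comment> \<open>Monochromaticity makes every fibre over \<open>U\<close> Euclidean as soon as
      one is, so that quadraticity can be differentiated in the base.\<close>
    have quad1: "quadratic (S1.q y)" and quad2: "quadratic (S2.q y)" if "y \<in> U" for y
      using S1.quadratic_transport[OF mono that x True] q[OF that] by simp_all
    obtain \<Gamma> k where \<Gamma>: "k > 0" "bilinear \<Gamma>" "\<And>u v. \<Gamma> u v = \<Gamma> v u" "\<And>u v. S1.G x u v = S1.q' x v (\<Gamma> u v)"
      "k * S1.shape_det x n = curvature_part (S1.H x) - S1.q' x (\<Gamma> e1 e1) (\<Gamma> e2 e2) + S1.q' x (\<Gamma> e1 e2) (\<Gamma> e1 e2)"
      using S1.gauss_equation[OF x n True S1.base_derivatives_quadratic(1)[OF quad1 x]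
          S1.base_derivatives_quadratic(2)[OF quad1 x]] by blast
    obtain \<Gamma>' k' where \<Gamma>': "k' > 0" "bilinear \<Gamma>'" "\<And>u v. \<Gamma>' u v = \<Gamma>' v u" "\<And>u v. S2.G x u v = S2.q' x v (\<Gamma>' u v)"
      "k' * S2.shape_det x n' = curvature_part (S2.H x) - S2.q' x (\<Gamma>' e1 e1) (\<Gamma>' e2 e2) + S2.q' x (\<Gamma>' e1 e2) (\<Gamma>' e1 e2)"
      using S2.gauss_equation[OF x n' quad2[OF x] S2.base_derivatives_quadratic(1)[OF quad2 x]
          S2.base_derivatives_quadratic(2)[OF quad2 x]] by blast
    have "S1.q' x v (\<Gamma> u v) = S1.q' x v (\<Gamma>' u v)" for u v
      using \<Gamma>(4)[of u v] \<Gamma>'(4)[of u v] G[OF x, of u v] q' by simp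
    then have "\<Gamma> u v = \<Gamma>' u v" for u v
      by (rule S1.connection_unique[OF x True \<Gamma>(2,3) \<Gamma>'(2,3)])
    moreover have "S1.H x = S2.H x" using H by (intro ext)
    ultimately have "k * S1.shape_det x n = k' * S2.shape_det x n'" unfolding \<Gamma>(5) \<Gamma>'(5) q' by simp
    then have "sgn (k * S1.shape_det x n) = sgn (k' * S2.shape_det x n')" by simp
    then show ?thesis using \<Gamma>(1) \<Gamma>'(1) by (simp add: sgn_mult)
  qed
qed

section \<open>Types of symmetric bilinear forms on the plane\<close>

lemma symform_definite:
  assumes "a * c - b\<^sup>2 > 0"
  shows "(\<forall>v. v \<noteq> 0 \<longrightarrow> 0 < symform a b c v v) \<or> (\<forall>v. v \<noteq> 0 \<longrightarrow> symform a b c v v < 0)"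
proof -
  have a: "a \<noteq> 0" using assms by auto
  have eq: "a * symform a b c v v = (a * v $ 1 + b * v $ 2)\<^sup>2 + (a * c - b\<^sup>2) * (v $ 2)\<^sup>2" for v
    unfolding symform_def by (simp add: power2_eq_square algebra_simps)
  have pos: "a * symform a b c v v > 0" if "v \<noteq> 0" for v
  proof (cases "v $ 2 = 0")
    case True
    then have "v $ 1 \<noteq> 0" using that by (simp add: vec_eq_iff forall_2)
    then show ?thesis unfolding eq using True a by simp
  next
    case False
    then show ?thesis unfolding eq using assms by (simp add: add_nonneg_pos)
  qed
  show ?thesis
  proof (cases "a > 0")
    case True
    then show ?thesis using pos by (simp add: zero_less_mult_iff)
  next
    case False
    then show ?thesis using pos a by (auto simp: zero_less_mult_iff)
  qed
qed

lemma symform_indefinite: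
  assumes "a * c - b\<^sup>2 < 0"
  shows "(\<exists>v. 0 < symform a b c v v) \<and> (\<exists>v. symform a b c v v < 0)"
proof -
  let ?s = "symform a b c"
  have ev: "?s (x *\<^sub>R e1 + y *\<^sub>R e2) (x *\<^sub>R e1 + y *\<^sub>R e2) = a * x\<^sup>2 + 2 * b * (x * y) + c * y\<^sup>2" for x y
    unfolding symform_def by (simp add: plane_basis power2_eq_square algebra_simps)
  show ?thesis
  proof (cases "a = 0")
    case True
    then have b: "b \<noteq> 0" using assms by auto
    have "?s (x *\<^sub>R e1 + b *\<^sub>R e2) (x *\<^sub>R e1 + b *\<^sub>R e2) = b\<^sup>2 * (2 * x + c)" for x
      using ev[of x b] unfolding True by (simp add: power2_eq_square algebra_simps)
    \<comment> \<open>The first coordinate is chosen so that the factor \<open>2 * x + c\<close>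
      becomes 1 or -1.\<close>
    moreover have "2 * ((1 - c) / 2) + c = 1" "2 * ((- 1 - c) / 2) + c = - 1" by (simp_all add: field_simps)
    ultimately have "?s (((1 - c) / 2) *\<^sub>R e1 + b *\<^sub>R e2) (((1 - c) / 2) *\<^sub>R e1 + b *\<^sub>R e2) = b\<^sup>2"
      "?s (((- 1 - c) / 2) *\<^sub>R e1 + b *\<^sub>R e2) (((- 1 - c) / 2) *\<^sub>R e1 + b *\<^sub>R e2) = - b\<^sup>2"
      by (metis mult.right_neutral, metis mult.right_neutral mult_minus_right)
    then show ?thesis using b by (metis neg_less_0_iff_less zero_less_power2)
  next
    case False
    have 1: "?s (1 *\<^sub>R e1 + 0 *\<^sub>R e2) (1 *\<^sub>R e1 + 0 *\<^sub>R e2) = a" unfolding ev by simp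
    \<comment> \<open>This vector is orthogonal to \<open>e1\<close> for the form; its value has the
      sign opposite to that at \<open>e1\<close>.\<close>
    have 2: "?s (b *\<^sub>R e1 + (- a) *\<^sub>R e2) (b *\<^sub>R e1 + (- a) *\<^sub>R e2) = a * (a * c - b\<^sup>2)"
      unfolding ev by (simp add: power2_eq_square algebra_simps)
    show ?thesis
    proof (cases "a > 0")
      case True
      then have "a * (a * c - b\<^sup>2) < 0" using assms by (simp add: mult_less_0_iff)
      then show ?thesis using 1 2 True by metis
    next
      case f: False
      then have "a * (a * c - b\<^sup>2) > 0" "a < 0" using assms False by (simp_all add: zero_less_mult_iff)
      then show ?thesis using 1 2 by metis
    qed
  qed
qed

lemma symform_degenerate:
  assumes "a * c - b\<^sup>2 = 0"
  shows "\<exists>u. u \<noteq> 0 \<and> (\<forall>v. symform a b c u v = 0)"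
proof (cases "a = 0 \<and> b = 0")
  case True
  then show ?thesis
    by (intro exI[of _ e1]) (simp add: symform_def plane_basis axis_eq_0_iff)
next
  case False
  let ?u = "b *\<^sub>R e1 - a *\<^sub>R e2"
  have "?u \<noteq> 0" using False by (auto simp: vec_eq_iff forall_2 plane_basis)
  moreover have "symform a b c ?u v = - (a * c - b\<^sup>2) * v $ 2" for v
    unfolding symform_def by (simp add: plane_basis power2_eq_square algebra_simps)
  ultimately show ?thesis using assms by (intro exI[of _ ?u]) simp
qed

section \<open>Charts and tangent vectors\<close>

lemma smooth_on_imp_Ck_on: "smooth_on f S \<Longrightarrow> Ck_on n f S"
  by (simp add: smooth_on_def)

lemma smooth_on_differentiable:
  assumes "smooth_on f S" "x \<in> S" shows "f differentiable (at x)"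
  using smooth_on_imp_Ck_on[OF assms(1), of "Suc 0"] assms(2) by simp

lemma smooth_on_deriv:
  assumes "smooth_on f S" shows "smooth_on (\<lambda>x. frechet_derivative f (at x) v) S"
  unfolding smooth_on_def
proof
  fix n show "Ck_on n (\<lambda>x. frechet_derivative f (at x) v) S"
    using smooth_on_imp_Ck_on[OF assms, of "Suc n"] by simp
qed

lemma has_frechet_derivative:
  "f differentiable (at x) \<Longrightarrow> (f has_derivative frechet_derivative f (at x)) (at x)"
  by (simp add: frechet_derivative_works)

locale atlas =
  fixes M :: "'m::{t2_space, second_countable_topology} set" and A :: "('m, 'e::euclidean_space) chart set"
  assumes manifold: "smooth_manifold M A"
begin

lemma chart: "k \<in> A \<Longrightarrow> is_chart k"
  and cover: "(\<Union>k\<in>A. fst k) = M"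
  and transition: "k \<in> A \<Longrightarrow> l \<in> A \<Longrightarrow> smooth_on (snd l \<circ> chart_inv k) (snd k ` (fst k \<inter> fst l))"
  using manifold by (auto simp: smooth_manifold_def)

lemma chart_homeomorphism: "k \<in> A \<Longrightarrow> homeomorphism (fst k) (snd k ` fst k) (snd k) (chart_inv k)"
  and open_chart_domain: "k \<in> A \<Longrightarrow> open (fst k)"
  and open_chart_image: "k \<in> A \<Longrightarrow> open (snd k ` fst k)"
  using chart unfolding is_chart_def by blast+

lemma chart_inv_left: "k \<in> A \<Longrightarrow> q \<in> fst k \<Longrightarrow> chart_inv k (snd k q) = q"
  using chart_homeomorphism unfolding homeomorphism_def by blast

lemma chart_inv_in: "k \<in> A \<Longrightarrow> x \<in> snd k ` fst k \<Longrightarrow> chart_inv k x \<in> fst k"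
  using chart_inv_left by auto

lemma chart_inv_right: "k \<in> A \<Longrightarrow> x \<in> snd k ` fst k \<Longrightarrow> snd k (chart_inv k x) = x"
  using chart_inv_left by auto

lemma open_overlap:
  assumes "k \<in> A" "l \<in> A" shows "open (snd k ` (fst k \<inter> fst l))"
proof -
  have "openin (top_of_set (fst k)) (fst k \<inter> fst l)"
    using open_chart_domain[OF assms(2)] by (rule openin_open_Int)
  then have "openin (top_of_set (snd k ` fst k)) (snd k ` (fst k \<inter> fst l))"
    by (rule homeomorphism_imp_open_map[OF chart_homeomorphism[OF assms(1)]])
  then show ?thesis using open_chart_image[OF assms(1)] openin_open_eq by blast
qed

lemma chart_change_differential:
  fixes f :: "'m \<Rightarrow> 'b::real_normed_vector"
  assumes k: "k \<in> A" "q \<in> fst k" and l: "l \<in> A" "q \<in> fst l"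
    and f: "(f \<circ> chart_inv l) differentiable (at (snd l q))"
  shows "(f \<circ> chart_inv k) differentiable (at (snd k q))"
    and "frechet_derivative (f \<circ> chart_inv k) (at (snd k q)) v =
      frechet_derivative (f \<circ> chart_inv l) (at (snd l q)) (frechet_derivative (snd l \<circ> chart_inv k) (at (snd k q)) v)"
proof -
  let ?t = "snd l \<circ> chart_inv k"
  have x: "snd k q \<in> snd k ` (fst k \<inter> fst l)" using k l by blast
  have t: "(?t has_derivative frechet_derivative ?t (at (snd k q))) (at (snd k q))"
    by (rule has_frechet_derivative[OF smooth_on_differentiable[OF transition[OF k(1) l(1)] x]])
  have tq: "?t (snd k q) = snd l q" using chart_inv_left[OF k] by simp
  have "((f \<circ> chart_inv l) \<circ> ?t has_derivative
      frechet_derivative (f \<circ> chart_inv l) (at (snd l q)) \<circ> frechet_derivative ?t (at (snd k q))) (at (snd k q))"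
    by (rule diff_chain_at[OF t]) (unfold tq, rule has_frechet_derivative[OF f])
  then have D: "(f \<circ> chart_inv k has_derivative
      frechet_derivative (f \<circ> chart_inv l) (at (snd l q)) \<circ> frechet_derivative ?t (at (snd k q))) (at (snd k q))"
    by (rule has_derivative_transform_within_open[OF _ open_overlap[OF k(1) l(1)] x])
       (use chart_inv_left[OF k(1)] chart_inv_left[OF l(1)] in auto)
  then show "(f \<circ> chart_inv k) differentiable (at (snd k q))" by (rule differentiableI)
  show "frechet_derivative (f \<circ> chart_inv k) (at (snd k q)) v =
      frechet_derivative (f \<circ> chart_inv l) (at (snd l q)) (frechet_derivative ?t (at (snd k q)) v)"
    unfolding frechet_derivative_at[OF D, symmetric] by simp
qed

lemma transition_self:
  assumes "k \<in> A" "q \<in> fst k"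
  shows "frechet_derivative (snd k \<circ> chart_inv k) (at (snd k q)) = (\<lambda>v. v)"
proof -
  have "(snd k \<circ> chart_inv k has_derivative (\<lambda>v. v)) (at (snd k q))"
    by (rule has_derivative_transform_within_open[OF has_derivative_ident open_chart_image[OF assms(1)]])
       (use assms chart_inv_right in auto)
  from frechet_derivative_at[OF this] show ?thesis by simp
qed

lemma transition_differentiable:
  assumes "k \<in> A" "q \<in> fst k" "l \<in> A" "q \<in> fst l"
  shows "(snd l \<circ> chart_inv k) differentiable (at (snd k q))"
  using smooth_on_differentiable[OF transition[OF assms(1,3)]] assms by blast

lemma tangent_of_coords_in:
  assumes k: "k \<in> A" "q \<in> fst k"
  shows "tangent_of_coords A q k v \<in> tangent_space A q"
  unfolding tangent_space_def mem_Collect_eq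
proof (intro conjI allI ballI impI)
  fix l m assume l: "l \<in> A" "q \<in> fst l" and m: "m \<in> A" "q \<in> fst m"
  show "tangent_of_coords A q k v m =
      frechet_derivative (snd m \<circ> chart_inv l) (at (snd l q)) (tangent_of_coords A q k v l)"
    using chart_change_differential(2)[OF k l transition_differentiable[OF l m]] l m
    by (simp add: tangent_of_coords_def)
qed (auto simp: tangent_of_coords_def)

lemma tangent_of_coords_same:
  "k \<in> A \<Longrightarrow> q \<in> fst k \<Longrightarrow> tangent_of_coords A q k v k = v"
  unfolding tangent_of_coords_def by (simp add: transition_self)

lemma tangent_of_coords_eq:
  assumes "\<xi> \<in> tangent_space A q" "k \<in> A" "q \<in> fst k"
  shows "tangent_of_coords A q k (\<xi> k) = \<xi>"
proof
  fix l
  have "l \<notin> A \<or> q \<notin> fst l \<Longrightarrow> \<xi> l = 0"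
    and "l \<in> A \<Longrightarrow> q \<in> fst l \<Longrightarrow> \<xi> l = frechet_derivative (snd l \<circ> chart_inv k) (at (snd k q)) (\<xi> k)"
    using assms unfolding tangent_space_def by blast+
  then show "tangent_of_coords A q k (\<xi> k) l = \<xi> l" by (simp add: tangent_of_coords_def)
qed

lemma tangent_of_coords_linear:
  assumes k: "k \<in> A" "q \<in> fst k"
  shows "tangent_of_coords A q k (v + w) = (\<lambda>l. tangent_of_coords A q k v l + tangent_of_coords A q k w l)"
    and "tangent_of_coords A q k (c *\<^sub>R v) = (\<lambda>l. c *\<^sub>R tangent_of_coords A q k v l)"
proof -
  have "tangent_of_coords A q k (v + w) l = tangent_of_coords A q k v l + tangent_of_coords A q k w l \<and>
      tangent_of_coords A q k (c *\<^sub>R v) l = c *\<^sub>R tangent_of_coords A q k v l" for l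
  proof (cases "l \<in> A \<and> q \<in> fst l")
    case True
    then have "linear (frechet_derivative (snd l \<circ> chart_inv k) (at (snd k q)))"
      by (intro linear_frechet_derivative transition_differentiable k) auto
    then show ?thesis using True by (simp add: tangent_of_coords_def linear_add linear_scale)
  next
    case False
    then have "tangent_of_coords A q k u l = 0" for u unfolding tangent_of_coords_def by (rule if_not_P)
    then show ?thesis by simp
  qed
  then show "tangent_of_coords A q k (v + w) = (\<lambda>l. tangent_of_coords A q k v l + tangent_of_coords A q k w l)"
    "tangent_of_coords A q k (c *\<^sub>R v) = (\<lambda>l. c *\<^sub>R tangent_of_coords A q k v l)"
    by blast+
qed

lemma chart_at:
  assumes "q \<in> M" shows "chart_at A q \<in> A" "q \<in> fst (chart_at A q)"
proof -
  have "\<exists>k. k \<in> A \<and> q \<in> fst k" using cover assms by blast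
  from someI_ex[OF this] show "chart_at A q \<in> A" "q \<in> fst (chart_at A q)"
    unfolding chart_at_def by blast+
qed

text \<open>\<open>differential\<close> uses the chart chosen at \<open>q\<close>, which varies with
  \<open>q\<close>. The chain rule through the transition map permits one fixed chart for all of its
  points.\<close>

lemma differential_in_chart:
  fixes f :: "'m \<Rightarrow> 'v::euclidean_space"
  assumes f: "smooth_map A f" and k: "k \<in> A" "q \<in> fst k" and \<xi>: "\<xi> \<in> tangent_space A q"
  shows "differential A f q \<xi> = frechet_derivative (f \<circ> chart_inv k) (at (snd k q)) (\<xi> k)"
proof -
  have q: "q \<in> M" using cover k by blast
  let ?l = "chart_at A q"
  have l: "?l \<in> A" "q \<in> fst ?l" using chart_at[OF q] by auto
  have d: "(f \<circ> chart_inv ?l) differentiable (at (snd ?l q))"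
    using f l unfolding smooth_map_def by (intro smooth_on_differentiable) auto
  have "\<xi> ?l = frechet_derivative (snd ?l \<circ> chart_inv k) (at (snd k q)) (\<xi> k)"
    using \<xi> k l unfolding tangent_space_def by blast
  then show ?thesis using chart_change_differential(2)[OF k l d, of "\<xi> k"] by (simp add: differential_def Let_def)
qed

end

section \<open>From the embedded manifold to a surface over a chart\<close>

lemma minkowski_energy_of_norm:
  fixes \<Phi> :: "'v::euclidean_space \<Rightarrow> real"
  assumes "banach_minkowski_norm \<Phi>"
  defines "B \<equiv> \<lambda>X. (\<Phi> X)\<^sup>2"
  shows "minkowski_energy B (\<lambda>X Y. if X = 0 then 0 else frechet_derivative B (at X) Y)
     (\<lambda>X Z Y. if X = 0 then 0 else second_differential B X Z Y)"
proof -
  have norm: "asym_norm \<Phi>" and smooth: "smooth_on \<Phi> (- {0})"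
    and conv: "\<And>v w. v \<noteq> 0 \<Longrightarrow> w \<noteq> 0 \<Longrightarrow> 0 < second_differential B v w w"
    using assms unfolding banach_minkowski_norm_def by auto
  have \<Phi>_pos: "0 < \<Phi> X" if "X \<noteq> 0" for X using norm that unfolding asym_norm_def by blast
  have \<Phi>_hom: "\<Phi> (t *\<^sub>R X) = t * \<Phi> X" if "0 \<le> t" for t X using norm that unfolding asym_norm_def by blast
  have \<Phi>: "(\<Phi> has_derivative frechet_derivative \<Phi> (at X)) (at X)" if "X \<noteq> 0" for X
    using smooth_on_differentiable[OF smooth] that by (intro has_frechet_derivative) auto
  have \<Phi>': "((\<lambda>X. frechet_derivative \<Phi> (at X) Y) has_derivative
      frechet_derivative (\<lambda>X. frechet_derivative \<Phi> (at X) Y) (at X)) (at X)" if "X \<noteq> 0" for X Y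
    using smooth_on_differentiable[OF smooth_on_deriv[OF smooth]] that by (intro has_frechet_derivative) auto
  have B: "(B has_derivative (\<lambda>Y. 2 * \<Phi> X * frechet_derivative \<Phi> (at X) Y)) (at X)" if "X \<noteq> 0" for X
    unfolding B_def using has_derivative_power[OF \<Phi>[OF that], of 2] by (simp add: mult_ac)
  have B1: "frechet_derivative B (at X) = (\<lambda>Y. 2 * \<Phi> X * frechet_derivative \<Phi> (at X) Y)" if "X \<noteq> 0" for X
    using frechet_derivative_at[OF B[OF that]] by simp
  have B2: "((\<lambda>X. frechet_derivative B (at X) Y) has_derivative (\<lambda>Z. second_differential B X Z Y)) (at X)"
    if X: "X \<noteq> 0" for X Y
  proof -
    have "(\<lambda>X. 2 * \<Phi> X * frechet_derivative \<Phi> (at X) Y) differentiable (at X)"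
      by (intro differentiable_mult differentiable_const differentiableI[OF \<Phi>[OF X]] differentiableI[OF \<Phi>'[OF X]])
    then obtain D where D: "((\<lambda>X. 2 * \<Phi> X * frechet_derivative \<Phi> (at X) Y) has_derivative D) (at X)"
      unfolding differentiable_def by blast
    have "((\<lambda>X. frechet_derivative B (at X) Y) has_derivative D) (at X)"
      by (rule has_derivative_transform_within_open[OF D, of "- {0}"]) (use X B1 in \<open>auto simp: open_Compl\<close>)
    with frechet_derivative_at[OF this] show ?thesis unfolding second_differential_def by simp
  qed
  show ?thesis
  proof
    show "0 < B X" if "X \<noteq> 0" for X using \<Phi>_pos[OF that] unfolding B_def by simp
    show "B (t *\<^sub>R X) = t\<^sup>2 * B X" if "0 \<le> t" for t X
      unfolding B_def \<Phi>_hom[OF that] by (rule power_mult_distrib)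
    show "(B has_derivative (\<lambda>Y. if X = 0 then 0 else frechet_derivative B (at X) Y)) (at X)" if "X \<noteq> 0" for X
      using B[OF that] that B1[OF that] by simp
    show "((\<lambda>X. if X = 0 then 0 else frechet_derivative B (at X) Y) has_derivative
        (\<lambda>Z. if X = 0 then 0 else second_differential B X Z Y)) (at X)" if X: "X \<noteq> 0" for X Y
    proof -
      have "((\<lambda>X. if X = 0 then 0 else frechet_derivative B (at X) Y) has_derivative (\<lambda>Z. second_differential B X Z Y)) (at X)"
        by (rule has_derivative_transform_within_open[OF B2[OF X], of "- {0}"]) (use X in \<open>auto simp: open_Compl\<close>)
      then show ?thesis using X by simp
    qed
  qed (use conv in auto)
qed

lemma surface_of_smooth_map:
  fixes F :: "real^2 \<Rightarrow> 'v::euclidean_space"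
  assumes \<Phi>: "banach_minkowski_norm \<Phi>" and F: "smooth_on F U" and U: "open U" and dim: "DIM('v) = 3"
    and inj: "\<And>x v. x \<in> U \<Longrightarrow> v \<noteq> 0 \<Longrightarrow> frechet_derivative F (at x) v \<noteq> 0"
  shows "surface (\<lambda>X. (\<Phi> X)\<^sup>2) (\<lambda>X Y. if X = 0 then 0 else frechet_derivative (\<lambda>X. (\<Phi> X)\<^sup>2) (at X) Y)
     (\<lambda>X Z Y. if X = 0 then 0 else second_differential (\<lambda>X. (\<Phi> X)\<^sup>2) X Z Y)
     U F (\<lambda>x v. if x \<in> U then frechet_derivative F (at x) v else 0) (second_differential F)
     (\<lambda>x s w v. frechet_derivative (\<lambda>y. second_differential F y w v) (at x) s)"
proof -
  have D: "(f has_derivative frechet_derivative f (at x)) (at x)" if "smooth_on f U" "x \<in> U" for f :: "real^2 \<Rightarrow> 'v" and x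
    by (rule has_frechet_derivative[OF smooth_on_differentiable[OF that]])
  have F2: "smooth_on (\<lambda>y. second_differential F y w v) U" for w v
    unfolding second_differential_def by (intro smooth_on_deriv F)
  show ?thesis
  proof (intro surface.intro surface_axioms.intro minkowski_energy_of_norm[OF \<Phi>] U dim)
    show "(F has_derivative (\<lambda>v. if x \<in> U then frechet_derivative F (at x) v else 0)) (at x)" if "x \<in> U" for x
      using D[OF F that] that by simp
    show "linear (\<lambda>v. if x \<in> U then frechet_derivative F (at x) v else 0)" for x
    proof (cases "x \<in> U")
      case True
      then show ?thesis using has_derivative_linear[OF D[OF F True]] by simp
    next
      case False
      then show ?thesis using linear_zero by simp
    qed
    show "((\<lambda>x. if x \<in> U then frechet_derivative F (at x) v else 0) has_derivative (\<lambda>w. second_differential F x w v)) (at x)"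
      if "x \<in> U" for x v
      unfolding second_differential_def
      by (rule has_derivative_transform_within_open[OF D[OF smooth_on_deriv[OF F] that] U that]) simp
    show "((\<lambda>x. second_differential F x u v) has_derivative
        (\<lambda>w. frechet_derivative (\<lambda>y. second_differential F y u v) (at x) w)) (at x)" if "x \<in> U" for x u v
      using D[OF F2 that] .
    show "(if x \<in> U then frechet_derivative F (at x) v else 0) \<noteq> 0" if "x \<in> U" "v \<noteq> 0" for x v
      using inj[OF that] that(1) by simp
  qed
qed

text \<open>Two functionals with the same kernel are proportional, and the product with
  \<open>n\<close> is one of them.\<close>

lemma (in surface) quotient_functional:
  assumes x: "x \<in> U" and n: "normal x n" and \<pi>: "quotient_map_to_real (range (d1 x)) \<pi>"
  shows "\<exists>c. c \<noteq> 0 \<and> (\<forall>y. \<pi> y = c * (n \<bullet> y))"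
proof -
  have lin: "linear \<pi>" and surj: "surj \<pi>" and ker: "{v. \<pi> v = 0} = range (d1 x)"
    using \<pi> unfolding quotient_map_to_real_def by auto
  have nn: "n \<bullet> n = 1" using n by (simp add: normal_def dot_square_norm)
  have eq: "\<pi> y = \<pi> n * (n \<bullet> y)" for y
  proof -
    have "n \<bullet> (y - (n \<bullet> y) *\<^sub>R n) = 0" by (simp add: inner_diff_right nn)
    then have "y - (n \<bullet> y) *\<^sub>R n \<in> {v. \<pi> v = 0}" unfolding ker by (rule normal_kernel[OF x n])
    then show ?thesis by (simp add: linear_diff[OF lin] linear_scale[OF lin])
  qed
  obtain z where "\<pi> z = 1" using surj by (metis surjD)
  then have "\<pi> n \<noteq> 0" using eq[of z] by auto
  then show ?thesis using eq by blast
qed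

lemma form_type_by_determinant:
  fixes T :: "('m, real^2) tangent_vector set" and k :: "('m, real^2) chart"
  assumes coords: "\<And>v. \<exists>\<xi>\<in>T. \<xi> k = v" and zero: "\<And>\<xi>. \<xi> \<in> T \<Longrightarrow> \<xi> k = 0 \<longleftrightarrow> \<xi> = (\<lambda>_. 0)"
    and h: "\<And>\<xi> \<eta>. h \<xi> \<eta> = symform a b c (\<xi> k) (\<eta> k)"
  shows "0 < a * c - b\<^sup>2 \<Longrightarrow> definite_form T h"
    and "a * c - b\<^sup>2 < 0 \<Longrightarrow> indefinite_form T h"
    and "a * c - b\<^sup>2 = 0 \<Longrightarrow> degenerate_form T h"
proof -
  show "definite_form T h" if "0 < a * c - b\<^sup>2"
    using symform_definite[OF that] zero unfolding definite_form_def h by blast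
  show "indefinite_form T h" if "a * c - b\<^sup>2 < 0"
    using symform_indefinite[OF that] coords unfolding indefinite_form_def h by metis
  show "degenerate_form T h" if "a * c - b\<^sup>2 = 0"
    using symform_degenerate[OF that] coords zero unfolding degenerate_form_def h by metis
qed

text \<open>A single embedding, read in the chart chosen at \<open>p\<close>. The chart depends on
  \<open>A\<close> and \<open>p\<close> only, so two embeddings yield surfaces over the same
  \<open>U\<close>.\<close>

locale embedded_surface = atlas M A
  for M :: "'m::{t2_space, second_countable_topology} set" and A :: "('m, real^2) chart set" +
  fixes \<phi> :: "'m \<times> ('m, real^2) tangent_vector \<Rightarrow> real" and \<Phi> :: "'v::euclidean_space \<Rightarrow> real"
    and f :: "'m \<Rightarrow> 'v" and p :: 'm
  assumes mono: "monochromatic M A \<phi>" and p: "p \<in> M" and dim: "DIM('v) = 3"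
    and norm: "banach_minkowski_norm \<Phi>" and iso: "isometric_embedding M A \<phi> \<Phi> f"
begin

abbreviation "k \<equiv> chart_at A p"
abbreviation "U \<equiv> snd k ` fst k"
abbreviation "F \<equiv> f \<circ> chart_inv k"
abbreviation "tv x v \<equiv> tangent_of_coords A (chart_inv k x) k v"
abbreviation "dF \<equiv> \<lambda>x v. if x \<in> U then frechet_derivative F (at x) v else 0"

lemma smooth: "smooth_map A f"
  and immersion: "q \<in> M \<Longrightarrow> inj_on (differential A f q) (tangent_space A q)"
  and isometric: "q \<in> M \<Longrightarrow> \<xi> \<in> tangent_space A q \<Longrightarrow> \<Phi> (differential A f q \<xi>) = \<phi> (q, \<xi>)"
  using iso unfolding isometric_embedding_def smooth_embedding_def smooth_immersion_def by auto

lemma k: "k \<in> A" "p \<in> fst k" using chart_at[OF p] by auto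

lemma base: "x \<in> U \<Longrightarrow> chart_inv k x \<in> fst k" "x \<in> U \<Longrightarrow> snd k (chart_inv k x) = x"
  "x \<in> U \<Longrightarrow> chart_inv k x \<in> M"
  using chart_inv_in[OF k(1)] chart_inv_right[OF k(1)] cover k(1) by blast+

lemma tv_in: "x \<in> U \<Longrightarrow> tv x v \<in> tangent_space A (chart_inv k x)"
  using tangent_of_coords_in[OF k(1) base(1)] .

lemma tv_k: "x \<in> U \<Longrightarrow> tv x v k = v"
  using tangent_of_coords_same[OF k(1) base(1)] .

lemma differential_coords:
  assumes "x \<in> U" "\<xi> \<in> tangent_space A (chart_inv k x)"
  shows "differential A f (chart_inv k x) \<xi> = dF x (\<xi> k)"
  using differential_in_chart[OF smooth k(1) base(1)[OF assms(1)] assms(2)] base(2)[OF assms(1)] assms(1) by simp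

text \<open>The right-hand side does not mention \<open>f\<close>: this is how the intrinsic metric
  fixes \<open>q\<close>.\<close>

lemma dF_norm: "x \<in> U \<Longrightarrow> \<Phi> (dF x v) = \<phi> (chart_inv k x, tv x v)"
  using differential_coords[OF _ tv_in, of x v] isometric[OF base(3) tv_in, of x v] tv_k[of x v] by simp

lemma dF_nonzero:
  assumes x: "x \<in> U" and v: "v \<noteq> 0" shows "frechet_derivative F (at x) v \<noteq> 0"
proof
  assume 0: "frechet_derivative F (at x) v = 0"
  have "linear (frechet_derivative F (at x))"
    using smooth k(1) x unfolding smooth_map_def by (intro linear_frechet_derivative smooth_on_differentiable) auto
  then have "frechet_derivative F (at x) 0 = 0" by (rule linear_0)
  then have "differential A f (chart_inv k x) (tv x v) = differential A f (chart_inv k x) (tv x 0)"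
    using differential_coords[OF x tv_in[OF x]] tv_k[OF x] 0 x by simp
  then have "tv x v = tv x 0" using immersion[OF base(3)[OF x]] tv_in[OF x] by (meson inj_onD)
  then show False using tv_k[OF x] v by metis
qed

lemma chart_surface: "surface (\<lambda>X. (\<Phi> X)\<^sup>2) (\<lambda>X Y. if X = 0 then 0 else frechet_derivative (\<lambda>X. (\<Phi> X)\<^sup>2) (at X) Y)
     (\<lambda>X Z Y. if X = 0 then 0 else second_differential (\<lambda>X. (\<Phi> X)\<^sup>2) X Z Y)
     U F dF (second_differential F)
     (\<lambda>x s w v. frechet_derivative (\<lambda>y. second_differential F y w v) (at x) s)"
  by (rule surface_of_smooth_map[OF norm _ open_chart_image[OF k(1)] dim dF_nonzero])
     (use smooth k(1) in \<open>auto simp: smooth_map_def\<close>)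

sublocale S: surface "\<lambda>X. (\<Phi> X)\<^sup>2" "\<lambda>X Y. if X = 0 then 0 else frechet_derivative (\<lambda>X. (\<Phi> X)\<^sup>2) (at X) Y"
     "\<lambda>X Z Y. if X = 0 then 0 else second_differential (\<lambda>X. (\<Phi> X)\<^sup>2) X Z Y"
     U F dF "second_differential F"
     "\<lambda>x s w v. frechet_derivative (\<lambda>y. second_differential F y w v) (at x) s"
  by (rule chart_surface)

lemma fibres_isometric: "S.isometric_fibres"
  unfolding S.isometric_fibres_def
proof (intro ballI)
  fix x y assume x: "x \<in> U" and y: "y \<in> U"
  let ?T = "tangent_space A (chart_inv k x)"
  obtain L where bij: "bij_betw L ?T (tangent_space A (chart_inv k y))"
    and add: "\<forall>\<xi>\<in>?T. \<forall>\<eta>\<in>?T. L (\<lambda>k. \<xi> k + \<eta> k) = (\<lambda>k. L \<xi> k + L \<eta> k)"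
    and scale: "\<forall>c. \<forall>\<xi>\<in>?T. L (\<lambda>k. c *\<^sub>R \<xi> k) = (\<lambda>k. c *\<^sub>R L \<xi> k)"
    and pres: "\<forall>\<xi>\<in>?T. \<phi> (chart_inv k y, L \<xi>) = \<phi> (chart_inv k x, \<xi>)"
    using mono[unfolded monochromatic_def isometric_tangent_spaces_def, rule_format, OF base(3)[OF x] base(3)[OF y]]
    by (elim exE conjE)
  define l where "l v = L (tv x v) k" for v
  have "linear l"
  proof (rule linearI)
    show "l (v + w) = l v + l w" for v w
      unfolding l_def tangent_of_coords_linear(1)[OF k(1) base(1)[OF x]] add[rule_format, OF tv_in[OF x] tv_in[OF x]] ..
    show "l (c *\<^sub>R v) = c *\<^sub>R l v" for c v
      unfolding l_def tangent_of_coords_linear(2)[OF k(1) base(1)[OF x]] scale[rule_format, OF tv_in[OF x]] ..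
  qed
  moreover have "S.q y (l v) = S.q x v" for v
  proof -
    have "L (tv x v) \<in> tangent_space A (chart_inv k y)" using bij_betwE[OF bij] tv_in[OF x] by blast
    then have "tv y (l v) = L (tv x v)"
      unfolding l_def using tangent_of_coords_eq[OF _ k(1) base(1)[OF y]] by blast
    then have "\<Phi> (dF y (l v)) = \<Phi> (dF x v)"
      using dF_norm[OF y, of "l v"] dF_norm[OF x, of v] pres[rule_format, OF tv_in[OF x], of v] by simp
    then show ?thesis unfolding S.q_def by simp
  qed
  ultimately show "\<exists>L. linear L \<and> (\<forall>v. S.q y (L v) = S.q x v)" by blast
qed

lemma second_differential_functional:
  assumes \<pi>: "linear \<pi>" and x: "x \<in> U"
  shows "second_differential (\<pi> \<circ> f \<circ> chart_inv k) x u v = \<pi> (second_differential F x u v)"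
proof -
  have bl: "bounded_linear \<pi>" using \<pi> by (simp add: linear_conv_bounded_linear)
  have 1: "frechet_derivative (\<pi> \<circ> f \<circ> chart_inv k) (at y) v = \<pi> (dF y v)" if y: "y \<in> U" for y
  proof -
    have "((\<lambda>y. \<pi> (F y)) has_derivative (\<lambda>v. \<pi> (dF y v))) (at y)"
      by (rule bounded_linear.has_derivative[OF bl S.F_der[OF y]])
    from fun_cong[OF frechet_derivative_at[OF this], of v] show ?thesis by (simp add: o_def)
  qed
  have "((\<lambda>y. \<pi> (dF y v)) has_derivative (\<lambda>w. \<pi> (second_differential F x w v))) (at x)"
    by (rule bounded_linear.has_derivative[OF bl S.d1_der[OF x]])
  then have "((\<lambda>y. frechet_derivative (\<pi> \<circ> f \<circ> chart_inv k) (at y) v) has_derivative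
      (\<lambda>w. \<pi> (second_differential F x w v))) (at x)"
    by (rule has_derivative_transform_within_open[OF _ open_chart_image[OF k(1)] x]) (simp add: 1)
  from fun_cong[OF frechet_derivative_at[OF this], of u] show ?thesis
    unfolding second_differential_def[of "\<pi> \<circ> f \<circ> chart_inv k"] by simp
qed

lemma form_type:
  assumes h: "second_fundamental_form_of A f p h" and n: "S.normal (snd k p) n"
  shows "0 < S.shape_det (snd k p) n \<Longrightarrow> definite_form (tangent_space A p) h"
    and "S.shape_det (snd k p) n < 0 \<Longrightarrow> indefinite_form (tangent_space A p) h"
    and "S.shape_det (snd k p) n = 0 \<Longrightarrow> degenerate_form (tangent_space A p) h"
proof -
  let ?x = "snd k p" and ?T = "tangent_space A p"
  have x: "?x \<in> U" using k(2) by blast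
  have px: "chart_inv k ?x = p" using chart_inv_left[OF k] .
  obtain \<pi> where \<pi>: "quotient_map_to_real (differential A f p ` ?T) \<pi>" and h': "h = hessian A (\<pi> \<circ> f) p"
    using h unfolding second_fundamental_form_of_def by blast
  have coords: "\<exists>\<xi>\<in>?T. \<xi> k = v" for v using tv_in[OF x, of v] tv_k[OF x, of v] unfolding px by blast
  have zero: "\<xi> k = 0 \<longleftrightarrow> \<xi> = (\<lambda>_. 0)" if "\<xi> \<in> ?T" for \<xi>
  proof
    assume "\<xi> k = 0"
    \<comment> \<open>Zero is written as a multiple so that homogeneity of
      \<open>tangent_of_coords\<close> applies.\<close>
    then have "\<xi> = tv ?x (0 *\<^sub>R 0)" using tangent_of_coords_eq[OF that k] px by simp
    then show "\<xi> = (\<lambda>_. 0)" unfolding tangent_of_coords_linear(2)[OF k(1) base(1)[OF x]] by simp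
  qed simp
  have "differential A f p ` ?T = range (dF ?x)"
  proof (intro equalityI subsetI)
    fix y assume "y \<in> differential A f p ` ?T"
    then show "y \<in> range (dF ?x)" using differential_coords[OF x] unfolding px by blast
  next
    fix y assume "y \<in> range (dF ?x)"
    then obtain v where "y = dF ?x v" by blast
    then have "y = differential A f p (tv ?x v)"
      using differential_coords[OF x tv_in[OF x], of v] tv_k[OF x, of v] unfolding px by simp
    then show "y \<in> differential A f p ` ?T" using tv_in[OF x, of v] unfolding px by blast
  qed
  with \<pi> have \<pi>': "quotient_map_to_real (range (dF ?x)) \<pi>" by simp
  obtain c where c: "c \<noteq> 0" "\<And>y. \<pi> y = c * (n \<bullet> y)" using S.quotient_functional[OF x n \<pi>'] by blast
  let ?s = "\<lambda>u v. n \<bullet> second_differential F ?x u v"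
  have form: "h \<xi> \<eta> = symform (c * ?s e1 e1) (c * ?s e1 e2) (c * ?s e2 e2) (\<xi> k) (\<eta> k)" for \<xi> \<eta>
  proof -
    have "linear \<pi>" using \<pi> unfolding quotient_map_to_real_def by blast
    then have "h \<xi> \<eta> = \<pi> (second_differential F ?x (\<xi> k) (\<eta> k))"
      unfolding h' hessian_def Let_def by (rule second_differential_functional[OF _ x])
    also have "\<dots> = c * symform (?s e1 e1) (?s e1 e2) (?s e2 e2) (\<xi> k) (\<eta> k)"
      unfolding c(2) S.shape_form[OF x, of n "\<xi> k" "\<eta> k"] ..
    finally show ?thesis by (simp add: symform_def algebra_simps)
  qed
  \<comment> \<open>The factor is a square, so the choice of the quotient map does not affect the
    sign.\<close>
  have det: "(c * ?s e1 e1) * (c * ?s e2 e2) - (c * ?s e1 e2)\<^sup>2 = c\<^sup>2 * S.shape_det ?x n"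
    unfolding S.shape_det_def by (simp add: power2_eq_square algebra_simps)
  have "c\<^sup>2 > 0" using c(1) by simp
  note types = form_type_by_determinant[where T = ?T and k = k and h = h and a = "c * ?s e1 e1"
      and b = "c * ?s e1 e2" and c = "c * ?s e2 e2", OF coords zero form, unfolded det]
  show "0 < S.shape_det ?x n \<Longrightarrow> definite_form ?T h"
    by (rule types(1)) (use \<open>c\<^sup>2 > 0\<close> in simp_all)
  show "S.shape_det ?x n < 0 \<Longrightarrow> indefinite_form ?T h"
    by (rule types(2)) (use \<open>c\<^sup>2 > 0\<close> in \<open>simp_all add: mult_less_0_iff\<close>)
  show "S.shape_det ?x n = 0 \<Longrightarrow> degenerate_form ?T h"
    by (rule types(3)) simp_all
qed

end

theorem corollary4p4:
  fixes M :: "'m::{t2_space, second_countable_topology} set"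
    and A :: "('m, real^2) chart set"
    and \<phi> :: "'m \<times> ('m, real^2) tangent_vector \<Rightarrow> real"
    and \<Phi>\<^sub>1 :: "'v::euclidean_space \<Rightarrow> real"
    and \<Phi>\<^sub>2 :: "'w::euclidean_space \<Rightarrow> real"
    and f\<^sub>1 :: "'m \<Rightarrow> 'v"
    and f\<^sub>2 :: "'m \<Rightarrow> 'w"
    and p :: 'm
    and h\<^sub>1 h\<^sub>2 :: "('m, real^2) tangent_vector \<Rightarrow> ('m, real^2) tangent_vector \<Rightarrow> real"
  assumes "finsler_manifold M A \<phi>"
    and "monochromatic M A \<phi>"
    and "p \<in> M"
    and "DIM('v) = 3" and "DIM('w) = 3"
    and "banach_minkowski_norm \<Phi>\<^sub>1" and "banach_minkowski_norm \<Phi>\<^sub>2"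
    and "isometric_embedding M A \<phi> \<Phi>\<^sub>1 f\<^sub>1"
    and "isometric_embedding M A \<phi> \<Phi>\<^sub>2 f\<^sub>2"
    and "second_fundamental_form_of A f\<^sub>1 p h\<^sub>1"
    and "second_fundamental_form_of A f\<^sub>2 p h\<^sub>2"
  shows "(definite_form (tangent_space A p) h\<^sub>1 \<and> definite_form (tangent_space A p) h\<^sub>2) \<or>
    (indefinite_form (tangent_space A p) h\<^sub>1 \<and> indefinite_form (tangent_space A p) h\<^sub>2) \<or>
    (degenerate_form (tangent_space A p) h\<^sub>1 \<and> degenerate_form (tangent_space A p) h\<^sub>2)"
proof -
  have manifold: "smooth_manifold M A" using assms(1) unfolding finsler_manifold_def by blast
  interpret E1: embedded_surface M A \<phi> \<Phi>\<^sub>1 f\<^sub>1 p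
    using assms manifold by unfold_locales
  interpret E2: embedded_surface M A \<phi> \<Phi>\<^sub>2 f\<^sub>2 p
    using assms manifold by unfold_locales
  let ?k = "chart_at A p"
  let ?x = "snd ?k p"
  have x: "?x \<in> snd ?k ` fst ?k" using E1.k(2) by blast
  obtain n where n: "E1.S.normal ?x n" using E1.S.normal_exists[OF x] .
  obtain m where m: "E2.S.normal ?x m" using E2.S.normal_exists[OF x] .
  \<comment> \<open>Both embeddings are read in the same chart, and each side is the square of the
    intrinsic norm.\<close>
  have eq: "(\<Phi>\<^sub>1 (E1.dF y v))\<^sup>2 = (\<Phi>\<^sub>2 (E2.dF y v))\<^sup>2" if "y \<in> snd ?k ` fst ?k" for y v
    unfolding E1.dF_norm[OF that] E2.dF_norm[OF that] ..
  have sgn: "sgn (E1.S.shape_det ?x n) = sgn (E2.S.shape_det ?x m)"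
    by (rule shape_det_sign_intrinsic[OF E1.chart_surface E2.chart_surface eq E1.fibres_isometric x n m])
  note t1 = E1.form_type[OF assms(10) n] and t2 = E2.form_type[OF assms(11) m]
  consider "0 < E1.S.shape_det ?x n" "0 < E2.S.shape_det ?x m"
    | "E1.S.shape_det ?x n < 0" "E2.S.shape_det ?x m < 0"
    | "E1.S.shape_det ?x n = 0" "E2.S.shape_det ?x m = 0"
    using sgn by (auto simp: sgn_real_def split: if_splits)
  then show ?thesis
    by cases (use t1 t2 in auto)
qed

end
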